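(* Let $\mathcal{G}$ be a convex class of distributions with $E_Gu^2(X,\theta)<\infty$ for all $G\in\mathcal{G}$. Let $\mathcal{G}_*\subseteq\mathcal{G}$ be such that $$\mathcal{V}_*\equiv\{v(x):E_Gv(X)=E_Gu(X,\theta),\ E_Gv^2(X)<\infty\ \ \forall G\in\mathcal{G}_*\}$$ is nonempty. For each $G_0$ let $v_{G_0}\equiv\arg\min\{E_{G_0}(v(X)-u(X,\theta))^2:v\in\mathcal{V}_{G_0}\}$. Suppose that for all $G_0\in\mathcal{G}_*$, $v_{G_0}\in\mathcal{V}_*$ and, as $(\varepsilon,n)\to(0,\infty)$, $$\sup\Big\{\Big|\sum_{j=1}^n\frac{v_G(X_j)-v_{G_0}(X_j)}{n^{1/2}}\Big|:\|v_G-v_{G_0}\|_{G_0}\le\varepsilon,\ G\in\mathcal{G}_*\Big\}\to0\quad\text{in }P_{G_0}\text{-probability}.$$ Let $\widehat G$ be an estimator of $G$ (based on $X_1,\dots,X_n$) such that $P_{G_0}(\widehat G\in\mathcal{G}_* )\to1$ and $\|v_{\widehat G}-v_{G_0}\|_{G_0}\to0$ in $P_{G_0}$-probability for all $G_0\in\mathcal{G}_*$. Then $$\widehat V_n\equiv\sum_{j=1}^nv_{\widehat G}(X_j)$$ is an asymptotically efficient estimator of $S_n=\sum_{j=1}^nu(X_j,\theta_j)$ at $P_{G_0}$ for all $G_0\in\mathcal{G}_*$.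
   Context: Under $P_G$ (with expectation $E_G$), $(X,\theta),(X_1,\theta_1),(X_2,\theta_2),\dots$ are i.i.d. with $\theta\sim G$ and, given $\theta$, $X$ has density $f(x|\theta)$ with respect to a measure $\nu$, where $f(\cdot|\cdot)$ is known; $f_G(x)\equiv\int f(x|\vartheta)G(d\vartheta)$. The $X_j$ are observed, the $\theta_j$ and $G\in\mathcal{G}$ are unknown. The utility $u(x,\vartheta)$ is a known Borel function, and $v$ denotes Borel functions of $x$ only. $\|h\|_G\equiv\{E_Gh^2(X)\}^{1/2}$; in $\|v_{\widehat G}-v_{G_0}\|_{G_0}$ the expectation is over $X$ only, with $\widehat G$ held fixed. For $G_0\in\mathcal{G}$, $$\mathcal{G}_{G_0}\equiv\Big\{G\in\mathcal{G}:E_{G_0}\big(f_G(X)/f_{G_0}(X)\big)^2<\infty,\ \int f_GI\{f_{G_0}>0\}\,d\nu=1\Big\},\qquad \mathcal{V}_{G_0}\equiv\{v(x):E_Gv(X)=E_Gu(X,\theta)\ \forall G\in\mathcal{G}_{G_0}\}.$$ An estimator $\widetilde S_n$ (a function of $X_1,\dots,X_n$) of $S_n$ is regular at $P_{G_0}$ if there is a random variable $\xi_0$ such that for all $c>0$ and all $G\in\mathcal{G}_{G_0}$, with $G_t\equiv(1-t)G_0+tG$, the law of $n^{-1/2}(\widetilde S_n-S_n)$ under $P_{G_{c/\sqrt n}}$ converges weakly to the law of $\xi_0$ (the same for all $c$ and $G$). It is asymptotically efficient at $P_{G_0}$ if it is regular at $P_{G_0}$ and $E\xi_0^2$ equals the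 sharp lower bound for the variance of the limits $\xi_0$ of all estimators of $S_n$ regular at $P_{G_0}$. *)

theory Defs
  imports "HOL-Probability.Probability"
begin

text \<open>
  The parameter space is the measurable space T, the observation space is that of the dominating
  measure \<open>\<nu>\<close>. A distribution \<open>G\<close> of the parameter is a probability measure with the sigma-algebra
  of T, and \<open>f x \<theta>\<close> is the density at x given \<open>\<theta>\<close>.
\<close>

definition kernel_density :: "'x measure \<Rightarrow> 't measure \<Rightarrow> ('x \<Rightarrow> 't \<Rightarrow> real) \<Rightarrow> bool" where
  "kernel_density \<nu> T f \<longleftrightarrow>
     case_prod f \<in> borel_measurable (\<nu> \<Otimes>\<^sub>M T) \<and>
     (\<forall>x\<in>space \<nu>. \<forall>\<theta>\<in>space T. 0 \<le> f x \<theta>) \<and>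
     (\<forall>\<theta>\<in>space T. (\<integral>\<^sup>+ x. ennreal (f x \<theta>) \<partial>\<nu>) = 1)"

definition distribution_on :: "'t measure \<Rightarrow> 't measure \<Rightarrow> bool" where
  "distribution_on T G \<longleftrightarrow> prob_space G \<and> sets G = sets T"

text \<open>The mixture \<open>(1 - t) G\<^sub>0 + t G\<close>; only meaningful for \<open>t\<close> in the unit interval.\<close>

definition mix :: "real \<Rightarrow> 't measure \<Rightarrow> 't measure \<Rightarrow> 't measure" where
  "mix t G0 G = measure_of (space G0) (sets G0)
     (\<lambda>A. ennreal (1 - t) * emeasure G0 A + ennreal t * emeasure G A)"

lemma sets_mix [simp]: "sets (mix t G0 G) = sets G0"
  by (simp add: mix_def)

lemma space_mix [simp]: "space (mix t G0 G) = space G0"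
  by (simp add: mix_def)

lemma emeasure_mix:
  assumes "sets G = sets G0" "A \<in> sets G0"
  shows "emeasure (mix t G0 G) A = ennreal (1 - t) * emeasure G0 A + ennreal t * emeasure G A"
proof -
  have "countably_additive (sets G0)
     (\<lambda>A. ennreal (1 - t) * emeasure G0 A + ennreal t * emeasure G A)"
    using assms(1)
    by (auto simp: countably_additive_def suminf_add [symmetric] suminf_emeasure)
  then show ?thesis
    using assms(2) unfolding mix_def
    by (intro emeasure_measure_of_sigma) (auto simp: positive_def sets.sigma_algebra_axioms)
qed

definition convex_class :: "'t measure set \<Rightarrow> bool" where
  "convex_class \<G> \<longleftrightarrow> (\<forall>G0\<in>\<G>. \<forall>G\<in>\<G>. \<forall>t\<in>{0..1}. mix t G0 G \<in> \<G>)"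

text \<open>The joint law of \<open>(X, \<theta>)\<close> under \<open>P\<^sub>G\<close>, and that of \<open>(X\<^sub>j, \<theta>\<^sub>j)\<close>, \<open>j < n\<close>.\<close>

definition joint :: "'x measure \<Rightarrow> ('x \<Rightarrow> 't \<Rightarrow> real) \<Rightarrow> 't measure \<Rightarrow> ('x \<times> 't) measure" where
  "joint \<nu> f G = density (\<nu> \<Otimes>\<^sub>M G) (\<lambda>(x, \<theta>). ennreal (f x \<theta>))"

definition sample ::
    "'x measure \<Rightarrow> ('x \<Rightarrow> 't \<Rightarrow> real) \<Rightarrow> 't measure \<Rightarrow> nat \<Rightarrow> (nat \<Rightarrow> 'x \<times> 't) measure" where
  "sample \<nu> f G n = (\<Pi>\<^sub>M j\<in>{..<n}. joint \<nu> f G)"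

definition observations :: "nat \<Rightarrow> (nat \<Rightarrow> 'x \<times> 't) \<Rightarrow> (nat \<Rightarrow> 'x)" where
  "observations n \<omega> = (\<lambda>j\<in>{..<n}. fst (\<omega> j))"

definition utility_sum :: "('x \<Rightarrow> 't \<Rightarrow> real) \<Rightarrow> nat \<Rightarrow> (nat \<Rightarrow> 'x \<times> 't) \<Rightarrow> real" where
  "utility_sum u n \<omega> = (\<Sum>j<n. u (fst (\<omega> j)) (snd (\<omega> j)))"

definition mixture_density :: "('x \<Rightarrow> 't \<Rightarrow> real) \<Rightarrow> 't measure \<Rightarrow> 'x \<Rightarrow> ennreal" where
  "mixture_density f G x = (\<integral>\<^sup>+ \<theta>. ennreal (f x \<theta>) \<partial>G)"

text \<open>\<open>\<parallel>h\<parallel>\<^sub>G\<close>, with value \<open>\<infinity>\<close> if \<open>h\<close> is not square integrable.\<close>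

definition norm_G ::
    "'x measure \<Rightarrow> ('x \<Rightarrow> 't \<Rightarrow> real) \<Rightarrow> 't measure \<Rightarrow> ('x \<Rightarrow> real) \<Rightarrow> ennreal" where
  "norm_G \<nu> f G h =
     (let I = \<integral>\<^sup>+ (x, \<theta>). ennreal ((h x)\<^sup>2) \<partial>joint \<nu> f G
      in if I = \<infinity> then \<infinity> else ennreal (sqrt (enn2real I)))"

text \<open>The class \<open>\<G>\<^bsub>G\<^sub>0\<^esub>\<close>. The value of the quotient where the denominator is 0 or \<open>\<infinity>\<close> is
  irrelevant: this has probability 0 under \<open>P\<^bsub>G\<^sub>0\<^esub>\<close>.\<close>

definition local_class ::
    "'x measure \<Rightarrow> ('x \<Rightarrow> 't \<Rightarrow> real) \<Rightarrow> 't measure set \<Rightarrow> 't measure \<Rightarrow> 't measure set" where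
  "local_class \<nu> f \<G> G0 =
     {G \<in> \<G>.
        (\<integral>\<^sup>+ (x, \<theta>). (mixture_density f G x / mixture_density f G0 x)\<^sup>2 \<partial>joint \<nu> f G0) < \<infinity> \<and>
        (\<integral>\<^sup>+ x. mixture_density f G x * indicator {x. mixture_density f G0 x > 0} x \<partial>\<nu>) = 1}"

text \<open>\<open>E\<^sub>G v(X) = E\<^sub>G u(X, \<theta>)\<close>, where \<open>E\<^sub>G v(X)\<close> is required to exist.\<close>

definition unbiased ::
    "'x measure \<Rightarrow> ('x \<Rightarrow> 't \<Rightarrow> real) \<Rightarrow> ('x \<Rightarrow> 't \<Rightarrow> real) \<Rightarrow> 't measure \<Rightarrow> ('x \<Rightarrow> real) \<Rightarrow> bool" where
  "unbiased \<nu> f u G v \<longleftrightarrow>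
     integrable (joint \<nu> f G) (\<lambda>(x, \<theta>). v x) \<and>
     (LINT (x, \<theta>)|joint \<nu> f G. v x) = (LINT (x, \<theta>)|joint \<nu> f G. u x \<theta>)"

definition local_unbiased_functions ::
    "'x measure \<Rightarrow> ('x \<Rightarrow> 't \<Rightarrow> real) \<Rightarrow> ('x \<Rightarrow> 't \<Rightarrow> real) \<Rightarrow> 't measure set \<Rightarrow> 't measure
      \<Rightarrow> ('x \<Rightarrow> real) set" where
  "local_unbiased_functions \<nu> f u \<G> G0 =
     {v \<in> borel_measurable \<nu>. \<forall>G\<in>local_class \<nu> f \<G> G0. unbiased \<nu> f u G v}"

definition square_integrable_unbiased_functions ::
    "'x measure \<Rightarrow> ('x \<Rightarrow> 't \<Rightarrow> real) \<Rightarrow> ('x \<Rightarrow> 't \<Rightarrow> real) \<Rightarrow> 't measure set \<Rightarrow> ('x \<Rightarrow> real) set" where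
  "square_integrable_unbiased_functions \<nu> f u \<G>s =
     {v \<in> borel_measurable \<nu>. \<forall>G\<in>\<G>s.
        unbiased \<nu> f u G v \<and> integrable (joint \<nu> f G) (\<lambda>(x, \<theta>). (v x)\<^sup>2)}"

definition mean_square_error ::
    "'x measure \<Rightarrow> ('x \<Rightarrow> 't \<Rightarrow> real) \<Rightarrow> ('x \<Rightarrow> 't \<Rightarrow> real) \<Rightarrow> 't measure \<Rightarrow> ('x \<Rightarrow> real) \<Rightarrow> ennreal" where
  "mean_square_error \<nu> f u G v = (\<integral>\<^sup>+ (x, \<theta>). ennreal ((v x - u x \<theta>)\<^sup>2) \<partial>joint \<nu> f G)"

text \<open>
  Convergence to 0 in probability of \<open>[0, \<infinity>]\<close>-valued maps. They need not be measurable
  (think of an uncountable supremum), so outer probability is used.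
\<close>

definition tendsto_0_in_prob ::
    "('i \<Rightarrow> 'a measure) \<Rightarrow> ('i \<Rightarrow> 'a \<Rightarrow> ennreal) \<Rightarrow> 'i filter \<Rightarrow> bool" where
  "tendsto_0_in_prob M Y F \<longleftrightarrow>
     (\<forall>\<delta>>0. ((\<lambda>i. outer_measure_of (M i) {\<omega> \<in> space (M i). Y i \<omega> > ennreal \<delta>}) \<longlongrightarrow> 0) F)"

text \<open>A sequence of estimators: \<open>S n\<close> is a real random variable in the observations \<open>X\<^sub>j\<close>, \<open>j < n\<close>.\<close>

definition estimator_seq :: "'x measure \<Rightarrow> (nat \<Rightarrow> (nat \<Rightarrow> 'x) \<Rightarrow> real) \<Rightarrow> bool" where
  "estimator_seq \<nu> S \<longleftrightarrow> (\<forall>n. S n \<in> borel_measurable (\<Pi>\<^sub>M j\<in>{..<n}. \<nu>))"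

definition error_law ::
    "'x measure \<Rightarrow> ('x \<Rightarrow> 't \<Rightarrow> real) \<Rightarrow> ('x \<Rightarrow> 't \<Rightarrow> real) \<Rightarrow> 't measure
      \<Rightarrow> (nat \<Rightarrow> (nat \<Rightarrow> 'x) \<Rightarrow> real) \<Rightarrow> nat \<Rightarrow> real measure" where
  "error_law \<nu> f u G S n = distr (sample \<nu> f G n) borel
     (\<lambda>\<omega>. (S n (observations n \<omega>) - utility_sum u n \<omega>) / sqrt (real n))"

text \<open>
  \<open>S\<close> is regular at \<open>P\<^bsub>G\<^sub>0\<^esub>\<close> and \<open>L\<close> is the law of the limit \<open>\<xi>\<^sub>0\<close>. For the finitely many \<open>n\<close> with
  \<open>c / sqrt n > 1\<close> the term \<open>mix (c / sqrt n) G0 G\<close> is junk, which does not affect the limit.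
\<close>

definition regular_with_limit ::
    "'x measure \<Rightarrow> ('x \<Rightarrow> 't \<Rightarrow> real) \<Rightarrow> ('x \<Rightarrow> 't \<Rightarrow> real) \<Rightarrow> 't measure set \<Rightarrow> 't measure
      \<Rightarrow> (nat \<Rightarrow> (nat \<Rightarrow> 'x) \<Rightarrow> real) \<Rightarrow> real measure \<Rightarrow> bool" where
  "regular_with_limit \<nu> f u \<G> G0 S L \<longleftrightarrow>
     estimator_seq \<nu> S \<and> real_distribution L \<and>
     (\<forall>c>0. \<forall>G\<in>local_class \<nu> f \<G> G0.
        weak_conv_m (\<lambda>n. error_law \<nu> f u (mix (c / sqrt (real n)) G0 G) S n) L)"

text \<open>
  The variance of a law on the reals, as an extended real. If the mean does not exist, the Bochner
  integral is 0 and the value is \<open>\<infinity>\<close>, as it should be.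
\<close>

definition law_variance :: "real measure \<Rightarrow> ennreal" where
  "law_variance L = (\<integral>\<^sup>+ y. ennreal ((y - (LINT z|L. z))\<^sup>2) \<partial>L)"

definition law_second_moment :: "real measure \<Rightarrow> ennreal" where
  "law_second_moment L = (\<integral>\<^sup>+ y. ennreal (y\<^sup>2) \<partial>L)"

definition variance_bound ::
    "'x measure \<Rightarrow> ('x \<Rightarrow> 't \<Rightarrow> real) \<Rightarrow> ('x \<Rightarrow> 't \<Rightarrow> real) \<Rightarrow> 't measure set \<Rightarrow> 't measure \<Rightarrow> ennreal" where
  "variance_bound \<nu> f u \<G> G0 =
     Inf {law_variance L | L. \<exists>S. regular_with_limit \<nu> f u \<G> G0 S L}"

definition asymptotically_efficient ::
    "'x measure \<Rightarrow> ('x \<Rightarrow> 't \<Rightarrow> real) \<Rightarrow> ('x \<Rightarrow> 't \<Rightarrow> real) \<Rightarrow> 't measure set \<Rightarrow> 't measure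
      \<Rightarrow> (nat \<Rightarrow> (nat \<Rightarrow> 'x) \<Rightarrow> real) \<Rightarrow> bool" where
  "asymptotically_efficient \<nu> f u \<G> G0 S \<longleftrightarrow>
     (\<exists>L. regular_with_limit \<nu> f u \<G> G0 S L \<and>
          law_second_moment L = variance_bound \<nu> f u \<G> G0)"

end

theory Submission
  imports Defs "HOL-Complex_Analysis.Great_Picard" "HOL-Real_Asymp.Real_Asymp"
begin

text \<open>The estimator enters the characteristic function of its error only through a factor of
  modulus one that depends on the observations. The other factor is a product over the coordinates,
  and averaging out \<open>\<theta>\<close> turns it into conditional means given X. Taking absolute
  values then gives a bound valid for every estimator. Two different quantities meet in it: for one
  coordinate, the real part of the mean of the factor minus 1 is about
  \<open>- s\<^sup>2 \<sigma>\<^sup>2 / (2 n)\<close>, with the full variance of \<open>w\<close>,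
  while its squared distance from 1 sees only the projection \<open>g\<close>. For real parameters
  the scores and \<open>g\<close> contribute to the real and the imaginary part and cannot cancel;
  for imaginary ones they can. Regularity speaks of positive parameters only, because mixing moves
  towards \<open>G\<close> and never away from it, whereas a linear combination of scores has
  coefficients of both signs. Two directions suffice, since the local class is closed under
  mixtures. Under a local alternative \<open>G\<close> has weight of order 1 / \<surd>n, so that
  there a first-order expansion is enough, and it asks only for integrability of
  \<open>w\<close>.\<close>

text \<open>
  Write \<open>w = v\<^sub>0 (X) - u (X, \<theta>)\<close> and \<open>\<sigma>\<^sup>2 = E w\<^sup>2\<close> under \<open>P\<^bsub>G\<^sub>0\<^esub>\<close>. By stochastic equicontinuity the
  estimator differs from \<open>\<Sum> v\<^sub>0 (X\<^sub>j)\<close> by \<open>o (\<surd>n)\<close> under \<open>P\<^bsub>G\<^sub>0\<^esub>\<close>, and under the local alternatives by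
  contiguity; since \<open>w\<close> has mean 0 under all of them, characteristic functions give the limit
  \<open>N (0, \<sigma>\<^sup>2)\<close>, although \<open>w\<close> need not be square integrable under \<open>G\<close>.

  For the lower bound, the characteristic function at \<open>s\<close> of the normalised error of an arbitrary
  regular estimator under a local alternative \<open>G\<^sub>0 + (t\<^sub>1 (G\<^sub>1 - G\<^sub>0) + t\<^sub>2 (G\<^sub>2 - G\<^sub>0)) / \<surd>n\<close> is a polynomial in
  \<open>(t\<^sub>1, t\<^sub>2)\<close> that is bounded locally uniformly on complex pairs. By Montel's theorem and the identity
  theorem its limit, which is constant for positive reals, is bounded by its growth at imaginary
  arguments. There the bound is \<open>exp ((s\<^sup>2 E (g - d)\<^sup>2 - s\<^sup>2 \<sigma>\<^sup>2) / 2)\<close>, where \<open>g (X) = E (w | X)\<close> and \<open>d\<close> is a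
  linear combination of the scores \<open>f\<^bsub>G\<^esub> / f\<^bsub>G\<^sub>0\<^esub> - 1\<close>. Minimality of \<open>v\<^sub>0\<close> means that \<open>g\<close> is in the closed
  linear span of the scores, so the limit law has a characteristic function bounded by that of
  \<open>N (0, \<sigma>\<^sup>2)\<close>, and hence variance at least \<open>\<sigma>\<^sup>2\<close>.
\<close>

section \<open>Mixtures of measures and product measures\<close>

text \<open>The three measures are related only through their values on sets, so that the fact
  serves both for \<open>mix\<close> and for the joint laws of mixtures.\<close>

lemma nn_integral_combination:
  assumes sets: "sets A = sets M" "sets B = sets M"
    and em: "\<And>S. S \<in> sets M \<Longrightarrow> emeasure M S = a * emeasure A S + b * emeasure B S"
    and h: "h \<in> borel_measurable M"
  shows "(\<integral>\<^sup>+x. h x \<partial>M) = a * (\<integral>\<^sup>+x. h x \<partial>A) + b * (\<integral>\<^sup>+x. h x \<partial>B)"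
  using h
proof (induction rule: borel_measurable_induct)
  case (cong f g)
  moreover have "space A = space M" "space B = space M"
    using sets by (auto dest: sets_eq_imp_space_eq)
  ultimately show ?case
    by (metis (no_types, lifting) nn_integral_cong)
next
  case (set S)
  then show ?case
    using sets by (simp add: em)
next
  case (mult h c)
  then show ?case
    using sets by (simp add: nn_integral_cmult distrib_left ac_simps cong: measurable_cong_sets)
next
  case (add h g)
  then show ?case
    using sets by (simp add: nn_integral_add distrib_left ac_simps cong: measurable_cong_sets)
next
  case (seq U)
  then have m: "U i \<in> borel_measurable A" "U i \<in> borel_measurable B" "U i \<in> borel_measurable M" for i
    using sets by (simp_all cong: measurable_cong_sets)
  have sp: "space A = space M" "space B = space M"
    using sets by (auto dest: sets_eq_imp_space_eq)
  have mono: "incseq (\<lambda>i. \<integral>\<^sup>+ x. U i x \<partial>N)" for N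
    using seq(3) by (auto simp: incseq_def le_fun_def intro!: nn_integral_mono)
  have conv: "(\<integral>\<^sup>+ x. (SUP i. U i) x \<partial>N) = (SUP i. \<integral>\<^sup>+ x. U i x \<partial>N)" if "sets N = sets M" for N
    using that m seq(3) by (simp add: image_comp nn_integral_monotone_convergence_SUP cong: measurable_cong_sets)
  have "(\<integral>\<^sup>+ x. (SUP i. U i) x \<partial>M) = (SUP i. a * (\<integral>\<^sup>+ x. U i x \<partial>A) + b * (\<integral>\<^sup>+ x. U i x \<partial>B))"
    using conv[OF refl] by (simp add: seq.IH del: SUP_apply Sup_apply)
  also have "\<dots> = (SUP i. a * (\<integral>\<^sup>+ x. U i x \<partial>A)) + (SUP i. b * (\<integral>\<^sup>+ x. U i x \<partial>B))"
    using mono by (intro ennreal_SUP_add) (auto simp: incseq_def intro!: mult_left_mono)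
  also have "\<dots> = a * (\<integral>\<^sup>+ x. (SUP i. U i) x \<partial>A) + b * (\<integral>\<^sup>+ x. (SUP i. U i) x \<partial>B)"
    by (simp only: conv[OF sets(1)] conv[OF sets(2)] SUP_mult_left_ennreal)
  finally show ?case by simp
qed

lemma
  fixes h :: "'a \<Rightarrow> complex"
  assumes sets: "sets A = sets M" "sets B = sets M"
    and ab: "0 \<le> a" "0 \<le> b"
    and em: "\<And>S. S \<in> sets M \<Longrightarrow> emeasure M S = ennreal a * emeasure A S + ennreal b * emeasure B S"
    and h: "integrable A h" "integrable B h"
  shows integrable_combination: "integrable M h"
    and integral_combination: "integral\<^sup>L M h = a * integral\<^sup>L A h + b * integral\<^sup>L B h"
proof -
  note nn = nn_integral_combination[OF sets em]
  have [measurable]: "h \<in> borel_measurable M"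
    using borel_measurable_integrable[OF h(1)] sets by (simp cong: measurable_cong_sets)
  have intg: "integrable M k" if "integrable A k" "integrable B k" for k :: "'a \<Rightarrow> 'b::{banach,second_countable_topology}"
  proof -
    have [measurable]: "k \<in> borel_measurable M"
      using borel_measurable_integrable[OF that(1)] sets by (simp cong: measurable_cong_sets)
    show ?thesis
      using that by (auto simp: integrable_iff_bounded nn ennreal_mult_less_top)
  qed
  then show "integrable M h" using h by blast
  have real: "integral\<^sup>L M k = a * integral\<^sup>L A k + b * integral\<^sup>L B k" if k: "integrable A k" "integrable B k" for k :: "'a \<Rightarrow> real"
  proof -
    have [measurable]: "k \<in> borel_measurable M"
      using borel_measurable_integrable[OF that(1)] sets by (simp cong: measurable_cong_sets)
    have *: "enn2real (\<integral>\<^sup>+x. ennreal (l x) \<partial>M) = a * enn2real (\<integral>\<^sup>+x. ennreal (l x) \<partial>A) + b * enn2real (\<integral>\<^sup>+x. ennreal (l x) \<partial>B)"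
      if l: "l = k \<or> l = (\<lambda>x. - k x)" for l
    proof -
      have [measurable]: "l \<in> borel_measurable M" using l by auto
      have "integrable A l" "integrable B l" using l k by auto
      then have "(\<integral>\<^sup>+x. ennreal (l x) \<partial>A) < \<infinity>" "(\<integral>\<^sup>+x. ennreal (l x) \<partial>B) < \<infinity>"
        by (auto elim!: integrableE simp: less_top[symmetric] ennreal_less_top)
      then show ?thesis
        using ab by (subst nn) (auto simp: enn2real_plus ennreal_mult_less_top enn2real_mult)
    qed
    show ?thesis
      using intg[OF k] k by (simp add: real_lebesgue_integral_def * algebra_simps)
  qed
  have "integrable A (\<lambda>x. Re (h x))" "integrable B (\<lambda>x. Re (h x))" "integrable A (\<lambda>x. Im (h x))" "integrable B (\<lambda>x. Im (h x))"
    using h by auto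
  from real[OF this(1,2)] real[OF this(3,4)]
  show "integral\<^sup>L M h = a * integral\<^sup>L A h + b * integral\<^sup>L B h"
    using intg[OF h] h by (intro complex_eqI) auto
qed

text \<open>The factors of the product that depend on the second component may be averaged out,
  one coordinate at a time.\<close>

lemma integral_PiM_marginal:
  fixes e :: "'a \<times> 'b \<Rightarrow> complex" and K :: "'a \<Rightarrow> complex" and n :: nat
  assumes J: "finite_measure J" and P: "finite_measure P"
    and fst [measurable]: "fst \<in> measurable J N" and sets: "sets P = sets N"
    and e: "integrable J e" and K: "integrable P K"
    and eq: "\<And>\<phi> C. \<phi> \<in> borel_measurable N \<Longrightarrow> (\<And>x. norm (\<phi> x) \<le> C) \<Longrightarrow>
        (\<integral>z. \<phi> (fst z) * e z \<partial>J) = (\<integral>x. \<phi> x * K x \<partial>P)"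
  shows "A \<in> borel_measurable (\<Pi>\<^sub>M j\<in>{..<n}. N) \<Longrightarrow> (\<And>x. norm (A x) \<le> C) \<Longrightarrow>
         (\<integral>\<omega>. A (\<lambda>j\<in>{..<n}. fst (\<omega> j)) * (\<Prod>j<n. e (\<omega> j)) \<partial>(\<Pi>\<^sub>M j\<in>{..<n}. J)) =
         (\<integral>x. A x * (\<Prod>j<n. K (x j)) \<partial>(\<Pi>\<^sub>M j\<in>{..<n}. P))"
proof (induction n arbitrary: A C)
  case 0
  show ?case
    by (simp add: PiM_empty lebesgue_integral_count_space_finite restrict_def)
next
  case (Suc n)
  interpret J: finite_measure J by fact
  interpret P: finite_measure P by fact
  interpret PJ: product_sigma_finite "\<lambda>_. J" by standard
  interpret PP: product_sigma_finite "\<lambda>_. P" by standard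
  interpret PPn: finite_product_sigma_finite "\<lambda>_. P" "{..<n}" by standard auto
  have em [measurable]: "e \<in> borel_measurable J" using e by auto
  have Km [measurable]: "K \<in> borel_measurable P" using K by auto
  have ins: "{..<Suc n} = insert n {..<n}" by auto
  note A [measurable] = Suc.prems(1)
  have A' [measurable]: "A \<in> borel_measurable (\<Pi>\<^sub>M j\<in>insert n {..<n}. N)"
    using A unfolding ins by simp
  have AP [measurable]: "A \<in> borel_measurable (\<Pi>\<^sub>M j\<in>insert n {..<n}. P)"
    using A' sets by (simp cong: measurable_cong_sets sets_PiM_cong)
  have C0: "0 \<le> C" using Suc.prems(2)[of undefined] norm_ge_zero order_trans by blast
  \<comment> \<open>Integrating out the last coordinate replaces \<open>A\<close> by
    \<open>?B\<close>, a function of the first \<open>n\<close> observations, and the bound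
    \<open>C\<close> by \<open>C\<close> times the mean of the norm of \<open>K\<close>. Hence the
    induction runs over arbitrary \<open>A\<close> and \<open>C\<close>.\<close>
  let ?B = "\<lambda>x. \<integral>y. A (x(n := y)) * K y \<partial>P"
  have obs: "(\<lambda>j\<in>insert n {..<n}. fst (fun_upd \<omega> n z j)) = fun_upd (\<lambda>j\<in>{..<n}. fst (\<omega> j)) n (fst z)" for \<omega> :: "nat \<Rightarrow> 'a \<times> 'b" and z
    by (auto simp: restrict_def)
  have upd: "(\<Prod>j\<in>insert n {..<n}. e (fun_upd \<omega> n z j)) = e z * (\<Prod>j<n. e (\<omega> j))" for \<omega> :: "nat \<Rightarrow> 'a \<times> 'b" and z
    by (subst prod.insert) (auto intro!: prod.cong)
  have updP: "(\<Prod>j\<in>insert n {..<n}. K (fun_upd x n y j)) = K y * (\<Prod>j<n. K (x j))" for x y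
    by (subst prod.insert) (auto intro!: prod.cong)
  have intJ: "integrable (\<Pi>\<^sub>M j\<in>insert n {..<n}. J) (\<lambda>\<omega>. A (\<lambda>j\<in>insert n {..<n}. fst (\<omega> j)) * (\<Prod>j\<in>insert n {..<n}. e (\<omega> j)))"
  proof (rule Bochner_Integration.integrable_bound)
    show "integrable (\<Pi>\<^sub>M j\<in>insert n {..<n}. J) (\<lambda>\<omega>. C * (\<Prod>j\<in>insert n {..<n}. e (\<omega> j)))"
      by (intro integrable_mult_right PJ.product_integrable_prod) (auto intro: e)
  qed (use Suc.prems(2) C0 in \<open>auto simp: norm_mult simp del: prod.insert intro!: mult_right_mono\<close>)
  have intP: "integrable (\<Pi>\<^sub>M j\<in>insert n {..<n}. P) (\<lambda>\<omega>. A \<omega> * (\<Prod>j\<in>insert n {..<n}. K (\<omega> j)))"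
  proof (rule Bochner_Integration.integrable_bound)
    show "integrable (\<Pi>\<^sub>M j\<in>insert n {..<n}. P) (\<lambda>\<omega>. C * (\<Prod>j\<in>insert n {..<n}. K (\<omega> j)))"
      by (intro integrable_mult_right PP.product_integrable_prod) (auto intro: K)
  qed (use Suc.prems(2) C0 in \<open>auto simp: norm_mult simp del: prod.insert intro!: mult_right_mono\<close>)
  have inner: "(\<integral>z. A (x(n := fst z)) * e z \<partial>J) = ?B x" if x: "x \<in> space (\<Pi>\<^sub>M j\<in>{..<n}. N)" for x
  proof (rule eq[of _ C])
    show "(\<lambda>y. A (x(n := y))) \<in> borel_measurable N"
      using x by measurable
  qed (rule Suc.prems(2))
  have Bm: "?B \<in> borel_measurable (\<Pi>\<^sub>M j\<in>{..<n}. N)"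
  proof -
    have "?B \<in> borel_measurable (\<Pi>\<^sub>M j\<in>{..<n}. P)"
      by (rule P.borel_measurable_lebesgue_integral) (simp add: split_beta, measurable)
    then show ?thesis using sets by (simp cong: measurable_cong_sets sets_PiM_cong)
  qed
  have Bb: "norm (?B x) \<le> C * (\<integral>y. norm (K y) \<partial>P)" for x
  proof -
    have "norm (?B x) \<le> (\<integral>y. norm (A (x(n := y)) * K y) \<partial>P)" by simp
    also have "\<dots> \<le> (\<integral>y. C * norm (K y) \<partial>P)"
      using K Suc.prems(2) C0 by (intro integral_mono') (auto simp: norm_mult intro!: mult_right_mono)
    finally show ?thesis by simp
  qed
  have "(\<integral>\<omega>. A (\<lambda>j\<in>{..<Suc n}. fst (\<omega> j)) * (\<Prod>j<Suc n. e (\<omega> j)) \<partial>(\<Pi>\<^sub>M j\<in>{..<Suc n}. J)) =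
     (\<integral>\<omega>. (\<integral>z. A (fun_upd (\<lambda>j\<in>{..<n}. fst (\<omega> j)) n (fst z)) * (e z * (\<Prod>j<n. e (\<omega> j))) \<partial>J) \<partial>(\<Pi>\<^sub>M j\<in>{..<n}. J))"
    unfolding ins by (subst PJ.product_integral_insert[OF _ _ intJ]) (simp_all only: obs upd, auto)
  also have "\<dots> = (\<integral>\<omega>. (\<integral>z. A (fun_upd (\<lambda>j\<in>{..<n}. fst (\<omega> j)) n (fst z)) * e z \<partial>J) * (\<Prod>j<n. e (\<omega> j)) \<partial>(\<Pi>\<^sub>M j\<in>{..<n}. J))"
    by (simp only: mult.assoc[symmetric] integral_mult_left_zero)
  also have "\<dots> = (\<integral>\<omega>. ?B (\<lambda>j\<in>{..<n}. fst (\<omega> j)) * (\<Prod>j<n. e (\<omega> j)) \<partial>(\<Pi>\<^sub>M j\<in>{..<n}. J))"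
  proof (intro Bochner_Integration.integral_cong refl arg_cong2[where f = "(*)"] inner)
    fix \<omega> assume "\<omega> \<in> space (\<Pi>\<^sub>M j\<in>{..<n}. J)"
    then show "(\<lambda>j\<in>{..<n}. fst (\<omega> j)) \<in> space (\<Pi>\<^sub>M j\<in>{..<n}. N)"
      using measurable_space[OF fst] by (auto simp: space_PiM PiE_def Pi_def)
  qed
  also have "\<dots> = (\<integral>x. ?B x * (\<Prod>j<n. K (x j)) \<partial>(\<Pi>\<^sub>M j\<in>{..<n}. P))"
    by (rule Suc.IH[OF Bm Bb])
  also have "\<dots> = (\<integral>x. (\<integral>y. A (x(n := y)) * (K y * (\<Prod>j<n. K (x j))) \<partial>P) \<partial>(\<Pi>\<^sub>M j\<in>{..<n}. P))"
    by (simp only: mult.assoc[symmetric] integral_mult_left_zero)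
  also have "\<dots> = (\<integral>x. A x * (\<Prod>j<Suc n. K (x j)) \<partial>(\<Pi>\<^sub>M j\<in>{..<Suc n}. P))"
    unfolding ins by (subst PP.product_integral_insert[OF _ _ intP]) (simp_all only: updP, auto)
  finally show ?case .
qed

section \<open>Square integrable functions\<close>

lemma L2_product_integrable:
  fixes a b :: "'a \<Rightarrow> real"
  assumes [measurable]: "a \<in> borel_measurable M" "b \<in> borel_measurable M"
    and i: "integrable M (\<lambda>x. (a x)\<^sup>2)" "integrable M (\<lambda>x. (b x)\<^sup>2)"
  shows "integrable M (\<lambda>x. a x * b x)"
proof (rule Bochner_Integration.integrable_bound)
  show "integrable M (\<lambda>x. (a x)\<^sup>2 + (b x)\<^sup>2)" using i by auto
  have "\<bar>a x * b x\<bar> \<le> (a x)\<^sup>2 + (b x)\<^sup>2" for x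
  proof -
    have "2 * \<bar>a x * b x\<bar> \<le> (a x)\<^sup>2 + (b x)\<^sup>2"
      using sum_squares_bound[of "\<bar>a x\<bar>" "\<bar>b x\<bar>"] by (simp add: abs_mult)
    then show ?thesis by linarith
  qed
  then show "AE x in M. norm (a x * b x) \<le> norm ((a x)\<^sup>2 + (b x)\<^sup>2)" by simp
qed simp

lemma L2_combination_integrable:
  fixes a b :: "'a \<Rightarrow> real"
  assumes "a \<in> borel_measurable M" "b \<in> borel_measurable M"
    and "integrable M (\<lambda>x. (a x)\<^sup>2)" "integrable M (\<lambda>x. (b x)\<^sup>2)"
  shows "integrable M (\<lambda>x. (s * a x + t * b x)\<^sup>2)"
proof -
  have "integrable M (\<lambda>x. s\<^sup>2 * (a x)\<^sup>2 + (2 * s * t) * (a x * b x) + t\<^sup>2 * (b x)\<^sup>2)"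
    using assms L2_product_integrable[OF assms] by auto
  then show ?thesis
    by (simp add: power2_sum power_mult_distrib algebra_simps)
qed

lemma L2_Cauchy_Schwarz:
  fixes a b :: "'a \<Rightarrow> real"
  assumes [measurable]: "a \<in> borel_measurable M" "b \<in> borel_measurable M"
    and i: "integrable M (\<lambda>x. (a x)\<^sup>2)" "integrable M (\<lambda>x. (b x)\<^sup>2)"
  shows "(\<integral>x. a x * b x \<partial>M)\<^sup>2 \<le> (\<integral>x. (a x)\<^sup>2 \<partial>M) * (\<integral>x. (b x)\<^sup>2 \<partial>M)"
proof -
  have nonneg: "0 \<le> (\<integral>x. (a x)\<^sup>2 \<partial>M)" "0 \<le> (\<integral>x. (b x)\<^sup>2 \<partial>M)" "0 \<le> (\<integral>x. \<bar>a x * b x\<bar> \<partial>M)"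
    by auto
  have "integrable M (\<lambda>x. a x * b x)" by (rule L2_product_integrable) fact+
  then have "ennreal (\<integral>x. \<bar>a x * b x\<bar> \<partial>M) = (\<integral>\<^sup>+x. ennreal \<bar>a x * b x\<bar> \<partial>M)"
    by (subst nn_integral_eq_integral) auto
  also have "\<dots> = (\<integral>\<^sup>+x. ennreal \<bar>a x\<bar> * ennreal \<bar>b x\<bar> \<partial>M)"
    by (simp add: abs_mult ennreal_mult)
  finally have "ennreal ((\<integral>x. \<bar>a x * b x\<bar> \<partial>M)\<^sup>2) = (\<integral>\<^sup>+x. ennreal \<bar>a x\<bar> * ennreal \<bar>b x\<bar> \<partial>M)\<^sup>2"
    by (metis ennreal_power nonneg(3))
  also have "\<dots> \<le> (\<integral>\<^sup>+x. (ennreal \<bar>a x\<bar>)\<^sup>2 \<partial>M) * (\<integral>\<^sup>+x. (ennreal \<bar>b x\<bar>)\<^sup>2 \<partial>M)"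
    by (intro Cauchy_Schwarz_nn_integral) auto
  also have "\<dots> = ennreal ((\<integral>x. (a x)\<^sup>2 \<partial>M) * (\<integral>x. (b x)\<^sup>2 \<partial>M))"
    using i by (simp add: ennreal_power nn_integral_eq_integral ennreal_mult)
  finally have "(\<integral>x. \<bar>a x * b x\<bar> \<partial>M)\<^sup>2 \<le> (\<integral>x. (a x)\<^sup>2 \<partial>M) * (\<integral>x. (b x)\<^sup>2 \<partial>M)"
    using nonneg by (subst (asm) ennreal_le_iff) auto
  moreover have "(\<integral>x. a x * b x \<partial>M)\<^sup>2 \<le> (\<integral>x. \<bar>a x * b x\<bar> \<partial>M)\<^sup>2"
    using integral_abs_bound[of M "\<lambda>x. a x * b x"] by (metis abs_ge_zero power2_abs power_mono)
  ultimately show ?thesis by linarith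
qed

text \<open>The increments are rescaled to have a common summable bound \<open>Q\<close>, so that the limit
  exists almost everywhere and no appeal to Fatou's lemma is needed.\<close>

lemma L2_complete:
  fixes d :: "nat \<Rightarrow> 'a \<Rightarrow> real"
  assumes [measurable]: "\<And>k. d k \<in> borel_measurable M"
    and inc: "\<And>k. (\<integral>\<^sup>+x. ennreal ((d (Suc k) x - d k x)\<^sup>2) \<partial>M) \<le> ennreal ((1/4) ^ k)"
  obtains l where "l \<in> borel_measurable M"
    and "\<And>k. (\<integral>\<^sup>+x. ennreal ((l x - d k x)\<^sup>2) \<partial>M) \<le> ennreal (4 * (1/2) ^ k)"
proof -
  define Q where "Q x = (\<Sum>j. ennreal (2 ^ j * (d (Suc j) x - d j x)\<^sup>2))" for x
  have [measurable]: "Q \<in> borel_measurable M" unfolding Q_def by measurable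
  have "(\<integral>\<^sup>+x. Q x \<partial>M) = (\<Sum>j. \<integral>\<^sup>+x. ennreal (2 ^ j * (d (Suc j) x - d j x)\<^sup>2) \<partial>M)"
    unfolding Q_def by (intro nn_integral_suminf) measurable
  also have "\<dots> \<le> (\<Sum>j. ennreal ((1/2) ^ j))"
  proof (intro suminf_le summableI)
    fix j
    have "(\<integral>\<^sup>+x. ennreal (2 ^ j * (d (Suc j) x - d j x)\<^sup>2) \<partial>M) = ennreal (2 ^ j) * (\<integral>\<^sup>+x. ennreal ((d (Suc j) x - d j x)\<^sup>2) \<partial>M)"
      by (simp add: ennreal_mult nn_integral_cmult)
    also have "\<dots> \<le> ennreal (2 ^ j) * ennreal ((1/4) ^ j)"
      by (intro mult_left_mono inc) simp
    also have "\<dots> = ennreal ((1/2) ^ j)"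
      by (simp add: ennreal_mult[symmetric] power_mult_distrib[symmetric])
    finally show "(\<integral>\<^sup>+x. ennreal (2 ^ j * (d (Suc j) x - d j x)\<^sup>2) \<partial>M) \<le> ennreal ((1/2) ^ j)" .
  qed
  also have "\<dots> = ennreal (\<Sum>j. (1/2) ^ j)"
    by (intro suminf_ennreal2 summable_geometric) auto
  also have "(\<Sum>j. (1/2::real) ^ j) = 2"
    by (subst suminf_geometric) auto
  finally have Q2: "(\<integral>\<^sup>+x. Q x \<partial>M) \<le> 2" by simp
  then have fin: "AE x in M. Q x \<noteq> \<infinity>"
    by (intro nn_integral_PInf_AE) (auto simp: top_unique)
  have bound: "(d m x - d k x)\<^sup>2 \<le> 2 * (1/2) ^ k * enn2real (Q x)" if Qx: "Q x \<noteq> \<infinity>" and "k \<le> m" for x k m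
  proof -
    let ?q = "\<lambda>j. 2 ^ j * (d (Suc j) x - d j x)\<^sup>2"
    have "d m x - d k x = (\<Sum>j=k..<m. d (Suc j) x - d j x)"
      using \<open>k \<le> m\<close> by (simp add: sum_Suc_diff'[of k m "\<lambda>j. d j x"])
    \<comment> \<open>The weights \<open>2 ^ j\<close> are inserted so that Cauchy-Schwarz separates
      a geometric tail of size at most \<open>2 * (1/2) ^ k\<close> from a partial sum of
      \<open>Q x\<close>.\<close>
    also have "\<dots> = (\<Sum>j=k..<m. sqrt ((1/2) ^ j) * (sqrt (2 ^ j) * (d (Suc j) x - d j x)))"
      by (simp add: real_sqrt_mult[symmetric] mult.assoc[symmetric] power_mult_distrib[symmetric])
    finally have "(d m x - d k x)\<^sup>2 = (\<Sum>j=k..<m. sqrt ((1/2) ^ j) * (sqrt (2 ^ j) * (d (Suc j) x - d j x)))\<^sup>2"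
      by simp
    also have "\<dots> \<le> (\<Sum>j=k..<m. (sqrt ((1/2) ^ j))\<^sup>2) * (\<Sum>j=k..<m. (sqrt (2 ^ j) * (d (Suc j) x - d j x))\<^sup>2)"
      by (rule Cauchy_Schwarz_ineq_sum)
    also have "\<dots> = (\<Sum>j=k..<m. (1/2) ^ j) * (\<Sum>j=k..<m. ?q j)"
      by (simp add: power_mult_distrib)
    also have "\<dots> \<le> (2 * (1/2) ^ k) * enn2real (Q x)"
    proof (intro mult_mono sum_nonneg)
      have "(\<Sum>j=k..<m. (1/2::real) ^ j) = 2 * (1/2) ^ k - 2 * (1/2) ^ m"
        using \<open>k \<le> m\<close> by (induction rule: dec_induct) auto
      then show "(\<Sum>j=k..<m. (1/2::real) ^ j) \<le> 2 * (1/2) ^ k" by simp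
      have "ennreal (\<Sum>j=k..<m. ?q j) = (\<Sum>j=k..<m. ennreal (?q j))"
        by (intro sum_ennreal[symmetric]) auto
      also have "\<dots> \<le> Q x"
        unfolding Q_def by (rule sum_le_suminf) auto
      also have "\<dots> = ennreal (enn2real (Q x))"
        using Qx by (simp add: less_top)
      finally show "(\<Sum>j=k..<m. ?q j) \<le> enn2real (Q x)"
        by (simp add: ennreal_le_iff)
    qed auto
    finally show ?thesis .
  qed
  define l where "l x = lim (\<lambda>k. d k x)" for x
  have conv: "(\<lambda>k. d k x) \<longlonglongrightarrow> l x" if Qx: "Q x \<noteq> \<infinity>" for x
  proof -
    let ?c = "sqrt (2 * enn2real (Q x))"
    have le: "\<bar>d m x - d k x\<bar> \<le> ?c * sqrt ((1/2) ^ k)" if "k \<le> m" for k m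
    proof -
      have "sqrt ((d m x - d k x)\<^sup>2) \<le> sqrt (2 * (1/2) ^ k * enn2real (Q x))"
        using bound[OF Qx that] by (rule real_sqrt_le_mono)
      also have "2 * (1/2) ^ k * enn2real (Q x) = (2 * enn2real (Q x)) * (1/2) ^ k" by simp
      finally show ?thesis
        by (simp only: real_sqrt_abs real_sqrt_mult)
    qed
    have "(\<lambda>k. ?c * sqrt ((1/2) ^ k)) \<longlonglongrightarrow> ?c * sqrt 0"
      by (intro tendsto_intros LIMSEQ_power_zero) auto
    then have lim0: "(\<lambda>k. ?c * sqrt ((1/2) ^ k)) \<longlonglongrightarrow> 0" by simp
    have "Cauchy (\<lambda>k. d k x)"
    proof (rule metric_CauchyI)
      fix e :: real assume "0 < e"
      then obtain N where N: "\<And>k. k \<ge> N \<Longrightarrow> ?c * sqrt ((1/2) ^ k) < e / 2"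
        using order_tendstoD(2)[OF lim0, of "e / 2"] by (auto simp: eventually_sequentially)
      show "\<exists>N. \<forall>m\<ge>N. \<forall>n\<ge>N. dist (d m x) (d n x) < e"
      proof (intro exI allI impI)
        fix m n assume "N \<le> m" "N \<le> n"
        then show "dist (d m x) (d n x) < e"
          using le[of N m] le[of N n] N[of N] by (simp add: dist_real_def)
      qed
    qed
    then show ?thesis
      unfolding l_def by (simp add: Cauchy_convergent_iff convergent_LIMSEQ_iff)
  qed
  show ?thesis
  proof (rule that)
    show "l \<in> borel_measurable M" unfolding l_def by measurable
    fix k
    have "(\<integral>\<^sup>+x. ennreal ((l x - d k x)\<^sup>2) \<partial>M) \<le> (\<integral>\<^sup>+x. ennreal (2 * (1/2) ^ k) * Q x \<partial>M)"
    proof (rule nn_integral_mono_AE, use fin in eventually_elim)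
      fix x assume Qx: "Q x \<noteq> \<infinity>"
      have "(\<lambda>m. (d m x - d k x)\<^sup>2) \<longlonglongrightarrow> (l x - d k x)\<^sup>2"
        by (intro tendsto_intros conv Qx)
      then have "(l x - d k x)\<^sup>2 \<le> 2 * (1/2) ^ k * enn2real (Q x)"
        using bound[OF Qx] by (intro LIMSEQ_le_const2) auto
      then have "ennreal ((l x - d k x)\<^sup>2) \<le> ennreal (2 * (1/2) ^ k * enn2real (Q x))"
        by (rule ennreal_leI)
      then show "ennreal ((l x - d k x)\<^sup>2) \<le> ennreal (2 * (1/2) ^ k) * Q x"
        using Qx by (simp add: ennreal_mult less_top)
    qed
    also have "\<dots> = ennreal (2 * (1/2) ^ k) * (\<integral>\<^sup>+x. Q x \<partial>M)"
      by (intro nn_integral_cmult) measurable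
    also have "\<dots> \<le> ennreal (2 * (1/2) ^ k) * ennreal 2"
      using Q2 by (intro mult_left_mono) auto
    finally show "(\<integral>\<^sup>+x. ennreal ((l x - d k x)\<^sup>2) \<partial>M) \<le> ennreal (4 * (1/2) ^ k)"
      by (simp add: ennreal_mult[symmetric] del: ennreal_numeral)
  qed
qed

text \<open>Hilbert space projection, carried out on functions: a minimising sequence in
  \<open>D\<close> is Cauchy by the parallelogram law, its limit \<open>l\<close> leaves a remainder
  \<open>w = g - l\<close> orthogonal to \<open>D\<close>, and by \<open>perp\<close> also
  orthogonal to \<open>g\<close>; so \<open>w\<close> has norm 0.\<close>

lemma L2_dense_criterion:
  fixes D :: "('a \<Rightarrow> real) set" and g :: "'a \<Rightarrow> real"
  assumes Dm: "\<And>d. d \<in> D \<Longrightarrow> d \<in> borel_measurable M"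
    and Di: "\<And>d. d \<in> D \<Longrightarrow> integrable M (\<lambda>x. (d x)\<^sup>2)"
    and ne: "D \<noteq> {}"
    and lin: "\<And>d e s t. d \<in> D \<Longrightarrow> e \<in> D \<Longrightarrow> (\<lambda>x. s * d x + t * e x) \<in> D"
    and gm: "g \<in> borel_measurable M" and gi: "integrable M (\<lambda>x. (g x)\<^sup>2)"
    and perp: "\<And>w. w \<in> borel_measurable M \<Longrightarrow> integrable M (\<lambda>x. (w x)\<^sup>2) \<Longrightarrow>
        (\<And>d. d \<in> D \<Longrightarrow> (\<integral>x. w x * d x \<partial>M) = 0) \<Longrightarrow> (\<integral>x. w x * g x \<partial>M) = 0"
    and "0 < \<epsilon>"
  shows "\<exists>d\<in>D. (\<integral>x. (g x - d x)\<^sup>2 \<partial>M) < \<epsilon>"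
proof -
  define N where "N d = (\<integral>x. (g x - d x)\<^sup>2 \<partial>M)" for d
  define I where "I = Inf (N ` D)"
  have N0: "0 \<le> N d" for d unfolding N_def by auto
  have bdd: "bdd_below (N ` D)" using N0 by (auto intro!: bdd_belowI2[where m = 0])
  have I_le: "I \<le> N d" if "d \<in> D" for d
    unfolding I_def using that bdd by (intro cINF_lower) auto
  have diff_i: "integrable M (\<lambda>x. (a x - b x)\<^sup>2)"
    if "a \<in> borel_measurable M" "b \<in> borel_measurable M" "integrable M (\<lambda>x. (a x)\<^sup>2)" "integrable M (\<lambda>x. (b x)\<^sup>2)"
    for a b :: "'a \<Rightarrow> real"
    using L2_combination_integrable[OF that, of 1 "-1"] by simp
  have gd: "integrable M (\<lambda>x. (g x - d x)\<^sup>2)" if "d \<in> D" for d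
    using Dm Di gm gi that by (intro diff_i) auto
  \<comment> \<open>With this tolerance the parallelogram law bounds the squared increments by
    \<open>(1/4) ^ k\<close>, the rate that \<open>L2_complete\<close> asks for.\<close>
  have "\<exists>d\<in>D. N d < I + (1/4) ^ k / 8" for k :: nat
  proof -
    have "\<exists>y\<in>N ` D. y < I + (1/4) ^ k / 8"
      using ne bdd unfolding I_def by (subst cInf_less_iff[symmetric]) auto
    then show ?thesis by auto
  qed
  then obtain d where dD: "\<And>k. d k \<in> D" and dN: "\<And>k. N (d k) < I + (1/4) ^ k / 8"
    by metis
  note [measurable] = Dm[OF dD] gm
  have dd: "integrable M (\<lambda>x. (d j x - d k x)\<^sup>2)" for j k
    using Dm Di dD by (intro diff_i) auto
  have par: "(\<integral>x. (d (Suc k) x - d k x)\<^sup>2 \<partial>M) \<le> (1/4) ^ k" for k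
  proof -
    define h where "h = (\<lambda>x. (1/2) * d (Suc k) x + (1/2) * d k x)"
    have hD: "h \<in> D" unfolding h_def by (intro lin dD)
    have "(\<integral>x. (d (Suc k) x - d k x)\<^sup>2 \<partial>M) =
        (\<integral>x. 2 * (g x - d (Suc k) x)\<^sup>2 + 2 * (g x - d k x)\<^sup>2 - 4 * (g x - h x)\<^sup>2 \<partial>M)"
      by (intro Bochner_Integration.integral_cong refl) (simp add: h_def power2_eq_square algebra_simps)
    also have "\<dots> = 2 * N (d (Suc k)) + 2 * N (d k) - 4 * N h"
      unfolding N_def using gd[OF dD] gd[OF hD] by simp
    also have "\<dots> \<le> 2 * (I + (1/4) ^ Suc k / 8) + 2 * (I + (1/4) ^ k / 8) - 4 * I"
      by (intro add_mono diff_mono mult_left_mono less_imp_le[OF dN] I_le hD) auto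
    also have "\<dots> \<le> (1/4) ^ k" by (simp add: field_simps)
    finally show ?thesis .
  qed
  obtain l where [measurable]: "l \<in> borel_measurable M"
    and l: "\<And>k. (\<integral>\<^sup>+x. ennreal ((l x - d k x)\<^sup>2) \<partial>M) \<le> ennreal (4 * (1/2) ^ k)"
    using par dd by (rule_tac L2_complete[of d M]) (auto simp: nn_integral_eq_integral ennreal_leI)
  have ld: "integrable M (\<lambda>x. (l x - d k x)\<^sup>2)" for k
    using le_less_trans[OF l[of k]] by (auto simp: integrable_iff_bounded)
  have ldN: "(\<integral>x. (l x - d k x)\<^sup>2 \<partial>M) \<le> 4 * (1/2) ^ k" for k
    using l[of k] ld[of k] by (simp add: nn_integral_eq_integral ennreal_le_iff)
  have li: "integrable M (\<lambda>x. (l x)\<^sup>2)"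
    using L2_combination_integrable[OF _ _ ld[of 0] Di[OF dD[of 0]], of 1 1] by simp
  define w where "w x = g x - l x" for x
  have [measurable]: "w \<in> borel_measurable M" unfolding w_def by measurable
  have wi: "integrable M (\<lambda>x. (w x)\<^sup>2)"
    unfolding w_def using li gi by (intro diff_i) auto
  have lim_inner: "(\<lambda>k. \<integral>x. (l x - d k x) * e x \<partial>M) \<longlonglongrightarrow> 0"
    if [measurable]: "e \<in> borel_measurable M" and e: "integrable M (\<lambda>x. (e x)\<^sup>2)" for e
  proof -
    have "(\<lambda>k. 4 * (1/2) ^ k * (\<integral>x. (e x)\<^sup>2 \<partial>M)) \<longlonglongrightarrow> 4 * 0 * (\<integral>x. (e x)\<^sup>2 \<partial>M)"
      by (intro tendsto_intros LIMSEQ_power_zero) auto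
    then have 0: "(\<lambda>k. 4 * (1/2) ^ k * (\<integral>x. (e x)\<^sup>2 \<partial>M)) \<longlonglongrightarrow> 0" by simp
    have "(\<integral>x. (l x - d k x) * e x \<partial>M)\<^sup>2 \<le> 4 * (1/2) ^ k * (\<integral>x. (e x)\<^sup>2 \<partial>M)" for k
    proof -
      have "(\<integral>x. (l x - d k x) * e x \<partial>M)\<^sup>2 \<le> (\<integral>x. (l x - d k x)\<^sup>2 \<partial>M) * (\<integral>x. (e x)\<^sup>2 \<partial>M)"
        using ld e by (intro L2_Cauchy_Schwarz) auto
      also have "\<dots> \<le> 4 * (1/2) ^ k * (\<integral>x. (e x)\<^sup>2 \<partial>M)"
        using ldN by (intro mult_right_mono) auto
      finally show ?thesis .
    qed
    then have "(\<lambda>k. (\<integral>x. (l x - d k x) * e x \<partial>M)\<^sup>2) \<longlonglongrightarrow> 0"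
      by (intro real_tendsto_sandwich[OF _ _ tendsto_const 0]) auto
    from tendsto_real_sqrt[OF this] show ?thesis
      by (simp add: tendsto_rabs_zero_iff)
  qed
  have we: "(\<integral>x. w x * e x \<partial>M) = 0" if e: "e \<in> D" for e
  proof -
    let ?c = "\<integral>x. w x * e x \<partial>M" and ?E = "\<integral>x. (e x)\<^sup>2 \<partial>M"
    note [measurable] = Dm[OF e]
    have lim: "(\<lambda>k. \<integral>x. (g x - d k x) * e x \<partial>M) \<longlonglongrightarrow> ?c"
    proof -
      have "(\<integral>x. (g x - d k x) * e x \<partial>M) = ?c + (\<integral>x. (l x - d k x) * e x \<partial>M)" for k
      proof -
        have "integrable M (\<lambda>x. w x * e x)" "integrable M (\<lambda>x. (l x - d k x) * e x)"
          using wi ld Di[OF e] by (auto intro!: L2_product_integrable)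
        then show ?thesis
          by (subst Bochner_Integration.integral_add[symmetric]) (auto simp: w_def algebra_simps)
      qed
      then show ?thesis
        using tendsto_add[OF tendsto_const lim_inner[OF Dm[OF e] Di[OF e]], of ?c] by simp
    qed
    \<comment> \<open>The competitor \<open>d k + t * e\<close> lies in \<open>D\<close>, so it
      improves on \<open>d k\<close> by no more than the tolerance, which vanishes as
      \<open>k\<close> grows.\<close>
    have le: "2 * t * (\<integral>x. (g x - d k x) * e x \<partial>M) \<le> (1/4) ^ k / 8 + t\<^sup>2 * ?E" for t k
    proof -
      have D1: "(\<lambda>x. 1 * d k x + t * e x) \<in> D" by (intro lin dD e)
      have int: "integrable M (\<lambda>x. (g x - d k x) * e x)"
        using gd[OF dD] Di[OF e] by (intro L2_product_integrable) auto
      have "N (\<lambda>x. 1 * d k x + t * e x) = (\<integral>x. (g x - d k x)\<^sup>2 - 2 * t * ((g x - d k x) * e x) + t\<^sup>2 * (e x)\<^sup>2 \<partial>M)"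
        unfolding N_def by (intro Bochner_Integration.integral_cong refl) (simp add: power2_eq_square algebra_simps)
      also have "\<dots> = N (d k) - 2 * t * (\<integral>x. (g x - d k x) * e x \<partial>M) + t\<^sup>2 * ?E"
        unfolding N_def using int gd[OF dD] Di[OF e] by simp
      finally show ?thesis
        using I_le[OF D1] dN[of k] by linarith
    qed
    have "2 * t * ?c \<le> t\<^sup>2 * ?E" for t
    proof -
      have "(\<lambda>k. 2 * t * (\<integral>x. (g x - d k x) * e x \<partial>M)) \<longlonglongrightarrow> 2 * t * ?c"
        by (intro tendsto_intros lim)
      moreover have "(\<lambda>k. (1/4) ^ k / 8 + t\<^sup>2 * ?E) \<longlonglongrightarrow> 0 / 8 + t\<^sup>2 * ?E"
        by (intro tendsto_intros LIMSEQ_power_zero) auto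
      ultimately show ?thesis
        using le by (intro LIMSEQ_le) auto
    qed
    \<comment> \<open>The optimal \<open>t\<close> would be \<open>?c / ?E\<close>; the added 1
      covers the case that \<open>?E\<close> is 0 and still forces \<open>?c\<close> to be
      0.\<close>
    from this[of "?c / (1 + ?E)"] have "2 * ?c\<^sup>2 / (1 + ?E) \<le> ?c\<^sup>2 * ?E / (1 + ?E)\<^sup>2"
      by (simp add: power2_eq_square)
    moreover have E0: "0 \<le> ?E" by auto
    moreover have "?c\<^sup>2 * ?E / (1 + ?E)\<^sup>2 \<le> ?c\<^sup>2 / (1 + ?E)"
    proof -
      have "?c\<^sup>2 * ?E / (1 + ?E)\<^sup>2 = (?c\<^sup>2 / (1 + ?E)) * (?E / (1 + ?E))"
        by (simp add: power2_eq_square)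
      also have "\<dots> \<le> (?c\<^sup>2 / (1 + ?E)) * 1"
        using E0 by (intro mult_left_mono) (auto simp: divide_le_eq_1 add_pos_nonneg)
      finally show ?thesis by simp
    qed
    ultimately have "?c\<^sup>2 / (1 + ?E) \<le> 0" by simp
    then show ?thesis using E0 by (simp add: divide_le_0_iff)
  qed
  have "(\<integral>x. w x * g x \<partial>M) = 0"
    by (rule perp[OF _ wi we]) auto
  \<comment> \<open>\<open>w\<close> is paired with \<open>w = g - d k - (l - d k)\<close>: the
    first two pairings vanish by orthogonality and the last one tends to 0.\<close>
  have "(\<integral>x. (w x)\<^sup>2 \<partial>M) = - (\<integral>x. (l x - d k x) * w x \<partial>M)" for k
  proof -
    have "(\<integral>x. (w x)\<^sup>2 \<partial>M) = (\<integral>x. w x * g x - w x * d k x - (l x - d k x) * w x \<partial>M)"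
      by (intro Bochner_Integration.integral_cong refl) (simp add: w_def power2_eq_square algebra_simps)
    also have "\<dots> = (\<integral>x. w x * g x \<partial>M) - (\<integral>x. w x * d k x \<partial>M) - (\<integral>x. (l x - d k x) * w x \<partial>M)"
      using wi gi ld Di[OF dD] by (simp add: L2_product_integrable)
    finally show ?thesis
      using \<open>(\<integral>x. w x * g x \<partial>M) = 0\<close> we[OF dD] by simp
  qed
  moreover have "(\<lambda>k. - (\<integral>x. (l x - d k x) * w x \<partial>M)) \<longlonglongrightarrow> - 0"
    using wi by (intro tendsto_minus lim_inner) auto
  ultimately have "(\<lambda>k. \<integral>x. (w x)\<^sup>2 \<partial>M) \<longlonglongrightarrow> 0" by simp
  then have w0: "(\<integral>x. (w x)\<^sup>2 \<partial>M) = 0" by (simp add: LIMSEQ_const_iff)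
  have "N (d k) \<le> 8 * (1/2) ^ k" for k
  proof -
    have "N (d k) \<le> (\<integral>x. 2 * (w x)\<^sup>2 + 2 * (l x - d k x)\<^sup>2 \<partial>M)"
      unfolding N_def
    proof (intro integral_mono gd dD Bochner_Integration.integrable_add integrable_mult_right wi ld)
      fix x
      show "(g x - d k x)\<^sup>2 \<le> 2 * (w x)\<^sup>2 + 2 * (l x - d k x)\<^sup>2"
        using zero_le_power2[of "w x - (l x - d k x)"] by (simp add: w_def power2_eq_square algebra_simps)
    qed
    also have "\<dots> = 2 * (\<integral>x. (l x - d k x)\<^sup>2 \<partial>M)"
      using wi ld by (simp add: w0)
    finally show ?thesis using ldN[of k] by simp
  qed
  moreover have "(\<lambda>k. 8 * (1/2::real) ^ k) \<longlonglongrightarrow> 8 * 0"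
    by (intro tendsto_intros LIMSEQ_power_zero) auto
  then have "eventually (\<lambda>k. 8 * (1/2::real) ^ k < \<epsilon>) sequentially"
    using \<open>0 < \<epsilon>\<close> by (intro order_tendstoD(2)[of _ 0]) auto
  then obtain k where "8 * (1/2::real) ^ k < \<epsilon>" by (auto simp: eventually_sequentially)
  ultimately have "N (d k) < \<epsilon>" by (meson le_less_trans)
  then show ?thesis using dD unfolding N_def by blast
qed

section \<open>Characteristic functions\<close>

lemma norm_iexp_minus_1_le: "cmod (iexp x - 1) \<le> \<bar>x\<bar>"
  using iexp_approx1[of x 0] by simp

lemma norm_iexp_minus_1_minus_le: "cmod (iexp x - 1 - \<i> * x) \<le> x\<^sup>2 / 2"
  using iexp_approx1[of x 1] by (simp add: power2_eq_square diff_diff_eq abs_mult[symmetric])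

lemma tendsto_iexp_first_order:
  "(\<lambda>n. of_real (sqrt (real n)) * (iexp (x / sqrt (real n)) - 1)) \<longlonglongrightarrow> \<i> * x"
proof -
  have "(\<lambda>n. of_real (sqrt (real n)) * (iexp (x / sqrt (real n)) - 1) - \<i> * x) \<longlonglongrightarrow> 0"
  proof (rule Lim_null_comparison)
    show "\<forall>\<^sub>F n in sequentially. norm (of_real (sqrt (real n)) * (iexp (x / sqrt (real n)) - 1) - \<i> * x) \<le> x\<^sup>2 / 2 / sqrt (real n)"
    proof (rule eventually_sequentiallyI[of 1])
      fix n :: nat assume "1 \<le> n"
      then have r: "0 < sqrt (real n)" by simp
      have "of_real (sqrt (real n)) * (iexp (x / sqrt (real n)) - 1) - \<i> * x =
          of_real (sqrt (real n)) * (iexp (x / sqrt (real n)) - 1 - \<i> * (x / sqrt (real n)))"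
        using r by (simp add: algebra_simps)
      also have "norm \<dots> \<le> sqrt (real n) * ((x / sqrt (real n))\<^sup>2 / 2)"
        unfolding norm_mult using r norm_iexp_minus_1_minus_le[of "x / sqrt (real n)"]
        by (intro mult_mono) auto
      also have "\<dots> = x\<^sup>2 / 2 / sqrt (real n)"
        using r by (simp add: power2_eq_square field_simps)
      finally show "norm (of_real (sqrt (real n)) * (iexp (x / sqrt (real n)) - 1) - \<i> * x) \<le> x\<^sup>2 / 2 / sqrt (real n)" .
    qed
    show "(\<lambda>n. x\<^sup>2 / 2 / sqrt (real n)) \<longlonglongrightarrow> 0" by real_asymp
  qed
  then show ?thesis by (simp add: LIM_zero_iff)
qed

lemma tendsto_iexp_second_order:
  "(\<lambda>n. of_nat n * (iexp (x / sqrt (real n)) - 1 - \<i> * (x / sqrt (real n)))) \<longlonglongrightarrow> - (x\<^sup>2 / 2)"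
proof -
  have "(\<lambda>n. of_nat n * (iexp (x / sqrt (real n)) - 1 - \<i> * (x / sqrt (real n))) + x\<^sup>2 / 2) \<longlonglongrightarrow> 0"
  proof (rule Lim_null_comparison)
    show "\<forall>\<^sub>F n in sequentially. norm (of_nat n * (iexp (x / sqrt (real n)) - 1 - \<i> * (x / sqrt (real n))) + x\<^sup>2 / 2) \<le> \<bar>x\<bar> ^ 3 / 6 / sqrt (real n)"
    proof (rule eventually_sequentiallyI[of 1])
      fix n :: nat assume "1 \<le> n"
      define r where "r = sqrt (real n)"
      have r: "0 < r" "real n = r\<^sup>2" using \<open>1 \<le> n\<close> by (auto simp: r_def)
      have rn: "of_nat n = (of_real (r\<^sup>2) :: complex)" using r(2) by (metis of_real_of_nat_eq)
      have rr: "cmod (of_real (r\<^sup>2)) = r\<^sup>2" by (simp only: norm_of_real abs_power2)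
      have "of_nat n * (iexp (x / r) - 1 - \<i> * (x / r)) + x\<^sup>2 / 2 =
          of_real (r\<^sup>2) * (iexp (x / r) - (\<Sum>k\<le>2. (\<i> * (x / r)) ^ k / fact k))"
        using r(1) unfolding rn by (simp add: numeral_2_eq_2 power2_eq_square field_simps)
      also have "norm \<dots> \<le> r\<^sup>2 * (\<bar>x / r\<bar> ^ 3 / 6)"
        unfolding norm_mult rr using r iexp_approx1[of "x / r" 2]
        by (intro mult_mono) (auto simp: fact_numeral)
      also have "\<dots> = \<bar>x\<bar> ^ 3 / 6 / r"
        using r(1) by (simp add: power2_eq_square power3_eq_cube field_simps)
      finally show "norm (of_nat n * (iexp (x / sqrt (real n)) - 1 - \<i> * (x / sqrt (real n))) + x\<^sup>2 / 2) \<le> \<bar>x\<bar> ^ 3 / 6 / sqrt (real n)"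
        unfolding r_def .
    qed
    show "(\<lambda>n. \<bar>x\<bar> ^ 3 / 6 / sqrt (real n)) \<longlonglongrightarrow> 0" by real_asymp
  qed
  then show ?thesis by (simp add: LIM_zero_iff[of _ "- (x\<^sup>2 / 2)" for x :: complex, symmetric])
qed

lemma norm_sqrt_iexp_le: "cmod (of_real (sqrt (real n)) * (iexp (x / sqrt (real n)) - 1)) \<le> \<bar>x\<bar>"
proof -
  have "cmod (of_real (sqrt (real n)) * (iexp (x / sqrt (real n)) - 1)) \<le> sqrt (real n) * \<bar>x / sqrt (real n)\<bar>"
    unfolding norm_mult using norm_iexp_minus_1_le[of "x / sqrt (real n)"] by (intro mult_mono) auto
  also have "\<dots> \<le> \<bar>x\<bar>" by (cases "n = 0") (auto simp: abs_divide)
  finally show ?thesis .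
qed

text \<open>The rescaled integrand is dominated by the absolute value of \<open>s * w x\<close>, so
  integrability of \<open>w\<close> is enough. This serves the alternatives under which
  \<open>w\<close> may have infinite variance.\<close>

lemma integral_iexp_first_order:
  assumes w: "integrable M w"
  shows "(\<lambda>n. of_real (sqrt (real n)) * (CLINT x|M. iexp (s * w x / sqrt (real n)) - 1)) \<longlonglongrightarrow> \<i> * (s * (\<integral>x. w x \<partial>M))"
proof -
  have [measurable]: "w \<in> borel_measurable M" using w by auto
  have "(\<lambda>n. CLINT x|M. of_real (sqrt (real n)) * (iexp (s * w x / sqrt (real n)) - 1)) \<longlonglongrightarrow> (CLINT x|M. \<i> * (s * w x))"
  proof (rule integral_dominated_convergence)
    show "integrable M (\<lambda>x. \<bar>s * w x\<bar>)" using w by auto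
    show "AE x in M. (\<lambda>n. of_real (sqrt (real n)) * (iexp (s * w x / sqrt (real n)) - 1)) \<longlonglongrightarrow> \<i> * (s * w x)"
      using tendsto_iexp_first_order[of "s * w x" for x] by auto
    show "AE x in M. norm (of_real (sqrt (real n)) * (iexp (s * w x / sqrt (real n)) - 1)) \<le> \<bar>s * w x\<bar>" for n
      using norm_sqrt_iexp_le[of n "s * w x" for x] by auto
  qed measurable
  also have "(CLINT x|M. \<i> * (s * w x)) = \<i> * (s * (\<integral>x. w x \<partial>M))"
  proof -
    have "(CLINT x|M. \<i> * (s * w x)) = \<i> * (CLINT x|M. of_real (s * w x))"
      by (rule integral_mult_right_zero)
    also have "(CLINT x|M. of_real (s * w x)) = of_real (\<integral>x. s * w x \<partial>M)"
      by (rule integral_complex_of_real)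
    finally show ?thesis by simp
  qed
  finally show ?thesis by simp
qed

text \<open>Since \<open>w\<close> has mean 0, the linear term of the expansion can be subtracted
  before multiplying by \<open>n\<close>, and the rest is dominated by
  \<open>s\<^sup>2 * (w x)\<^sup>2 / 2\<close>. The second claim, uniform in \<open>n\<close>, is
  for the local boundedness that Montel's theorem demands.\<close>

lemma integral_iexp_second_order:
  assumes w: "integrable M w" "integrable M (\<lambda>x. (w x)\<^sup>2)" and 0: "(\<integral>x. w x \<partial>M) = 0"
  shows "(\<lambda>n. of_nat n * (CLINT x|M. iexp (s * w x / sqrt (real n)) - 1)) \<longlonglongrightarrow> - (s\<^sup>2 * (\<integral>x. (w x)\<^sup>2 \<partial>M) / 2)"
    and "cmod (of_nat n * (CLINT x|M. iexp (s * w x / sqrt (real n)) - 1)) \<le> s\<^sup>2 * (\<integral>x. (w x)\<^sup>2 \<partial>M) / 2"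
proof -
  have [measurable]: "w \<in> borel_measurable M" using w by auto
  let ?f = "\<lambda>n x. of_nat n * (iexp (s * w x / sqrt (real n)) - 1 - \<i> * (s * w x / sqrt (real n)))"
  have bd: "norm (?f n x) \<le> s\<^sup>2 * (w x)\<^sup>2 / 2" for n x
  proof -
    have "norm (?f n x) \<le> real n * ((s * w x / sqrt (real n))\<^sup>2 / 2)"
      unfolding norm_mult using norm_iexp_minus_1_minus_le[of "s * w x / sqrt (real n)"] by (intro mult_mono) auto
    also have "\<dots> \<le> s\<^sup>2 * (w x)\<^sup>2 / 2"
      by (cases "n = 0") (auto simp: power_mult_distrib power_divide)
    finally show ?thesis .
  qed
  have ii: "integrable M (\<lambda>x. s\<^sup>2 * (w x)\<^sup>2 / 2)" using w by auto
  have fi: "integrable M (?f n)" for n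
    by (rule Bochner_Integration.integrable_bound[OF ii]) (use bd in auto)
  have e1: "integrable M (\<lambda>x. iexp (s * w x / sqrt (real n)) - 1)" for n
  proof (rule Bochner_Integration.integrable_bound[of M "\<lambda>x. s * w x / sqrt (real n)"])
    show "AE x in M. norm (iexp (s * w x / sqrt (real n)) - 1) \<le> norm (s * w x / sqrt (real n))"
      using norm_iexp_minus_1_le[of "s * w x / sqrt (real n)" for x] by (simp only: real_norm_def) simp
  qed (use w in auto)
  have eq: "of_nat n * (CLINT x|M. iexp (s * w x / sqrt (real n)) - 1) = (CLINT x|M. ?f n x)" for n
  proof -
    have "(CLINT x|M. ?f n x) = of_nat n * ((CLINT x|M. iexp (s * w x / sqrt (real n)) - 1) - (CLINT x|M. \<i> * (s * w x / sqrt (real n))))"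
    proof -
      have i2: "integrable M (\<lambda>x. \<i> * of_real (s * w x / sqrt (real n)) :: complex)"
        using w by (intro integrable_mult_right integrable_of_real) auto
      show ?thesis
        by (simp only: integral_mult_right_zero Bochner_Integration.integral_diff[OF e1 i2])
    qed
    also have "(CLINT x|M. \<i> * (s * w x / sqrt (real n))) = 0"
    proof -
      have "(CLINT x|M. \<i> * (s * w x / sqrt (real n))) = \<i> * (CLINT x|M. of_real (s * w x / sqrt (real n)))"
        by (rule integral_mult_right_zero)
      also have "(CLINT x|M. of_real (s * w x / sqrt (real n))) = of_real (\<integral>x. s * w x / sqrt (real n) \<partial>M)"
        by (rule integral_complex_of_real)
      finally show ?thesis using 0 by simp
    qed
    finally show ?thesis by (simp only: diff_zero)
  qed
  have "(\<lambda>n. CLINT x|M. ?f n x) \<longlonglongrightarrow> (CLINT x|M. - ((s * w x)\<^sup>2 / 2))"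
  proof (rule integral_dominated_convergence[OF _ _ ii])
    show "AE x in M. (\<lambda>n. ?f n x) \<longlonglongrightarrow> - ((s * w x)\<^sup>2 / 2)"
      using tendsto_iexp_second_order[of "s * w x" for x] by auto
  qed (use bd in auto)
  also have "(CLINT x|M. - ((s * w x)\<^sup>2 / 2)) = - (s\<^sup>2 * (\<integral>x. (w x)\<^sup>2 \<partial>M) / 2)"
  proof -
    have "(CLINT x|M. - ((s * w x)\<^sup>2 / 2)) = (CLINT x|M. of_real (- (s\<^sup>2 / 2 * (w x)\<^sup>2)))"
      by (simp add: power_mult_distrib)
    also have "\<dots> = of_real (\<integral>x. - (s\<^sup>2 / 2 * (w x)\<^sup>2) \<partial>M)"
      by (rule integral_complex_of_real)
    also have "(\<integral>x. - (s\<^sup>2 / 2 * (w x)\<^sup>2) \<partial>M) = - (s\<^sup>2 * (\<integral>x. (w x)\<^sup>2 \<partial>M) / 2)"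
      by simp
    finally show ?thesis by simp
  qed
  finally show "(\<lambda>n. of_nat n * (CLINT x|M. iexp (s * w x / sqrt (real n)) - 1)) \<longlonglongrightarrow> - (s\<^sup>2 * (\<integral>x. (w x)\<^sup>2 \<partial>M) / 2)"
    unfolding eq .
  have "cmod (CLINT x|M. ?f n x) \<le> (\<integral>x. norm (?f n x) \<partial>M)" by (rule integral_norm_bound)
  also have "\<dots> \<le> (\<integral>x. s\<^sup>2 * (w x)\<^sup>2 / 2 \<partial>M)"
    using fi bd by (intro integral_mono ii) auto
  finally show "cmod (of_nat n * (CLINT x|M. iexp (s * w x / sqrt (real n)) - 1)) \<le> s\<^sup>2 * (\<integral>x. (w x)\<^sup>2 \<partial>M) / 2"
    unfolding eq using w by simp
qed

text \<open>In the closed unit disc, n-th powers differ by at most \<open>n\<close> times the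
  difference of the bases. Comparison with \<open>exp (- a / n)\<close> thus avoids complex
  logarithms.\<close>

lemma tendsto_power_exp:
  fixes z :: "nat \<Rightarrow> complex" and a :: real
  assumes z: "\<And>n. norm (z n) \<le> 1" and lim: "(\<lambda>n. of_nat n * (z n - 1)) \<longlonglongrightarrow> - a" and "0 \<le> a"
  shows "(\<lambda>n. z n ^ n) \<longlonglongrightarrow> of_real (exp (- a))"
proof -
  define w :: "nat \<Rightarrow> complex" where "w n = of_real (exp (- a / real n))" for n
  have w1: "norm (w n) \<le> 1" for n using \<open>0 \<le> a\<close> by (simp add: w_def)
  have "(\<lambda>n. of_real (real n * (exp (- a / real n) - 1)) :: complex) \<longlonglongrightarrow> of_real (- a)"
  proof (intro tendsto_of_real)
    have "((\<lambda>t. (exp (- a * t) - 1) / t) \<longlongrightarrow> - a) (at 0)"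
    proof -
      have "((\<lambda>t. exp (- a * t)) has_field_derivative - a) (at 0)"
        by (auto intro!: derivative_eq_intros)
      then show ?thesis by (simp add: DERIV_def)
    qed
    moreover have "filterlim (\<lambda>n. 1 / real n) (at 0) sequentially" by real_asymp
    ultimately have "(\<lambda>n. (exp (- a * (1 / real n)) - 1) / (1 / real n)) \<longlonglongrightarrow> - a"
      by (rule filterlim_compose)
    then show "(\<lambda>n. real n * (exp (- a / real n) - 1)) \<longlonglongrightarrow> - a"
      by (simp add: mult.commute)
  qed
  then have wl: "(\<lambda>n. of_nat n * (w n - 1)) \<longlonglongrightarrow> - a" by (simp add: w_def)
  have "(\<lambda>n. z n ^ n - w n ^ n) \<longlonglongrightarrow> 0"
  proof (rule Lim_null_comparison)
    show "\<forall>\<^sub>F n in sequentially. norm (z n ^ n - w n ^ n) \<le> norm (of_nat n * (z n - 1) - of_nat n * (w n - 1))"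
    proof (intro always_eventually allI)
      fix n
      have "norm (z n ^ n - w n ^ n) \<le> n * norm (z n - w n)"
        by (rule norm_power_diff[OF z w1])
      also have "\<dots> = norm (of_nat n * (z n - w n))" by (simp add: norm_mult)
      also have "of_nat n * (z n - w n) = of_nat n * (z n - 1) - of_nat n * (w n - 1)" by (simp add: algebra_simps)
      finally show "norm (z n ^ n - w n ^ n) \<le> norm (of_nat n * (z n - 1) - of_nat n * (w n - 1))" .
    qed
    show "(\<lambda>n. norm (of_nat n * (z n - 1) - of_nat n * (w n - 1))) \<longlonglongrightarrow> 0"
      using tendsto_norm[OF tendsto_diff[OF lim wl]] by simp
  qed
  moreover have "(\<lambda>n. w n ^ n) \<longlonglongrightarrow> of_real (exp (- a))"
  proof (rule tendsto_eventually, rule eventually_sequentiallyI[of 1])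
    fix n :: nat assume "1 \<le> n"
    then have "exp (- a / real n) ^ n = exp (- a)"
      by (simp add: exp_of_nat_mult[symmetric])
    then show "w n ^ n = of_real (exp (- a))"
      unfolding w_def by (metis of_real_power)
  qed
  ultimately show ?thesis using tendsto_add by fastforce
qed

text \<open>If the variance \<open>V\<close> is finite, centring and cos x \<ge> 1 - x^2 / 2 bound
  the modulus of the characteristic function from below by \<open>1 - s\<^sup>2 * V / 2\<close>;
  comparing with the upper bound near \<open>s = 0\<close> gives the claim. An infinite variance
  satisfies it trivially.\<close>

lemma law_variance_ge_of_char:
  assumes L: "real_distribution L"
    and char: "\<And>s. 0 < s \<Longrightarrow> cmod (char L s) \<le> exp (- (s\<^sup>2 * v / 2))"
    and "0 \<le> v"
  shows "ennreal v \<le> law_variance L"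
proof (cases "law_variance L = \<infinity>")
  case False
  interpret real_distribution L by fact
  define m where "m = (LINT z|L. z)"
  have sq: "integrable L (\<lambda>y. (y - m)\<^sup>2)"
    using False unfolding law_variance_def m_def by (auto simp: integrable_iff_bounded less_top)
  define V where "V = (\<integral>y. (y - m)\<^sup>2 \<partial>L)"
  have V: "law_variance L = ennreal V"
    unfolding law_variance_def V_def m_def[symmetric] using sq by (intro nn_integral_eq_integral) auto
  have key: "1 - s\<^sup>2 * V / 2 \<le> exp (- (s\<^sup>2 * v / 2))" if "0 < s" for s
  proof -
    have iexp: "integrable L (\<lambda>x. iexp (s * (x - m)))"
      by (intro integrable_iexp) auto
    have "1 - s\<^sup>2 * V / 2 = (\<integral>y. 1 - s\<^sup>2 / 2 * (y - m)\<^sup>2 \<partial>L)"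
      unfolding V_def using sq by (simp add: prob_space del: space_eq_univ)
    also have "\<dots> \<le> (\<integral>y. Re (iexp (s * (y - m))) \<partial>L)"
    proof (intro integral_mono)
      fix y
      have "\<bar>Re (iexp (s * (y - m)) - 1 - \<i> * (s * (y - m)))\<bar> \<le> (s * (y - m))\<^sup>2 / 2"
        using norm_iexp_minus_1_minus_le[of "s * (y - m)"] abs_Re_le_cmod order_trans by blast
      then have "\<bar>Re (iexp (s * (y - m))) - 1\<bar> \<le> s\<^sup>2 / 2 * (y - m)\<^sup>2"
        by (simp add: power_mult_distrib)
      then show "1 - s\<^sup>2 / 2 * (y - m)\<^sup>2 \<le> Re (iexp (s * (y - m)))"
        by linarith
    next
      show "integrable L (\<lambda>y. Re (iexp (s * (y - m))))" using iexp by (rule integrable_Re)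
    qed (use sq in auto)
    also have "\<dots> = Re (CLINT y|L. iexp (s * (y - m)))" using iexp by simp
    also have "\<dots> \<le> cmod (CLINT y|L. iexp (s * (y - m)))" by (rule complex_Re_le_cmod)
    also have "(CLINT y|L. iexp (s * (y - m))) = (CLINT y|L. iexp (- (s * m)) * iexp (s * y))"
      by (simp add: exp_add[symmetric] algebra_simps)
    also have "cmod \<dots> = cmod (char L s)" by (simp add: char_def norm_mult)
    also note char[OF that]
    finally show ?thesis .
  qed
  have "v \<le> V"
  \<comment> \<open>Here \<open>y\<close> stands for \<open>s\<^sup>2 / 2\<close>. Replacing the
    exponential by \<open>1 / (1 + y * v)\<close> turns the inequality into an algebraic one whose
    limit at 0 compares the first-order terms.\<close>
  proof (rule tendsto_lowerbound)
    show "((\<lambda>y. V + y * v * V) \<longlongrightarrow> V) (at_right 0)"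
      by (auto intro!: tendsto_eq_intros)
    show "\<forall>\<^sub>F y in at_right 0. v \<le> V + y * v * V"
      using eventually_at_right_less
    proof eventually_elim
      case (elim y)
      have "1 - y * V \<le> exp (- (y * v))"
        using key[of "sqrt (2 * y)"] elim by simp
      also have "\<dots> \<le> 1 / (1 + y * v)"
        using exp_ge_add_one_self[of "y * v"] elim \<open>0 \<le> v\<close>
        by (simp add: exp_minus inverse_eq_divide frac_le add_pos_nonneg)
      finally have "(1 - y * V) * (1 + y * v) \<le> 1"
        using elim \<open>0 \<le> v\<close> by (simp add: le_divide_eq add_pos_nonneg)
      then have "y * v \<le> y * (V + y * v * V)" by (simp add: algebra_simps)
      then show ?case using elim by simp
    qed
  qed simp
  then show ?thesis unfolding V by (rule ennreal_leI)
qed simp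

text \<open>Normality of the bounded family \<open>F\<close> turns convergence on the positive reals into convergence
  along a subsequence everywhere.\<close>

lemma norm_limit_on_reals_le:
  fixes F :: "nat \<Rightarrow> complex \<Rightarrow> complex"
  assumes hol: "\<And>n. F n holomorphic_on UNIV"
    and bounded: "\<And>K. compact K \<Longrightarrow> \<exists>B. \<forall>n. \<forall>z\<in>K. norm (F n z) \<le> B"
    and lim: "\<And>t::real. 0 < t \<Longrightarrow> (\<lambda>n. F n (of_real t)) \<longlonglongrightarrow> c"
    and b: "\<And>n. norm (F n z0) \<le> b n" "b \<longlonglongrightarrow> \<beta>"
  shows "norm c \<le> \<beta>"
proof -
  obtain g r where g: "g holomorphic_on UNIV" and r: "strict_mono (r :: nat \<Rightarrow> nat)"
    and conv: "\<And>x. (\<lambda>n. F (r n) x) \<longlonglongrightarrow> g x"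
  proof (rule Montel[OF open_UNIV, of "range F" F])
    show "\<exists>B. \<forall>h\<in>range F. \<forall>z\<in>K. norm (h z) \<le> B" if "compact K" for K
      using bounded[OF that] by auto
  qed (use hol in auto)
  have gc: "g (of_real t) = c" if "0 < t" for t :: real
    using LIMSEQ_unique[OF conv LIMSEQ_subseq_LIMSEQ[OF lim[OF that] r, unfolded comp_def]] .
  have "g z0 - c = 0"
  proof (rule analytic_continuation[of "\<lambda>z. g z - c" UNIV "of_real ` {0<..}" 1])
    show "(1::complex) islimpt of_real ` {0<..}"
      unfolding islimpt_sequential
    proof (intro exI[of _ "\<lambda>n. of_real (1 + 1 / real (Suc n))"] conjI allI)
      show "of_real (1 + 1 / real (Suc n)) \<in> of_real ` {0<..} - {1::complex}" for n
      proof -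
        have "0 < 1 + 1 / real (Suc n)" "1 + 1 / real (Suc n) \<noteq> 1" by (auto simp: add_pos_pos)
        then show ?thesis
          by (intro DiffI imageI) (auto simp only: greaterThan_iff singleton_iff of_real_eq_1_iff)
      qed
      have "(\<lambda>n. of_real (1 + 1 / real (Suc n)) :: complex) \<longlonglongrightarrow> of_real 1"
        by (intro tendsto_of_real) real_asymp
      then show "(\<lambda>n. of_real (1 + 1 / real (Suc n)) :: complex) \<longlonglongrightarrow> 1" by simp
    qed
  qed (use g gc in \<open>auto intro!: holomorphic_intros\<close>)
  then have "(\<lambda>n. norm (F (r n) z0)) \<longlonglongrightarrow> norm c"
    using tendsto_norm[OF conv[of z0]] by simp
  moreover have "(\<lambda>n. b (r n)) \<longlonglongrightarrow> \<beta>"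
    using LIMSEQ_subseq_LIMSEQ[OF b(2) r] by (simp add: comp_def)
  ultimately show ?thesis
    using b(1) by (intro LIMSEQ_le) auto
qed

text \<open>Expanding the product over all maps from coordinates to summands yields a finite sum in
  which \<open>z\<close> occurs only in products of the \<open>c i\<close>, outside the integrals.
  No differentiation under the integral sign takes place.\<close>

lemma holomorphic_on_integral_prod_sum:
  fixes k :: "nat \<Rightarrow> 'a \<Rightarrow> complex" and c :: "nat \<Rightarrow> complex \<Rightarrow> complex" and n m :: nat
  assumes P: "finite_measure P" and k: "\<And>i. i < m \<Longrightarrow> integrable P (k i)"
    and A: "A \<in> borel_measurable (\<Pi>\<^sub>M j\<in>{..<n}. P)" "\<And>x. norm (A x) \<le> C"
    and c: "\<And>i. i < m \<Longrightarrow> c i holomorphic_on S"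
  shows "(\<lambda>z. \<integral>x. A x * (\<Prod>j<n. \<Sum>i<m. c i z * k i (x j)) \<partial>(\<Pi>\<^sub>M j\<in>{..<n}. P)) holomorphic_on S"
proof -
  interpret P: finite_measure P by fact
  interpret PP: product_sigma_finite "\<lambda>_. P" by standard
  let ?G = "PiE {..<n} (\<lambda>_. {..<m})"
  have "C \<ge> 0" using A(2)[of undefined] norm_ge_zero order_trans by blast
  have int: "integrable (\<Pi>\<^sub>M j\<in>{..<n}. P) (\<lambda>x. A x * (\<Prod>j<n. k (\<sigma> j) (x j)))" if "\<sigma> \<in> ?G" for \<sigma>
  proof (rule Bochner_Integration.integrable_bound)
    have ki: "integrable P (k (\<sigma> j))" if "j \<in> {..<n}" for j using \<open>\<sigma> \<in> ?G\<close> that by (intro k) auto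
    show i: "integrable (\<Pi>\<^sub>M j\<in>{..<n}. P) (\<lambda>x. C * (\<Prod>j<n. k (\<sigma> j) (x j)))"
      by (intro integrable_mult_right PP.product_integrable_prod ki) auto
    have "(\<lambda>x. \<Prod>j<n. k (\<sigma> j) (x j)) \<in> borel_measurable (\<Pi>\<^sub>M j\<in>{..<n}. P)"
      using ki by (intro borel_measurable_integrable PP.product_integrable_prod) auto
    then show "(\<lambda>x. A x * (\<Prod>j<n. k (\<sigma> j) (x j))) \<in> borel_measurable (\<Pi>\<^sub>M j\<in>{..<n}. P)"
      using A(1) by measurable
    show "AE x in \<Pi>\<^sub>M j\<in>{..<n}. P. norm (A x * (\<Prod>j<n. k (\<sigma> j) (x j))) \<le> norm (C * (\<Prod>j<n. k (\<sigma> j) (x j)))"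
      using A(2) \<open>C \<ge> 0\<close> by (auto simp: norm_mult intro!: mult_right_mono)
  qed
  have "(\<integral>x. A x * (\<Prod>j<n. \<Sum>i<m. c i z * k i (x j)) \<partial>(\<Pi>\<^sub>M j\<in>{..<n}. P)) =
      (\<Sum>\<sigma>\<in>?G. (\<Prod>j<n. c (\<sigma> j) z) * (\<integral>x. A x * (\<Prod>j<n. k (\<sigma> j) (x j)) \<partial>(\<Pi>\<^sub>M j\<in>{..<n}. P)))" for z
  proof -
    have "(\<integral>x. A x * (\<Prod>j<n. \<Sum>i<m. c i z * k i (x j)) \<partial>(\<Pi>\<^sub>M j\<in>{..<n}. P)) =
        (\<integral>x. (\<Sum>\<sigma>\<in>?G. (\<Prod>j<n. c (\<sigma> j) z) * (A x * (\<Prod>j<n. k (\<sigma> j) (x j)))) \<partial>(\<Pi>\<^sub>M j\<in>{..<n}. P))"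
    proof (intro Bochner_Integration.integral_cong refl)
      fix x
      have "(\<Prod>j<n. \<Sum>i<m. c i z * k i (x j)) = (\<Sum>\<sigma>\<in>?G. \<Prod>j<n. c (\<sigma> j) z * k (\<sigma> j) (x j))"
        by (rule prod_sum_PiE) auto
      then show "A x * (\<Prod>j<n. \<Sum>i<m. c i z * k i (x j)) =
          (\<Sum>\<sigma>\<in>?G. (\<Prod>j<n. c (\<sigma> j) z) * (A x * (\<Prod>j<n. k (\<sigma> j) (x j))))"
        by (simp add: sum_distrib_left prod.distrib mult.left_commute)
    qed
    also have "\<dots> = (\<Sum>\<sigma>\<in>?G. (\<integral>x. (\<Prod>j<n. c (\<sigma> j) z) * (A x * (\<Prod>j<n. k (\<sigma> j) (x j))) \<partial>(\<Pi>\<^sub>M j\<in>{..<n}. P)))"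
      by (intro Bochner_Integration.integral_sum integrable_mult_right int)
    finally show ?thesis by simp
  qed
  moreover have "(\<lambda>z. \<Sum>\<sigma>\<in>?G. (\<Prod>j<n. c (\<sigma> j) z) * (\<integral>x. A x * (\<Prod>j<n. k (\<sigma> j) (x j)) \<partial>(\<Pi>\<^sub>M j\<in>{..<n}. P))) holomorphic_on S"
    using c by (intro holomorphic_intros) (auto dest: PiE_mem)
  ultimately show ?thesis by simp
qed

section \<open>The mixture model\<close>

locale mixture_model = sigma_finite_measure \<nu> for \<nu> :: "'x measure" +
  fixes T :: "'t measure" and f :: "'x \<Rightarrow> 't \<Rightarrow> real"
  assumes kernel: "kernel_density \<nu> T f"
begin

abbreviation J :: "'t measure \<Rightarrow> ('x \<times> 't) measure" where
  "J \<equiv> joint \<nu> f"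

definition P :: "'t measure \<Rightarrow> 'x measure" where
  "P G = density \<nu> (mixture_density f G)"

text \<open>Mixture densities are finite almost everywhere, so real values lose only a null set, on
  which \<open>dens\<close> takes the value 0. Real values permit subtraction and Bochner
  integrals.\<close>

definition dens :: "'t measure \<Rightarrow> 'x \<Rightarrow> real" where
  "dens G x = enn2real (mixture_density f G x)"

text \<open>The conditional mean of \<open>w (X, \<theta>)\<close> given \<open>X\<close> under \<open>P\<^bsub>G\<^esub>\<close>, multiplied by the likelihood
  ratio of \<open>X\<close> under \<open>P\<^bsub>G\<^esub>\<close> and \<open>P\<^bsub>G\<^sub>0\<^esub>\<close>.\<close>

definition cmean :: "'t measure \<Rightarrow> 't measure \<Rightarrow> ('x \<times> 't \<Rightarrow> 'b) \<Rightarrow> 'x \<Rightarrow> 'b::{banach,second_countable_topology}" where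
  "cmean G0 G w x = (1 / dens G0 x) *\<^sub>R (\<integral>\<theta>. f x \<theta> *\<^sub>R w (x, \<theta>) \<partial>G)"

text \<open>Absolute continuity of the laws of X alone: \<open>G0\<close> and \<open>G\<close> may
  be mutually singular as distributions of the parameter. Therefore \<open>cmean\<close> integrates
  over \<open>G\<close> but divides by the density belonging to \<open>G0\<close>.\<close>

definition dominated :: "'t measure \<Rightarrow> 't measure \<Rightarrow> bool" where
  "dominated G0 G \<longleftrightarrow> distribution_on T G0 \<and> distribution_on T G \<and>
     (AE x in \<nu>. mixture_density f G0 x = 0 \<longrightarrow> mixture_density f G x = 0)"

lemma f_nonneg: "x \<in> space \<nu> \<Longrightarrow> \<theta> \<in> space T \<Longrightarrow> 0 \<le> f x \<theta>"
  using kernel unfolding kernel_density_def by blast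

lemma f_measurable: "case_prod f \<in> borel_measurable (\<nu> \<Otimes>\<^sub>M T)"
  using kernel unfolding kernel_density_def by blast

lemma distributionD:
  assumes "distribution_on T G"
  shows "prob_space G" "sets G = sets T" "space G = space T" "sets (\<nu> \<Otimes>\<^sub>M G) = sets (\<nu> \<Otimes>\<^sub>M T)"
    "sets (J G) = sets (\<nu> \<Otimes>\<^sub>M T)"
proof -
  show "prob_space G" and s: "sets G = sets T"
    using assms unfolding distribution_on_def by auto
  show "space G = space T" using s by (rule sets_eq_imp_space_eq)
  show p: "sets (\<nu> \<Otimes>\<^sub>M G) = sets (\<nu> \<Otimes>\<^sub>M T)" by (intro sets_pair_measure_cong s refl)
  then show "sets (J G) = sets (\<nu> \<Otimes>\<^sub>M T)" by (simp add: joint_def)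
qed

lemma borel_measurable_pair_iff:
  assumes "distribution_on T G"
  shows "borel_measurable (\<nu> \<Otimes>\<^sub>M G) = borel_measurable (\<nu> \<Otimes>\<^sub>M T)"
    and "borel_measurable (J G) = borel_measurable (\<nu> \<Otimes>\<^sub>M T)"
  using distributionD[OF assms] by (auto cong: measurable_cong_sets)

section \<open>The joint law, its marginal, and densities\<close>

lemma nn_integral_joint:
  assumes G: "distribution_on T G" and h: "h \<in> borel_measurable (\<nu> \<Otimes>\<^sub>M T)"
  shows "(\<integral>\<^sup>+z. h z \<partial>J G) = (\<integral>\<^sup>+x. \<integral>\<^sup>+\<theta>. ennreal (f x \<theta>) * h (x, \<theta>) \<partial>G \<partial>\<nu>)"
proof -
  interpret G: prob_space G by (rule distributionD[OF G])
  have [measurable]: "h \<in> borel_measurable (\<nu> \<Otimes>\<^sub>M G)" "case_prod f \<in> borel_measurable (\<nu> \<Otimes>\<^sub>M G)"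
    using h f_measurable borel_measurable_pair_iff[OF G] by auto
  have "(\<integral>\<^sup>+z. h z \<partial>J G) = (\<integral>\<^sup>+z. (case z of (x, \<theta>) \<Rightarrow> ennreal (f x \<theta>)) * h z \<partial>(\<nu> \<Otimes>\<^sub>M G))"
    unfolding joint_def by (subst nn_integral_density) (auto simp: split_beta')
  also have "\<dots> = (\<integral>\<^sup>+x. \<integral>\<^sup>+\<theta>. ennreal (f x \<theta>) * h (x, \<theta>) \<partial>G \<partial>\<nu>)"
    by (subst G.nn_integral_fst[symmetric]) (auto simp: split_beta')
  finally show ?thesis .
qed

lemma mixture_density_measurable [measurable]:
  assumes G: "distribution_on T G"
  shows "mixture_density f G \<in> borel_measurable \<nu>"
proof -
  interpret G: prob_space G by (rule distributionD[OF G])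
  have [measurable]: "case_prod f \<in> borel_measurable (\<nu> \<Otimes>\<^sub>M G)"
    using f_measurable borel_measurable_pair_iff[OF G] by auto
  have "(\<lambda>x. \<integral>\<^sup>+\<theta>. ennreal (f x \<theta>) \<partial>G) \<in> borel_measurable \<nu>"
    by measurable
  then show ?thesis by (simp add: mixture_density_def[abs_def])
qed

lemma dens_measurable [measurable]: "distribution_on T G \<Longrightarrow> dens G \<in> borel_measurable \<nu>"
  unfolding dens_def[abs_def] by measurable

lemma sets_P [simp]: "sets (P G) = sets \<nu>" and space_P [simp]: "space (P G) = space \<nu>"
  by (auto simp: P_def)

lemma borel_measurable_P [simp]: "borel_measurable (P G) = borel_measurable \<nu>"
  by (auto cong: measurable_cong_sets)

lemma nn_integral_joint_fst:
  assumes G: "distribution_on T G" and h [measurable]: "h \<in> borel_measurable \<nu>"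
  shows "(\<integral>\<^sup>+z. h (fst z) \<partial>J G) = (\<integral>\<^sup>+x. h x \<partial>P G)"
proof -
  interpret G: prob_space G by (rule distributionD[OF G])
  have [measurable]: "case_prod f \<in> borel_measurable (\<nu> \<Otimes>\<^sub>M G)"
    using f_measurable borel_measurable_pair_iff[OF G] by auto
  have "(\<integral>\<^sup>+z. h (fst z) \<partial>J G) = (\<integral>\<^sup>+x. \<integral>\<^sup>+\<theta>. ennreal (f x \<theta>) * h x \<partial>G \<partial>\<nu>)"
    by (subst nn_integral_joint[OF G]) auto
  also have "\<dots> = (\<integral>\<^sup>+x. mixture_density f G x * h x \<partial>\<nu>)"
    unfolding mixture_density_def
    by (intro nn_integral_cong nn_integral_multc) measurable
  also have "\<dots> = (\<integral>\<^sup>+x. h x \<partial>P G)"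
    unfolding P_def using G by (subst nn_integral_density) auto
  finally show ?thesis .
qed

lemma prob_space_joint:
  assumes G: "distribution_on T G"
  shows "prob_space (J G)"
proof
  interpret G: prob_space G by (rule distributionD[OF G])
  interpret pair_sigma_finite \<nu> G ..
  have [measurable]: "case_prod f \<in> borel_measurable (\<nu> \<Otimes>\<^sub>M G)"
    using f_measurable borel_measurable_pair_iff[OF G] by auto
  have "emeasure (J G) (space (J G)) = (\<integral>\<^sup>+z. 1 \<partial>J G)" by simp
  also have "\<dots> = (\<integral>\<^sup>+x. \<integral>\<^sup>+\<theta>. ennreal (f x \<theta>) \<partial>G \<partial>\<nu>)"
    by (subst nn_integral_joint[OF G]) auto
  also have "\<dots> = (\<integral>\<^sup>+\<theta>. \<integral>\<^sup>+x. ennreal (f x \<theta>) \<partial>\<nu> \<partial>G)"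
    by (rule Fubini'[symmetric]) (auto simp: split_beta')
  also have "\<dots> = (\<integral>\<^sup>+\<theta>. 1 \<partial>G)"
    using kernel distributionD(3)[OF G] unfolding kernel_density_def by (intro nn_integral_cong) auto
  finally show "emeasure (J G) (space (J G)) = 1" by (simp add: G.emeasure_space_1)
qed

lemma prob_space_P:
  assumes G: "distribution_on T G"
  shows "prob_space (P G)"
proof
  interpret J: prob_space "J G" by (rule prob_space_joint[OF G])
  have "emeasure (P G) (space (P G)) = (\<integral>\<^sup>+x. 1 \<partial>P G)" by simp
  also have "\<dots> = 1"
    using nn_integral_joint_fst[OF G, of "\<lambda>_. 1"] by (simp add: J.emeasure_space_1)
  finally show "emeasure (P G) (space (P G)) = 1" .
qed

lemma mixture_density_finite:
  assumes G: "distribution_on T G"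
  shows "AE x in \<nu>. mixture_density f G x \<noteq> \<infinity>"
proof (rule nn_integral_PInf_AE)
  interpret prob_space "P G" by (rule prob_space_P[OF G])
  have "(\<integral>\<^sup>+x. mixture_density f G x \<partial>\<nu>) = (\<integral>\<^sup>+x. 1 \<partial>P G)"
    unfolding P_def using G by (subst nn_integral_density) auto
  then show "(\<integral>\<^sup>+x. mixture_density f G x \<partial>\<nu>) \<noteq> \<infinity>" using emeasure_space_1 by simp
qed (use G in measurable)

lemma AE_dens:
  assumes G: "distribution_on T G"
  shows "AE x in \<nu>. mixture_density f G x = ennreal (dens G x)"
  using mixture_density_finite[OF G] by eventually_elim (simp add: dens_def less_top)

text \<open>Positivity of the density may be assumed, which makes the divisions by
  \<open>dens G\<close> meaningful almost everywhere.\<close>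

lemma AE_P:
  assumes G: "distribution_on T G" and "AE x in \<nu>. 0 < dens G x \<longrightarrow> Q x"
  shows "AE x in P G. Q x"
  unfolding P_def using G
  by (subst AE_density, measurable) (use AE_dens[OF G] assms(2) in eventually_elim, auto)

lemma P_eq:
  assumes G: "distribution_on T G"
  shows "P G = density \<nu> (\<lambda>x. ennreal (dens G x))"
  unfolding P_def using G AE_dens[OF G] by (intro density_cong) auto

lemma integrable_joint_iff:
  fixes w :: "'x \<times> 't \<Rightarrow> 'b::{banach,second_countable_topology}"
  assumes G: "distribution_on T G" and w: "w \<in> borel_measurable (\<nu> \<Otimes>\<^sub>M T)"
  shows "integrable (J G) w \<longleftrightarrow> integrable (\<nu> \<Otimes>\<^sub>M G) (\<lambda>(x, \<theta>). f x \<theta> *\<^sub>R w (x, \<theta>))"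
    and "integral\<^sup>L (J G) w = (\<integral>(x, \<theta>). f x \<theta> *\<^sub>R w (x, \<theta>) \<partial>(\<nu> \<Otimes>\<^sub>M G))"
proof -
  have [measurable]: "w \<in> borel_measurable (\<nu> \<Otimes>\<^sub>M G)" "case_prod f \<in> borel_measurable (\<nu> \<Otimes>\<^sub>M G)"
    using w f_measurable borel_measurable_pair_iff[OF G] by auto
  have nn: "AE z in \<nu> \<Otimes>\<^sub>M G. 0 \<le> case_prod f z"
    using f_nonneg distributionD(3)[OF G] by (intro AE_I2) (auto simp: space_pair_measure)
  have J: "J G = density (\<nu> \<Otimes>\<^sub>M G) (\<lambda>z. ennreal (case_prod f z))"
    unfolding joint_def by (simp add: split_beta')
  show "integrable (J G) w \<longleftrightarrow> integrable (\<nu> \<Otimes>\<^sub>M G) (\<lambda>(x, \<theta>). f x \<theta> *\<^sub>R w (x, \<theta>))"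
    unfolding J using nn by (subst integrable_density) (auto simp: split_beta')
  show "integral\<^sup>L (J G) w = (\<integral>(x, \<theta>). f x \<theta> *\<^sub>R w (x, \<theta>) \<partial>(\<nu> \<Otimes>\<^sub>M G))"
    unfolding J using nn by (subst integral_density) (auto simp: split_beta')
qed

lemma fst_measurable_joint:
  assumes G: "distribution_on T G"
  shows "fst \<in> measurable (J G) \<nu>"
proof -
  have "fst \<in> measurable (\<nu> \<Otimes>\<^sub>M T) \<nu>" by measurable
  then show ?thesis using distributionD(5)[OF G] by (simp cong: measurable_cong_sets)
qed

section \<open>Conditional means under a change of the parameter distribution\<close>

lemma AE_integrable_section:
  fixes w :: "'x \<times> 't \<Rightarrow> 'b::{banach,second_countable_topology}"
  assumes G: "distribution_on T G" and w: "integrable (J G) w"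
  shows "AE x in \<nu>. integrable G (\<lambda>\<theta>. f x \<theta> *\<^sub>R w (x, \<theta>))"
proof -
  interpret G: prob_space G by (rule distributionD[OF G])
  interpret pair_sigma_finite \<nu> G ..
  have "w \<in> borel_measurable (\<nu> \<Otimes>\<^sub>M T)"
    using borel_measurable_integrable[OF w] unfolding borel_measurable_pair_iff(2)[OF G] .
  from w[unfolded integrable_joint_iff(1)[OF G this]] show ?thesis
    by (rule AE_integrable_fst'[where f = "\<lambda>(x, \<theta>). f x \<theta> *\<^sub>R w (x, \<theta>)", unfolded prod.case])
qed

lemma section_measurable:
  fixes w :: "'x \<times> 't \<Rightarrow> 'b::{banach,second_countable_topology}"
  assumes G: "distribution_on T G" and w: "w \<in> borel_measurable (\<nu> \<Otimes>\<^sub>M T)" and x: "x \<in> space \<nu>"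
  shows "(\<lambda>\<theta>. f x \<theta> *\<^sub>R w (x, \<theta>)) \<in> borel_measurable G"
proof -
  have [measurable]: "w \<in> borel_measurable (\<nu> \<Otimes>\<^sub>M G)" "case_prod f \<in> borel_measurable (\<nu> \<Otimes>\<^sub>M G)"
    using w f_measurable borel_measurable_pair_iff[OF G] by auto
  show ?thesis using x by measurable
qed

lemma cmean_measurable:
  fixes w :: "'x \<times> 't \<Rightarrow> 'b::{banach,second_countable_topology}"
  assumes G0: "distribution_on T G0" and G: "distribution_on T G" and w: "w \<in> borel_measurable (\<nu> \<Otimes>\<^sub>M T)"
  shows "cmean G0 G w \<in> borel_measurable \<nu>"
proof -
  interpret G: prob_space G by (rule distributionD[OF G])
  have [measurable]: "w \<in> borel_measurable (\<nu> \<Otimes>\<^sub>M G)" "case_prod f \<in> borel_measurable (\<nu> \<Otimes>\<^sub>M G)"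
    using w f_measurable borel_measurable_pair_iff[OF G] by auto
  note [measurable] = dens_measurable[OF G0]
  show ?thesis unfolding cmean_def[abs_def] by measurable
qed

lemma
  fixes w :: "'x \<times> 't \<Rightarrow> 'b::{banach,second_countable_topology}"
  assumes dom: "dominated G0 G" and w: "integrable (J G) w"
  shows cmean_integrable: "integrable (P G0) (cmean G0 G w)"
    and integral_cmean: "integral\<^sup>L (P G0) (cmean G0 G w) = integral\<^sup>L (J G) w"
proof -
  have G0: "distribution_on T G0" and G: "distribution_on T G"
    and AE0: "AE x in \<nu>. mixture_density f G0 x = 0 \<longrightarrow> mixture_density f G x = 0"
    using dom unfolding dominated_def by auto
  interpret G: prob_space G by (rule distributionD[OF G])
  interpret pair_sigma_finite \<nu> G ..
  have wm: "w \<in> borel_measurable (\<nu> \<Otimes>\<^sub>M T)"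
    using borel_measurable_integrable[OF w] unfolding borel_measurable_pair_iff(2)[OF G] .
  have fw: "integrable (\<nu> \<Otimes>\<^sub>M G) (\<lambda>(x, \<theta>). f x \<theta> *\<^sub>R w (x, \<theta>))"
    using w unfolding integrable_joint_iff(1)[OF G wm] .
  have [measurable]: "cmean G0 G w \<in> borel_measurable \<nu>" "dens G0 \<in> borel_measurable \<nu>"
    by (intro cmean_measurable G0 G wm dens_measurable)+
  have d0: "0 \<le> dens G0 x" for x by (simp add: dens_def)
  have eq: "AE x in \<nu>. dens G0 x *\<^sub>R cmean G0 G w x = (\<integral>\<theta>. f x \<theta> *\<^sub>R w (x, \<theta>) \<partial>G)"
    using AE0 AE_dens[OF G0] AE_space
  proof eventually_elim
    case (elim x)
    show ?case
    \<comment> \<open>At a zero of \<open>dens G0\<close> the left side is 0, so the inner integral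
      must vanish as well: domination makes the density under \<open>G\<close> zero there, hence
      \<open>f x\<close> vanishes for \<open>G\<close>-almost every parameter.\<close>
    proof (cases "dens G0 x = 0")
      case True
      then have "(\<integral>\<^sup>+\<theta>. ennreal (f x \<theta>) \<partial>G) = 0"
        using elim by (simp add: mixture_density_def)
      moreover have "(\<lambda>\<theta>. f x \<theta>) \<in> borel_measurable G"
        using section_measurable[OF G, of "\<lambda>_. 1 :: real"] elim by simp
      ultimately have "AE \<theta> in G. ennreal (f x \<theta>) = 0"
        by (subst (asm) nn_integral_0_iff_AE) auto
      then have "AE \<theta> in G. f x \<theta> *\<^sub>R w (x, \<theta>) = 0"
        using AE_space by eventually_elim
          (use f_nonneg elim distributionD(3)[OF G] in \<open>auto simp: ennreal_eq_0_iff intro!: antisym\<close>)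
      then have "(\<integral>\<theta>. f x \<theta> *\<^sub>R w (x, \<theta>) \<partial>G) = 0" by (rule integral_eq_zero_AE)
      with True show ?thesis by simp
    qed (simp add: cmean_def)
  qed
  have i: "integrable \<nu> (\<lambda>x. \<integral>\<theta>. f x \<theta> *\<^sub>R w (x, \<theta>) \<partial>G)"
    using integrable_fst[OF fw] by simp
  then have i': "integrable \<nu> (\<lambda>x. dens G0 x *\<^sub>R cmean G0 G w x)"
    by (rule integrable_cong_AE_imp) (use eq in auto)
  then show "integrable (P G0) (cmean G0 G w)"
    unfolding P_eq[OF G0] using d0 by (subst integrable_density) auto
  have "integral\<^sup>L (P G0) (cmean G0 G w) = (\<integral>x. dens G0 x *\<^sub>R cmean G0 G w x \<partial>\<nu>)"
    unfolding P_eq[OF G0] using d0 by (subst integral_density) auto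
  also have "\<dots> = (\<integral>x. (\<integral>\<theta>. f x \<theta> *\<^sub>R w (x, \<theta>) \<partial>G) \<partial>\<nu>)"
    using eq i i' by (intro integral_cong_AE) auto
  also have "\<dots> = integral\<^sup>L (J G) w"
    using integral_fst[OF fw] integrable_joint_iff(2)[OF G wm] by simp
  finally show "integral\<^sup>L (P G0) (cmean G0 G w) = integral\<^sup>L (J G) w" .
qed

lemma cmean_norm_le:
  fixes w :: "'x \<times> 't \<Rightarrow> 'b::{banach,second_countable_topology}"
  assumes G: "distribution_on T G" and w: "w \<in> borel_measurable (\<nu> \<Otimes>\<^sub>M T)"
    and W: "integrable (J G) W" and le: "\<And>z. norm (w z) \<le> W z"
  shows "AE x in \<nu>. norm (cmean G0 G w x) \<le> cmean G0 G W x"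
  using AE_integrable_section[OF G W] AE_space
proof eventually_elim
  case (elim x)
  have W0: "0 \<le> W z" for z using le[of z] norm_ge_zero order_trans by blast
  have "norm (\<integral>\<theta>. f x \<theta> *\<^sub>R w (x, \<theta>) \<partial>G) \<le> (\<integral>\<theta>. norm (f x \<theta> *\<^sub>R w (x, \<theta>)) \<partial>G)"
    by (rule integral_norm_bound)
  also have "\<dots> \<le> (\<integral>\<theta>. f x \<theta> *\<^sub>R W (x, \<theta>) \<partial>G)"
    using le elim f_nonneg distributionD(3)[OF G] W0
    by (intro integral_mono') (auto intro!: mult_mono)
  finally have "norm (\<integral>\<theta>. f x \<theta> *\<^sub>R w (x, \<theta>) \<partial>G) \<le> (\<integral>\<theta>. f x \<theta> *\<^sub>R W (x, \<theta>) \<partial>G)" .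
  then show ?case
    unfolding cmean_def by (auto simp: dens_def intro!: divide_right_mono)
qed

lemma cmean_tendsto:
  fixes w :: "nat \<Rightarrow> 'x \<times> 't \<Rightarrow> 'b::{banach,second_countable_topology}"
  assumes G: "distribution_on T G" and w: "\<And>n. w n \<in> borel_measurable (\<nu> \<Otimes>\<^sub>M T)" "w' \<in> borel_measurable (\<nu> \<Otimes>\<^sub>M T)"
    and W: "integrable (J G) W" and le: "\<And>n z. norm (w n z) \<le> W z"
    and lim: "\<And>z. (\<lambda>n. w n z) \<longlonglongrightarrow> w' z"
  shows "AE x in \<nu>. (\<lambda>n. cmean G0 G (w n) x) \<longlonglongrightarrow> cmean G0 G w' x"
  using AE_integrable_section[OF G W] AE_space
proof eventually_elim
  case (elim x)
  have "(\<lambda>n. \<integral>\<theta>. f x \<theta> *\<^sub>R w n (x, \<theta>) \<partial>G) \<longlonglongrightarrow> (\<integral>\<theta>. f x \<theta> *\<^sub>R w' (x, \<theta>) \<partial>G)"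
  proof (rule integral_dominated_convergence[where w = "\<lambda>\<theta>. f x \<theta> *\<^sub>R W (x, \<theta>)"])
    show "AE \<theta> in G. (\<lambda>n. f x \<theta> *\<^sub>R w n (x, \<theta>)) \<longlonglongrightarrow> f x \<theta> *\<^sub>R w' (x, \<theta>)"
      by (intro AE_I2 tendsto_intros lim)
    show "AE \<theta> in G. norm (f x \<theta> *\<^sub>R w n (x, \<theta>)) \<le> f x \<theta> *\<^sub>R W (x, \<theta>)" for n
      using le elim f_nonneg distributionD(3)[OF G] by (intro AE_I2) (auto intro!: mult_mono)
  qed (use elim w in \<open>auto intro!: section_measurable[OF G]\<close>)
  then show ?case unfolding cmean_def by (intro tendsto_intros)
qed

lemma cmean_const:
  fixes c :: "'b::{banach,second_countable_topology}"
  assumes G: "distribution_on T G"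
  shows "AE x in \<nu>. cmean G0 G (\<lambda>_. c) x = (dens G x / dens G0 x) *\<^sub>R c"
proof -
  interpret J: prob_space "J G" by (rule prob_space_joint[OF G])
  have i: "integrable (J G) (\<lambda>_. 1 :: real)" by simp
  show ?thesis
    using AE_integrable_section[OF G i] AE_space
  proof eventually_elim
    case (elim x)
    have "(\<integral>\<theta>. f x \<theta> \<partial>G) = dens G x"
      unfolding dens_def mixture_density_def
      using section_measurable[OF G, of "\<lambda>_. 1 :: real" x] elim f_nonneg distributionD(3)[OF G]
      by (subst integral_eq_nn_integral) auto
    then show ?case using elim by (simp add: cmean_def)
  qed
qed

lemma cmean_diff:
  fixes w w' :: "'x \<times> 't \<Rightarrow> 'b::{banach,second_countable_topology}"
  assumes G: "distribution_on T G" and w: "integrable (J G) w" "integrable (J G) w'"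
  shows "AE x in \<nu>. cmean G0 G (\<lambda>z. w z - w' z) x = cmean G0 G w x - cmean G0 G w' x"
  using AE_integrable_section[OF G w(1)] AE_integrable_section[OF G w(2)]
  by eventually_elim (simp add: cmean_def scaleR_diff_right)

text \<open>A function of the observation is a constant factor of the inner integral. The equation
  therefore holds at every point and for every \<open>w\<close>, integrable or not.\<close>

lemma cmean_mult:
  fixes w :: "'x \<times> 't \<Rightarrow> 'b::{real_normed_field,banach,second_countable_topology}"
  shows "cmean G0 G (\<lambda>z. h (fst z) * w z) x = h x * cmean G0 G w x"
  unfolding cmean_def by (simp flip: mult_scaleR_right)

lemma cmean_of_real:
  "cmean G0 G (\<lambda>z. complex_of_real (w z)) x = of_real (cmean G0 G w x)"
  unfolding cmean_def by (simp add: scaleR_conv_of_real flip: of_real_mult)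

lemma integrable_joint_fst:
  fixes h :: "'x \<Rightarrow> 'b::{banach,second_countable_topology}"
  assumes G: "distribution_on T G" and h [measurable]: "h \<in> borel_measurable \<nu>"
  shows "integrable (J G) (\<lambda>z. h (fst z)) \<longleftrightarrow> integrable (P G) h"
proof -
  have "(\<lambda>z. h (fst z)) \<in> borel_measurable (J G)"
    unfolding borel_measurable_pair_iff[OF G] by measurable
  then show ?thesis
    by (simp add: integrable_iff_bounded nn_integral_joint_fst[OF G, of "\<lambda>x. ennreal (norm (h x))"])
qed

section \<open>Mixtures of parameter distributions\<close>

lemma distribution_on_mix:
  assumes "distribution_on T G0" "distribution_on T G" "t \<in> {0..1}"
  shows "distribution_on T (mix t G0 G)"
proof -
  interpret G0: prob_space G0 by (rule distributionD[OF assms(1)])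
  interpret G: prob_space G by (rule distributionD[OF assms(2)])
  have s: "sets G = sets G0" "space G = space G0"
    using distributionD[OF assms(1)] distributionD[OF assms(2)] by auto
  have "emeasure (mix t G0 G) (space (mix t G0 G)) = 1"
    using assms(3) s G0.emeasure_space_1 G.emeasure_space_1
    by (simp add: emeasure_mix ennreal_plus[symmetric] del: ennreal_plus)
  then show ?thesis
    using distributionD(2)[OF assms(1)] unfolding distribution_on_def by (auto intro: prob_spaceI)
qed

lemma nn_integral_mix:
  assumes "distribution_on T G0" "distribution_on T G" "h \<in> borel_measurable T"
  shows "(\<integral>\<^sup>+\<theta>. h \<theta> \<partial>mix t G0 G) = ennreal (1 - t) * (\<integral>\<^sup>+\<theta>. h \<theta> \<partial>G0) + ennreal t * (\<integral>\<^sup>+\<theta>. h \<theta> \<partial>G)"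
  using distributionD(2)[OF assms(1)] distributionD(2)[OF assms(2)] assms(3)
  by (intro nn_integral_combination) (auto simp: emeasure_mix cong: measurable_cong_sets)

lemma mixture_density_mix:
  assumes G: "distribution_on T G0" "distribution_on T G" and x: "x \<in> space \<nu>"
  shows "mixture_density f (mix t G0 G) x = ennreal (1 - t) * mixture_density f G0 x + ennreal t * mixture_density f G x"
proof -
  note [measurable] = f_measurable
  have "(\<lambda>\<theta>. ennreal (f x \<theta>)) \<in> borel_measurable T" using x by measurable
  then show ?thesis unfolding mixture_density_def by (intro nn_integral_mix G)
qed

lemma emeasure_joint_mix:
  assumes G0: "distribution_on T G0" and G: "distribution_on T G" and t: "t \<in> {0..1}" and S: "S \<in> sets (\<nu> \<Otimes>\<^sub>M T)"
  shows "emeasure (J (mix t G0 G)) S = ennreal (1 - t) * emeasure (J G0) S + ennreal t * emeasure (J G) S"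
proof -
  note mixd = distribution_on_mix[OF G0 G t]
  interpret G0: prob_space G0 by (rule distributionD[OF G0])
  interpret G: prob_space G by (rule distributionD[OF G])
  note [measurable] = f_measurable S
  have em: "emeasure (J H) S = (\<integral>\<^sup>+x. \<integral>\<^sup>+\<theta>. ennreal (f x \<theta>) * indicator S (x, \<theta>) \<partial>H \<partial>\<nu>)" if H: "distribution_on T H" for H
    using nn_integral_joint[OF H, of "indicator S"] S distributionD[OF H] by simp
  have m: "(\<lambda>x. \<integral>\<^sup>+\<theta>. ennreal (f x \<theta>) * indicator S (x, \<theta>) \<partial>H) \<in> borel_measurable \<nu>" if H: "distribution_on T H" for H
  proof -
    interpret H: prob_space H by (rule distributionD[OF H])
    have [measurable]: "case_prod f \<in> borel_measurable (\<nu> \<Otimes>\<^sub>M H)" "S \<in> sets (\<nu> \<Otimes>\<^sub>M H)"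
      using f_measurable S borel_measurable_pair_iff[OF H] distributionD(4)[OF H] by auto
    show ?thesis by measurable
  qed
  have "emeasure (J (mix t G0 G)) S = (\<integral>\<^sup>+x. ennreal (1 - t) * (\<integral>\<^sup>+\<theta>. ennreal (f x \<theta>) * indicator S (x, \<theta>) \<partial>G0)
      + ennreal t * (\<integral>\<^sup>+\<theta>. ennreal (f x \<theta>) * indicator S (x, \<theta>) \<partial>G) \<partial>\<nu>)"
    unfolding em[OF mixd] by (intro nn_integral_cong nn_integral_mix G0 G) measurable
  also have "\<dots> = ennreal (1 - t) * emeasure (J G0) S + ennreal t * emeasure (J G) S"
    unfolding em[OF G0] em[OF G] using m[OF G0] m[OF G]
    by (simp add: nn_integral_add nn_integral_cmult)
  finally show ?thesis .
qed

lemma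
  fixes h :: "'x \<times> 't \<Rightarrow> complex"
  assumes G: "distribution_on T G0" "distribution_on T G" "t \<in> {0..1}" and h: "integrable (J G0) h" "integrable (J G) h"
  shows integrable_joint_mix: "integrable (J (mix t G0 G)) h"
    and integral_joint_mix: "integral\<^sup>L (J (mix t G0 G)) h = of_real (1 - t) * integral\<^sup>L (J G0) h + of_real t * integral\<^sup>L (J G) h"
proof -
  note s = distributionD(5)[OF distribution_on_mix[OF G]] distributionD(5)[OF G(1)] distributionD(5)[OF G(2)]
  have em: "emeasure (J (mix t G0 G)) S = ennreal (1 - t) * emeasure (J G0) S + ennreal t * emeasure (J G) S"
    if "S \<in> sets (J (mix t G0 G))" for S
    using that s by (intro emeasure_joint_mix G) auto
  show "integrable (J (mix t G0 G)) h"
    by (rule integrable_combination[OF _ _ _ _ em h]) (use s G in auto)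
  show "integral\<^sup>L (J (mix t G0 G)) h = of_real (1 - t) * integral\<^sup>L (J G0) h + of_real t * integral\<^sup>L (J G) h"
    by (rule integral_combination[OF _ _ _ _ em h]) (use s G in auto)
qed

end

section \<open>Two directions of approach\<close>

text \<open>Expansion around 1 gives |K|^2 = 1 + 2 Re (K - 1) + |K - 1|^2; Cauchy-Schwarz and 1 + y
  \<le> exp y do the rest. The two terms of the exponent are kept apart because their limits have
  different origins.\<close>

lemma power_integral_norm_le:
  fixes K :: "'a \<Rightarrow> complex"
  assumes "prob_space P" and [measurable]: "K \<in> borel_measurable P" and i: "integrable P (\<lambda>x. (cmod (K x - 1))\<^sup>2)"
  shows "((\<integral>x. cmod (K x) \<partial>P) ^ n)\<^sup>2 \<le>
      exp (real n * (2 * Re (CLINT x|P. K x - 1) + (\<integral>x. (cmod (K x - 1))\<^sup>2 \<partial>P)))"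
proof -
  interpret prob_space P by fact
  let ?R = "\<lambda>x. K x - 1" and ?y = "2 * Re (CLINT x|P. K x - 1) + (\<integral>x. (cmod (K x - 1))\<^sup>2 \<partial>P)"
  have "integrable P (\<lambda>x. cmod (?R x))"
    using i by (rule square_integrable_imp_integrable[rotated]) measurable
  then have R: "integrable P ?R" by (rule integrable_norm_cancel) measurable
  from Bochner_Integration.integrable_add[OF R integrable_const[of 1]] have Ki: "integrable P K" by simp
  have eq: "(cmod (K x))\<^sup>2 = 1 + 2 * Re (?R x) + (cmod (?R x))\<^sup>2" for x
    unfolding cmod_power2 minus_complex.simps one_complex.simps by (simp add: power2_eq_square algebra_simps)
  have i2: "integrable P (\<lambda>x. (cmod (K x))\<^sup>2)"
    unfolding eq using R Ki i by auto
  have "(\<integral>x. (cmod (K x))\<^sup>2 \<partial>P) = 1 + ?y"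
    unfolding eq using R Ki i by (simp add: prob_space)
  moreover have "(\<integral>x. cmod (K x) * 1 \<partial>P)\<^sup>2 \<le> (\<integral>x. (cmod (K x))\<^sup>2 \<partial>P) * (\<integral>x. 1\<^sup>2 \<partial>P)"
    using i2 by (intro L2_Cauchy_Schwarz) auto
  ultimately have "(\<integral>x. cmod (K x) \<partial>P)\<^sup>2 \<le> 1 + ?y" by (simp add: prob_space)
  also have "\<dots> \<le> exp ?y" by (rule exp_ge_add_one_self)
  finally have "((\<integral>x. cmod (K x) \<partial>P)\<^sup>2) ^ n \<le> exp ?y ^ n"
    by (intro power_mono) auto
  moreover have "((\<integral>x. cmod (K x) \<partial>P)\<^sup>2) ^ n = ((\<integral>x. cmod (K x) \<partial>P) ^ n)\<^sup>2"
    by (simp only: power_mult[symmetric] mult.commute)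
  ultimately show ?thesis
    by (simp only: exp_of_nat_mult)
qed

lemma norm_integral_prod_le:
  fixes K :: "'a \<Rightarrow> complex" and n :: nat
  assumes P: "prob_space P" and K: "integrable P K" and A: "\<And>x. norm (A x) \<le> 1"
  shows "cmod (\<integral>x. A x * (\<Prod>j<n. K (x j)) \<partial>(\<Pi>\<^sub>M j\<in>{..<n}. P)) \<le> (\<integral>x. cmod (K x) \<partial>P) ^ n"
proof -
  interpret P: prob_space P by fact
  interpret PP: product_sigma_finite "\<lambda>_. P" by standard
  have "cmod (\<integral>x. A x * (\<Prod>j<n. K (x j)) \<partial>(\<Pi>\<^sub>M j\<in>{..<n}. P)) \<le> (\<integral>x. cmod (A x * (\<Prod>j<n. K (x j))) \<partial>(\<Pi>\<^sub>M j\<in>{..<n}. P))"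
    by (rule integral_norm_bound)
  also have "\<dots> \<le> (\<integral>x. (\<Prod>j<n. cmod (K (x j))) \<partial>(\<Pi>\<^sub>M j\<in>{..<n}. P))"
    using A K by (intro integral_mono' PP.product_integrable_prod)
      (auto simp: norm_mult prod_norm[symmetric] intro!: mult_left_le_one_le prod_nonneg)
  also have "\<dots> = (\<Prod>j<n. \<integral>x. cmod (K x) \<partial>P)"
    using K by (intro PP.product_integral_prod) auto
  finally show ?thesis by simp
qed

context mixture_model
begin

abbreviation lr :: "'t measure \<Rightarrow> 't measure \<Rightarrow> 'x \<Rightarrow> real" where
  "lr G0 G x \<equiv> dens G x / dens G0 x"

lemma AE_P':
  assumes "distribution_on T G" "AE x in \<nu>. Q x"
  shows "AE x in P G. Q x"
  using assms(2) by (intro AE_P assms(1)) auto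

text \<open>Conditional Jensen inequality, from the nonnegative conditional mean of the squared
  deviation of \<open>\<bar>w z\<bar>\<close> from its own conditional mean. The absolute value
  appears because the conditional mean of \<open>\<bar>w z\<bar>\<close> later dominates the
  rescaled factors.\<close>

lemma cmean_power2_le:
  fixes w :: "'x \<times> 't \<Rightarrow> real"
  assumes G: "distribution_on T G" and w: "w \<in> borel_measurable (\<nu> \<Otimes>\<^sub>M T)" "integrable (J G) (\<lambda>z. (w z)\<^sup>2)"
  shows "AE x in P G. (cmean G G (\<lambda>z. \<bar>w z\<bar>) x)\<^sup>2 \<le> cmean G G (\<lambda>z. (w z)\<^sup>2) x"
proof -
  interpret J: prob_space "J G" by (rule prob_space_joint[OF G])
  have [measurable]: "w \<in> borel_measurable (J G)" unfolding borel_measurable_pair_iff(2)[OF G] by (rule w(1))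
  have w1: "integrable (J G) (\<lambda>z. \<bar>w z\<bar>)"
    using w(2) by (intro integrable_abs) (rule J.square_integrable_imp_integrable[rotated], auto)
  have one: "integrable (J G) (\<lambda>z. 1 :: real)" by simp
  have "AE x in \<nu>. 0 < dens G x \<longrightarrow> (cmean G G (\<lambda>z. \<bar>w z\<bar>) x)\<^sup>2 \<le> cmean G G (\<lambda>z. (w z)\<^sup>2) x"
    using AE_integrable_section[OF G w(2)] AE_integrable_section[OF G w1] AE_integrable_section[OF G one]
      cmean_const[OF G, of G "1 :: real"] AE_space
  proof eventually_elim
    case (elim x)
    show ?case
    proof
      assume d: "0 < dens G x"
      let ?a = "cmean G G (\<lambda>z. \<bar>w z\<bar>) x"
      have 1: "cmean G G (\<lambda>_. 1 :: real) x = 1" using elim(4) d by simp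
      have "0 \<le> (\<integral>\<theta>. f x \<theta> * (\<bar>w (x, \<theta>)\<bar> - ?a)\<^sup>2 \<partial>G)"
        using elim(5) f_nonneg distributionD(3)[OF G] by (intro integral_nonneg_AE AE_I2) auto
      also have "\<dots> = (\<integral>\<theta>. f x \<theta> * (w (x, \<theta>))\<^sup>2 - 2 * ?a * (f x \<theta> * \<bar>w (x, \<theta>)\<bar>) + ?a\<^sup>2 * f x \<theta> \<partial>G)"
        by (intro Bochner_Integration.integral_cong refl) (simp add: power2_eq_square algebra_simps)
      also have "\<dots> = (\<integral>\<theta>. f x \<theta> * (w (x, \<theta>))\<^sup>2 \<partial>G) - 2 * ?a * (\<integral>\<theta>. f x \<theta> * \<bar>w (x, \<theta>)\<bar> \<partial>G) + ?a\<^sup>2 * (\<integral>\<theta>. f x \<theta> \<partial>G)"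
        using elim(1-3) by simp
      finally have "0 \<le> cmean G G (\<lambda>z. (w z)\<^sup>2) x - 2 * ?a * ?a + ?a\<^sup>2 * cmean G G (\<lambda>_. 1 :: real) x"
        using d by (simp add: cmean_def field_simps)
      then show "?a\<^sup>2 \<le> cmean G G (\<lambda>z. (w z)\<^sup>2) x"
        unfolding 1 by (simp add: power2_eq_square)
    qed
  qed
  then show ?thesis by (rule AE_P[OF G])
qed

lemma dominated_refl: "distribution_on T G \<Longrightarrow> dominated G G"
  by (simp add: dominated_def)

lemma cmean_abs_square_integrable:
  fixes w :: "'x \<times> 't \<Rightarrow> real"
  assumes G: "distribution_on T G" and w: "w \<in> borel_measurable (\<nu> \<Otimes>\<^sub>M T)" "integrable (J G) (\<lambda>z. (w z)\<^sup>2)"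
  shows "integrable (P G) (\<lambda>x. (cmean G G (\<lambda>z. \<bar>w z\<bar>) x)\<^sup>2)"
proof (rule Bochner_Integration.integrable_bound[OF cmean_integrable[OF dominated_refl[OF G] w(2)]])
  note [measurable] = w(1)
  have "(\<lambda>z. \<bar>w z\<bar>) \<in> borel_measurable (\<nu> \<Otimes>\<^sub>M T)" by measurable
  note [measurable] = cmean_measurable[OF G G this]
  show "(\<lambda>x. (cmean G G (\<lambda>z. \<bar>w z\<bar>) x)\<^sup>2) \<in> borel_measurable (P G)"
    by simp
  show "AE x in P G. norm ((cmean G G (\<lambda>z. \<bar>w z\<bar>) x)\<^sup>2) \<le> norm (cmean G G (\<lambda>z. (w z)\<^sup>2) x)"
    using cmean_power2_le[OF assms] by eventually_elim auto
qed

lemma cmean_square_integrable: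
  fixes w :: "'x \<times> 't \<Rightarrow> real"
  assumes G: "distribution_on T G" and w: "w \<in> borel_measurable (\<nu> \<Otimes>\<^sub>M T)" "integrable (J G) (\<lambda>z. (w z)\<^sup>2)"
  shows "integrable (P G) (\<lambda>x. (cmean G G w x)\<^sup>2)"
proof (rule Bochner_Integration.integrable_bound[OF cmean_abs_square_integrable[OF G w(1) w(2)]])
  interpret J: prob_space "J G" by (rule prob_space_joint[OF G])
  have [measurable]: "w \<in> borel_measurable (J G)" unfolding borel_measurable_pair_iff(2)[OF G] by (rule w(1))
  have w1: "integrable (J G) (\<lambda>z. \<bar>w z\<bar>)"
    using w(2) by (intro integrable_abs) (rule J.square_integrable_imp_integrable[rotated], auto)
  show "(\<lambda>x. (cmean G G w x)\<^sup>2) \<in> borel_measurable (P G)"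
  proof -
    note [measurable] = cmean_measurable[OF G G w(1)]
    show ?thesis by simp
  qed
  have "AE x in \<nu>. norm (cmean G G w x) \<le> cmean G G (\<lambda>z. \<bar>w z\<bar>) x"
    by (rule cmean_norm_le[OF G w(1) w1]) simp
  from AE_P'[OF G this]
  show "AE x in P G. norm ((cmean G G w x)\<^sup>2) \<le> norm ((cmean G G (\<lambda>z. \<bar>w z\<bar>) x)\<^sup>2)"
    by eventually_elim (auto simp: abs_le_square_iff[symmetric])
qed

end

text \<open>The argument \<open>s\<close> of the characteristic function is a fixed parameter of the
  locale: the complex analysis takes place in the mixing weights, at one \<open>s\<close> at a
  time.\<close>

locale two_directions = mixture_model \<nu> T f
  for \<nu> :: "'x measure" and T :: "'t measure" and f :: "'x \<Rightarrow> 't \<Rightarrow> real" +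
  fixes G0 G1 G2 :: "'t measure" and w :: "'x \<times> 't \<Rightarrow> real" and s :: real
  assumes dom: "dominated G0 G1" "dominated G0 G2"
    and lr_sq: "integrable (P G0) (\<lambda>x. (lr G0 G1 x)\<^sup>2)" "integrable (P G0) (\<lambda>x. (lr G0 G2 x)\<^sup>2)"
    and w_measurable [measurable]: "w \<in> borel_measurable (\<nu> \<Otimes>\<^sub>M T)"
    and w_sq: "integrable (J G0) (\<lambda>z. (w z)\<^sup>2)"
    and w_int: "integrable (J G1) w" "integrable (J G2) w"
    and w_0: "integral\<^sup>L (J G0) w = 0" "integral\<^sup>L (J G1) w = 0" "integral\<^sup>L (J G2) w = 0"
begin

lemma dist: "distribution_on T G0" "distribution_on T G1" "distribution_on T G2"
  using dom by (auto simp: dominated_def)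

sublocale J0: prob_space "J G0" by (rule prob_space_joint[OF dist(1)])
sublocale J1: prob_space "J G1" by (rule prob_space_joint[OF dist(2)])
sublocale J2: prob_space "J G2" by (rule prob_space_joint[OF dist(3)])
sublocale P0: prob_space "P G0" by (rule prob_space_P[OF dist(1)])

definition e :: "nat \<Rightarrow> 'x \<times> 't \<Rightarrow> complex" where
  "e n z = iexp (s * w z / sqrt (real n))"

abbreviation k :: "'t measure \<Rightarrow> nat \<Rightarrow> 'x \<Rightarrow> complex" where
  "k G n \<equiv> cmean G0 G (e n)"

text \<open>For small nonnegative weights this is the conditional mean, times the likelihood ratio,
  of \<open>e n\<close> under the mixture with weights \<zeta>1 / \<surd>n on \<open>G1\<close> and
  \<zeta>2 / \<surd>n on \<open>G2\<close>. Being affine in the weights, it makes sense for complex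
  ones.\<close>

definition K :: "complex \<Rightarrow> complex \<Rightarrow> nat \<Rightarrow> 'x \<Rightarrow> complex" where
  "K \<zeta>1 \<zeta>2 n x = k G0 n x + \<zeta>1 / sqrt (real n) * (k G1 n x - k G0 n x) + \<zeta>2 / sqrt (real n) * (k G2 n x - k G0 n x)"

abbreviation g :: "'x \<Rightarrow> real" where "g \<equiv> cmean G0 G0 w"
abbreviation \<sigma>2 :: real where "\<sigma>2 \<equiv> (\<integral>z. (w z)\<^sup>2 \<partial>J G0)"

text \<open>A square integrable bound for \<surd>n |K - 1|, uniform in \<open>n\<close> and in
  weights of modulus at most \<open>Z\<close>. The 2 comes from subtracting \<open>k G0 n\<close>,
  of modulus at most 1, once in each direction.\<close>

definition Q :: "real \<Rightarrow> 'x \<Rightarrow> real" where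
  "Q Z x = \<bar>s\<bar> * cmean G0 G0 (\<lambda>z. \<bar>w z\<bar>) x + Z * (lr G0 G1 x + lr G0 G2 x + 2)"

text \<open>The exponent of \<open>power_integral_norm_le\<close>; it bounds the squared modulus of
  the characteristic function continued to complex weights.\<close>

definition Y :: "complex \<Rightarrow> complex \<Rightarrow> nat \<Rightarrow> real" where
  "Y \<zeta>1 \<zeta>2 n = real n * (2 * Re (CLINT x|P G0. K \<zeta>1 \<zeta>2 n x - 1) + (\<integral>x. (cmod (K \<zeta>1 \<zeta>2 n x - 1))\<^sup>2 \<partial>P G0))"

section \<open>Expansion of the averaged factors\<close>

lemma w0_int: "integrable (J G0) w"
  by (rule J0.square_integrable_imp_integrable[OF _ w_sq])
    (simp only: borel_measurable_pair_iff(2)[OF dist(1)] w_measurable)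

lemma e_measurable [measurable]: "e n \<in> borel_measurable (\<nu> \<Otimes>\<^sub>M T)"
  unfolding e_def[abs_def] by measurable

lemma e_integrable: "distribution_on T G \<Longrightarrow> integrable (J G) (e n)"
proof -
  assume G: "distribution_on T G"
  interpret J: prob_space "J G" by (rule prob_space_joint[OF G])
  show ?thesis
    by (rule J.integrable_const_bound[of _ 1])
      (auto simp: e_def e_measurable[unfolded borel_measurable_pair_iff(2)[OF G, symmetric]])
qed

lemma k_integrable: "dominated G0 G \<Longrightarrow> integrable (P G0) (k G n)"
  by (intro cmean_integrable e_integrable) (auto simp: dominated_def)

lemma integral_k: "dominated G0 G \<Longrightarrow> integral\<^sup>L (P G0) (k G n) = integral\<^sup>L (J G) (e n)"
  by (intro integral_cmean e_integrable) (auto simp: dominated_def)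

lemma dom0: "dominated G0 G0" by (rule dominated_refl[OF dist(1)])

lemma K_integrable: "integrable (P G0) (K \<zeta>1 \<zeta>2 n)"
  unfolding K_def[abs_def] using k_integrable[OF dom0] k_integrable[OF dom(1)] k_integrable[OF dom(2)]
  by auto

lemma norm_k_le: "distribution_on T G \<Longrightarrow> AE x in \<nu>. cmod (k G n x) \<le> lr G0 G x"
proof -
  assume G: "distribution_on T G"
  interpret J: prob_space "J G" by (rule prob_space_joint[OF G])
  have "AE x in \<nu>. norm (k G n x) \<le> cmean G0 G (\<lambda>_. 1) x"
    by (rule cmean_norm_le[OF G e_measurable]) (auto simp: e_def)
  then show ?thesis
    using cmean_const[OF G, of G0 "1 :: real"] by eventually_elim simp
qed

lemma k_tendsto: "distribution_on T G \<Longrightarrow> AE x in \<nu>. (\<lambda>n. k G n x) \<longlonglongrightarrow> of_real (lr G0 G x)"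
proof -
  assume G: "distribution_on T G"
  interpret J: prob_space "J G" by (rule prob_space_joint[OF G])
  have "(\<lambda>n. e n z) \<longlonglongrightarrow> 1" for z
  proof -
    have "(\<lambda>n. s * w z / sqrt (real n)) \<longlonglongrightarrow> 0" by real_asymp
    then have "(\<lambda>n. iexp (s * w z / sqrt (real n))) \<longlonglongrightarrow> iexp 0"
      by (intro tendsto_intros)
    then show ?thesis by (simp add: e_def)
  qed
  then have "AE x in \<nu>. (\<lambda>n. k G n x) \<longlonglongrightarrow> cmean G0 G (\<lambda>_. 1) x"
    by (intro cmean_tendsto[OF G, where W = "\<lambda>_. 1"]) (auto simp: e_def)
  then show ?thesis
    using cmean_const[OF G, of G0 "1 :: complex"] by eventually_elim (simp add: scaleR_conv_of_real)
qed

text \<open>Dominated convergence inside the integral over the parameter. The constant 1 has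
  conditional mean 1 only where \<open>dens G0\<close> is positive, hence the claims almost
  everywhere under \<open>P G0\<close>.\<close>

lemma sqrt_k0:
  shows "AE x in P G0. cmod (of_real (sqrt (real n)) * (k G0 n x - 1)) \<le> \<bar>s\<bar> * cmean G0 G0 (\<lambda>z. \<bar>w z\<bar>) x"
    and "AE x in P G0. (\<lambda>n. of_real (sqrt (real n)) * (k G0 n x - 1)) \<longlonglongrightarrow> \<i> * of_real (s * g x)"
proof -
  define E where "E n z = of_real (sqrt (real n)) * (e n z - 1)" for n z
  have E_m: "E n \<in> borel_measurable (\<nu> \<Otimes>\<^sub>M T)" for n unfolding E_def[abs_def] by measurable
  have i: "integrable (J G0) (\<lambda>z. \<bar>s\<bar> * \<bar>w z\<bar>)" using w0_int by auto
  have le: "norm (E n z) \<le> \<bar>s\<bar> * \<bar>w z\<bar>" for n z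
    unfolding E_def e_def using norm_sqrt_iexp_le[of n "s * w z"] by (simp only: abs_mult)
  have eq: "AE x in \<nu>. 0 < dens G0 x \<longrightarrow> of_real (sqrt (real n)) * (k G0 n x - 1) = cmean G0 G0 (E n) x" for n
    using cmean_diff[OF dist(1) e_integrable[OF dist(1), of n] J0.integrable_const[of 1], of G0] cmean_const[OF dist(1), of G0 "1 :: complex"]
  proof eventually_elim
    case (elim x)
    have "cmean G0 G0 (E n) x = of_real (sqrt (real n)) * cmean G0 G0 (\<lambda>z. e n z - 1) x"
      unfolding E_def by (rule cmean_mult[where h = "\<lambda>_. _"])
    then show ?case using elim by auto
  qed
  have b: "AE x in \<nu>. norm (cmean G0 G0 (E n) x) \<le> cmean G0 G0 (\<lambda>z. \<bar>s\<bar> * \<bar>w z\<bar>) x" for n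
    by (rule cmean_norm_le[OF dist(1) E_m i le])
  show "AE x in P G0. cmod (of_real (sqrt (real n)) * (k G0 n x - 1)) \<le> \<bar>s\<bar> * cmean G0 G0 (\<lambda>z. \<bar>w z\<bar>) x"
    using AE_P[OF dist(1) eq[of n]] AE_P'[OF dist(1) b[of n]]
    by eventually_elim (simp only: cmean_mult[where h = "\<lambda>_. _"])
  have lim: "AE x in \<nu>. (\<lambda>n. cmean G0 G0 (E n) x) \<longlonglongrightarrow> cmean G0 G0 (\<lambda>z. \<i> * of_real (s * w z)) x"
  proof (rule cmean_tendsto[OF dist(1) E_m _ i le])
    show "(\<lambda>n. E n z) \<longlonglongrightarrow> \<i> * of_real (s * w z)" for z
      unfolding E_def e_def by (rule tendsto_iexp_first_order)
  qed measurable
  have "AE x in P G0. \<forall>n. of_real (sqrt (real n)) * (k G0 n x - 1) = cmean G0 G0 (E n) x"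
    unfolding AE_all_countable using AE_P[OF dist(1) eq] by blast
  then show "AE x in P G0. (\<lambda>n. of_real (sqrt (real n)) * (k G0 n x - 1)) \<longlonglongrightarrow> \<i> * of_real (s * g x)"
    using AE_P'[OF dist(1) lim]
  proof eventually_elim
    case (elim x)
    have "cmean G0 G0 (\<lambda>z. \<i> * of_real (s * w z)) x = \<i> * of_real (s * g x)"
      by (simp only: cmean_mult[where h = "\<lambda>_. _"] cmean_of_real)
    with elim show ?case by simp
  qed
qed

lemma lr_0: "AE x in P G0. lr G0 G0 x = 1"
  by (rule AE_P[OF dist(1)]) auto

lemma Q_measurable [measurable]: "Q Z \<in> borel_measurable \<nu>"
proof -
  have "(\<lambda>z. \<bar>w z\<bar>) \<in> borel_measurable (\<nu> \<Otimes>\<^sub>M T)" by measurable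
  note [measurable] = cmean_measurable[OF dist(1) dist(1) this] dens_measurable[OF dist(1)]
     dens_measurable[OF dist(2)] dens_measurable[OF dist(3)]
  show ?thesis unfolding Q_def[abs_def] by measurable
qed

lemma Q_square_integrable: "integrable (P G0) (\<lambda>x. (Q Z x)\<^sup>2)"
proof -
  have m0: "(\<lambda>z. \<bar>w z\<bar>) \<in> borel_measurable (\<nu> \<Otimes>\<^sub>M T)" by measurable
  note m = cmean_measurable[OF dist(1) dist(1) m0] dens_measurable[OF dist(1)]
     dens_measurable[OF dist(2)] dens_measurable[OF dist(3)]
  note [measurable] = m
  let ?m = "cmean G0 G0 (\<lambda>z. \<bar>w z\<bar>)"
  have 1: "integrable (P G0) (\<lambda>x. (1 * lr G0 G1 x + 1 * lr G0 G2 x)\<^sup>2)"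
    by (intro L2_combination_integrable lr_sq) auto
  have 2: "integrable (P G0) (\<lambda>x. (1 * (1 * lr G0 G1 x + 1 * lr G0 G2 x) + 2 * 1)\<^sup>2)"
    by (rule L2_combination_integrable[OF _ _ 1]) auto
  have 3: "integrable (P G0) (\<lambda>x. (\<bar>s\<bar> * ?m x + Z * (1 * (1 * lr G0 G1 x + 1 * lr G0 G2 x) + 2 * 1))\<^sup>2)"
    by (rule L2_combination_integrable[OF _ _ cmean_abs_square_integrable[OF dist(1) w_measurable w_sq] 2]) auto
  show ?thesis using 3 by (simp add: Q_def algebra_simps)
qed

lemma sqrt_K_le:
  assumes "cmod \<zeta>1 \<le> Z" "cmod \<zeta>2 \<le> Z"
  shows "AE x in P G0. cmod (of_real (sqrt (real n)) * (K \<zeta>1 \<zeta>2 n x - 1)) \<le> Q Z x"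
  using sqrt_k0(1)[of n] AE_P'[OF dist(1) norm_k_le[OF dist(1), of n]] AE_P'[OF dist(1) norm_k_le[OF dist(2), of n]]
    AE_P'[OF dist(1) norm_k_le[OF dist(3), of n]] lr_0
proof eventually_elim
  case (elim x)
  show ?case
  proof (cases "n = 0")
    \<comment> \<open>For \<open>n = 0\<close> the left side is 0, so only nonnegativity of
      \<open>Q\<close> matters; the other case cancels the factor \<open>sqrt n\<close>.\<close>
    case True
    then show ?thesis
      using elim(1) order_trans[OF norm_ge_zero elim(3)] order_trans[OF norm_ge_zero elim(4)]
        order_trans[OF norm_ge_zero assms(1)] by (simp add: Q_def)
  next
    case False
    then have eq: "of_real (sqrt (real n)) * (K \<zeta>1 \<zeta>2 n x - 1) =
        of_real (sqrt (real n)) * (k G0 n x - 1) + \<zeta>1 * (k G1 n x - k G0 n x) + \<zeta>2 * (k G2 n x - k G0 n x)"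
      by (simp add: K_def field_simps)
    have "cmod (of_real (sqrt (real n)) * (K \<zeta>1 \<zeta>2 n x - 1)) \<le> cmod (of_real (sqrt (real n)) * (k G0 n x - 1)) + cmod (\<zeta>1 * (k G1 n x - k G0 n x)) + cmod (\<zeta>2 * (k G2 n x - k G0 n x))"
      unfolding eq by (rule order_trans[OF norm_triangle_ineq add_mono[OF norm_triangle_ineq order_refl]])
    also have "\<dots> \<le> \<bar>s\<bar> * cmean G0 G0 (\<lambda>z. \<bar>w z\<bar>) x + Z * (lr G0 G1 x + 1) + Z * (lr G0 G2 x + 1)"
    proof (intro add_mono elim(1))
      have a: "cmod (k G1 n x - k G0 n x) \<le> lr G0 G1 x + 1"
        using norm_triangle_ineq4[of "k G1 n x" "k G0 n x"] elim by linarith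
      show "cmod (\<zeta>1 * (k G1 n x - k G0 n x)) \<le> Z * (lr G0 G1 x + 1)"
        unfolding norm_mult using a assms order_trans[OF norm_ge_zero assms(1)] by (intro mult_mono) auto
      have a: "cmod (k G2 n x - k G0 n x) \<le> lr G0 G2 x + 1"
        using norm_triangle_ineq4[of "k G2 n x" "k G0 n x"] elim by linarith
      show "cmod (\<zeta>2 * (k G2 n x - k G0 n x)) \<le> Z * (lr G0 G2 x + 1)"
        unfolding norm_mult using a assms order_trans[OF norm_ge_zero assms(1)] by (intro mult_mono) auto
    qed
    also have "\<dots> = Q Z x" by (simp add: Q_def algebra_simps)
    finally show ?thesis .
  qed
qed

text \<open>For imaginary weights the limit is \<i> times a real function, in which a combination of
  the scores can offset \<open>s * g x\<close>.\<close>

lemma sqrt_K_tendsto: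
  "AE x in P G0. (\<lambda>n. of_real (sqrt (real n)) * (K \<zeta>1 \<zeta>2 n x - 1)) \<longlonglongrightarrow>
     \<i> * of_real (s * g x) + \<zeta>1 * of_real (lr G0 G1 x - 1) + \<zeta>2 * of_real (lr G0 G2 x - 1)"
  using sqrt_k0(2) AE_P'[OF dist(1) k_tendsto[OF dist(1)]] AE_P'[OF dist(1) k_tendsto[OF dist(2)]]
    AE_P'[OF dist(1) k_tendsto[OF dist(3)]] lr_0
proof eventually_elim
  case (elim x)
  have "(\<lambda>n. of_real (sqrt (real n)) * (k G0 n x - 1) + \<zeta>1 * (k G1 n x - k G0 n x) + \<zeta>2 * (k G2 n x - k G0 n x)) \<longlonglongrightarrow>
      \<i> * of_real (s * g x) + \<zeta>1 * (of_real (lr G0 G1 x) - of_real (lr G0 G0 x)) + \<zeta>2 * (of_real (lr G0 G2 x) - of_real (lr G0 G0 x))"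
    by (intro tendsto_add elim(1) tendsto_mult[OF tendsto_const] tendsto_diff elim(2-4))
  then have "(\<lambda>n. of_real (sqrt (real n)) * (k G0 n x - 1) + \<zeta>1 * (k G1 n x - k G0 n x) + \<zeta>2 * (k G2 n x - k G0 n x)) \<longlonglongrightarrow>
      \<i> * of_real (s * g x) + \<zeta>1 * of_real (lr G0 G1 x - 1) + \<zeta>2 * of_real (lr G0 G2 x - 1)"
    using elim(5) by simp
  moreover have "\<forall>\<^sub>F n in sequentially. of_real (sqrt (real n)) * (k G0 n x - 1) + \<zeta>1 * (k G1 n x - k G0 n x) + \<zeta>2 * (k G2 n x - k G0 n x)
       = of_real (sqrt (real n)) * (K \<zeta>1 \<zeta>2 n x - 1)"
    by (rule eventually_sequentiallyI[of 1]) (simp add: K_def field_simps)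
  ultimately show ?case by (rule Lim_transform_eventually)
qed

text \<open>Integrating \<open>K\<close> undoes the conditioning and leads back to the joint laws.
  This part of the exponent therefore sees \<open>w\<close> itself and not its projection
  \<open>g\<close>.\<close>

lemma n_Re_integral_K:
  "real n * (2 * Re (CLINT x|P G0. K \<zeta>1 \<zeta>2 n x - 1)) =
   2 * Re (of_nat n * (CLINT z|J G0. e n z - 1)
     + \<zeta>1 * (of_real (sqrt (real n)) * (CLINT z|J G1. e n z - 1) - of_real (sqrt (real n)) * (CLINT z|J G0. e n z - 1))
     + \<zeta>2 * (of_real (sqrt (real n)) * (CLINT z|J G2. e n z - 1) - of_real (sqrt (real n)) * (CLINT z|J G0. e n z - 1)))"
proof -
  note ki = k_integrable[OF dom0, of n] k_integrable[OF dom(1), of n] k_integrable[OF dom(2), of n]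
  note ei = e_integrable[OF dist(1), of n] e_integrable[OF dist(2), of n] e_integrable[OF dist(3), of n]
  let ?i = "\<lambda>G. integral\<^sup>L (J G) (e n)"
  have 1: "(CLINT z|J G0. e n z - 1) = ?i G0 - 1" "(CLINT z|J G1. e n z - 1) = ?i G1 - 1" "(CLINT z|J G2. e n z - 1) = ?i G2 - 1"
    using ei by (simp_all add: J0.prob_space J1.prob_space J2.prob_space)
  have "(CLINT x|P G0. K \<zeta>1 \<zeta>2 n x - 1) = ?i G0 + \<zeta>1 / sqrt (real n) * (?i G1 - ?i G0) + \<zeta>2 / sqrt (real n) * (?i G2 - ?i G0) - 1"
    unfolding K_def using ki by (simp add: integral_k[OF dom0] integral_k[OF dom(1)] integral_k[OF dom(2)] P0.prob_space[simplified])
  moreover have r: "of_nat n = of_real (sqrt (real n)) * (of_real (sqrt (real n)) :: complex)"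
    by (simp flip: of_real_mult)
  ultimately have "of_nat n * (CLINT x|P G0. K \<zeta>1 \<zeta>2 n x - 1) = of_nat n * (CLINT z|J G0. e n z - 1)
     + \<zeta>1 * (of_real (sqrt (real n)) * (CLINT z|J G1. e n z - 1) - of_real (sqrt (real n)) * (CLINT z|J G0. e n z - 1))
     + \<zeta>2 * (of_real (sqrt (real n)) * (CLINT z|J G2. e n z - 1) - of_real (sqrt (real n)) * (CLINT z|J G0. e n z - 1))"
    unfolding 1 r by (cases "n = 0") (simp_all add: field_simps)
  moreover have "real n * (2 * Re c) = 2 * Re (of_nat n * c)" for c
    by simp
  ultimately show ?thesis by (simp only:)
qed

lemma integral_K_power2:
  "real n * (\<integral>x. (cmod (K \<zeta>1 \<zeta>2 n x - 1))\<^sup>2 \<partial>P G0) = (\<integral>x. (cmod (of_real (sqrt (real n)) * (K \<zeta>1 \<zeta>2 n x - 1)))\<^sup>2 \<partial>P G0)"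
  by (simp add: norm_mult power_mult_distrib)

lemma K_measurable [measurable]: "K \<zeta>1 \<zeta>2 n \<in> borel_measurable \<nu>"
  using borel_measurable_integrable[OF K_integrable] by simp

lemma Q_nonneg_le:
  assumes "cmod \<zeta>1 \<le> Z" "cmod \<zeta>2 \<le> Z"
  shows "AE x in P G0. (cmod (of_real (sqrt (real n)) * (K \<zeta>1 \<zeta>2 n x - 1)))\<^sup>2 \<le> (Q Z x)\<^sup>2"
  using sqrt_K_le[OF assms, of n] by eventually_elim (intro power_mono, auto)

lemma K_power2_integrable: "integrable (P G0) (\<lambda>x. (cmod (K \<zeta>1 \<zeta>2 n x - 1))\<^sup>2)"
proof (cases "n = 0")
  case True
  \<comment> \<open>Division by \<open>sqrt 0\<close> gives 0, so for \<open>n = 0\<close> all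
    factors are 1 and \<open>K\<close> equals 1 almost everywhere.\<close>
  then have e1: "e n = (\<lambda>_. 1)" by (simp add: e_def fun_eq_iff)
  have "AE x in P G0. (cmod (K \<zeta>1 \<zeta>2 n x - 1))\<^sup>2 = 0"
    using AE_P'[OF dist(1) cmean_const[OF dist(1), of G0 "1 :: complex"]] lr_0
    by eventually_elim ((simp only: K_def e1), (simp add: True))
  then show ?thesis
    by (subst integrable_cong_AE[where g = "\<lambda>_. 0"]) auto
next
  case False
  have "integrable (P G0) (\<lambda>x. (cmod (of_real (sqrt (real n)) * (K \<zeta>1 \<zeta>2 n x - 1)))\<^sup>2)"
    by (rule Bochner_Integration.integrable_bound[OF Q_square_integrable[of "max (cmod \<zeta>1) (cmod \<zeta>2)"]])
      (use Q_nonneg_le[of \<zeta>1 "max (cmod \<zeta>1) (cmod \<zeta>2)" \<zeta>2 n] in auto)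
  then show ?thesis using False by (simp add: norm_mult power_mult_distrib)
qed

lemma first_order_bound:
  assumes "integrable M w" "w \<in> borel_measurable M"
  shows "cmod (of_real (sqrt (real n)) * (CLINT z|M. e n z - 1)) \<le> \<bar>s\<bar> * (\<integral>z. \<bar>w z\<bar> \<partial>M)"
proof -
  have eq: "of_real (sqrt (real n)) * (CLINT z|M. e n z - 1) = (CLINT z|M. of_real (sqrt (real n)) * (e n z - 1))"
    by (rule integral_mult_right_zero[symmetric])
  have "cmod (of_real (sqrt (real n)) * (CLINT z|M. e n z - 1)) \<le> (\<integral>z. cmod (of_real (sqrt (real n)) * (e n z - 1)) \<partial>M)"
    unfolding eq by (rule integral_norm_bound)
  also have "\<dots> \<le> (\<integral>z. \<bar>s * w z\<bar> \<partial>M)"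
    unfolding e_def using assms by (intro integral_mono' norm_sqrt_iexp_le) auto
  finally show ?thesis by (simp add: abs_mult)
qed

text \<open>Uniformity in \<open>n\<close> over bounded sets of complex weights is what makes the
  family of characteristic functions normal.\<close>

lemma Y_bounded:
  "\<exists>B. \<forall>n \<zeta>1 \<zeta>2. cmod \<zeta>1 \<le> Z \<longrightarrow> cmod \<zeta>2 \<le> Z \<longrightarrow> Y \<zeta>1 \<zeta>2 n \<le> B"
proof (intro exI allI impI)
  fix n \<zeta>1 \<zeta>2 assume \<zeta>: "cmod \<zeta>1 \<le> Z" "cmod \<zeta>2 \<le> Z"
  have Z0: "0 \<le> Z" using order_trans[OF norm_ge_zero \<zeta>(1)] .
  let ?E = "\<lambda>G. \<integral>z. \<bar>w z\<bar> \<partial>J G"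
  let ?z0 = "of_nat n * (CLINT z|J G0. e n z - 1)"
  let ?r = "\<lambda>G. of_real (sqrt (real n)) * (CLINT z|J G. e n z - 1)"
  have z0: "cmod ?z0 \<le> s\<^sup>2 * \<sigma>2 / 2"
    unfolding e_def by (rule integral_iexp_second_order(2)[OF w0_int w_sq w_0(1)])
  have r: "cmod (?r G0) \<le> \<bar>s\<bar> * ?E G0" "cmod (?r G1) \<le> \<bar>s\<bar> * ?E G1" "cmod (?r G2) \<le> \<bar>s\<bar> * ?E G2"
    using w0_int w_int by (auto intro!: first_order_bound)
  have "real n * (2 * Re (CLINT x|P G0. K \<zeta>1 \<zeta>2 n x - 1)) = 2 * Re (?z0 + \<zeta>1 * (?r G1 - ?r G0) + \<zeta>2 * (?r G2 - ?r G0))"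
    by (rule n_Re_integral_K)
  also have "\<dots> \<le> 2 * cmod (?z0 + \<zeta>1 * (?r G1 - ?r G0) + \<zeta>2 * (?r G2 - ?r G0))"
    by (intro mult_left_mono complex_Re_le_cmod) auto
  also have "\<dots> \<le> 2 * (cmod ?z0 + cmod (\<zeta>1 * (?r G1 - ?r G0)) + cmod (\<zeta>2 * (?r G2 - ?r G0)))"
    by (intro mult_left_mono order_trans[OF norm_triangle_ineq add_mono[OF norm_triangle_ineq order_refl]]) auto
  also have "\<dots> \<le> 2 * (s\<^sup>2 * \<sigma>2 / 2 + Z * (\<bar>s\<bar> * ?E G1 + \<bar>s\<bar> * ?E G0) + Z * (\<bar>s\<bar> * ?E G2 + \<bar>s\<bar> * ?E G0))"
  proof (intro mult_left_mono add_mono z0)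
    have "cmod (?r G1 - ?r G0) \<le> \<bar>s\<bar> * ?E G1 + \<bar>s\<bar> * ?E G0"
      using r by (intro order_trans[OF norm_triangle_ineq4] add_mono)
    then show "cmod (\<zeta>1 * (?r G1 - ?r G0)) \<le> Z * (\<bar>s\<bar> * ?E G1 + \<bar>s\<bar> * ?E G0)"
      unfolding norm_mult[of \<zeta>1] using \<zeta> Z0 by (intro mult_mono) auto
    have "cmod (?r G2 - ?r G0) \<le> \<bar>s\<bar> * ?E G2 + \<bar>s\<bar> * ?E G0"
      using r by (intro order_trans[OF norm_triangle_ineq4] add_mono)
    then show "cmod (\<zeta>2 * (?r G2 - ?r G0)) \<le> Z * (\<bar>s\<bar> * ?E G2 + \<bar>s\<bar> * ?E G0)"
      unfolding norm_mult[of \<zeta>2] using \<zeta> Z0 by (intro mult_mono) auto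
  qed simp
  finally have 1: "real n * (2 * Re (CLINT x|P G0. K \<zeta>1 \<zeta>2 n x - 1)) \<le> \<dots>" .
  have 2: "real n * (\<integral>x. (cmod (K \<zeta>1 \<zeta>2 n x - 1))\<^sup>2 \<partial>P G0) \<le> (\<integral>x. (Q Z x)\<^sup>2 \<partial>P G0)"
    unfolding integral_K_power2 by (intro integral_mono_AE' Q_square_integrable Q_nonneg_le \<zeta>) auto
  show "Y \<zeta>1 \<zeta>2 n \<le> 2 * (s\<^sup>2 * \<sigma>2 / 2 + Z * (\<bar>s\<bar> * ?E G1 + \<bar>s\<bar> * ?E G0) + Z * (\<bar>s\<bar> * ?E G2 + \<bar>s\<bar> * ?E G0)) + (\<integral>x. (Q Z x)\<^sup>2 \<partial>P G0)"
    unfolding Y_def distrib_left[of "real n"] by (intro add_mono 1 2)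
qed

text \<open>Mean 0 of \<open>w\<close> under all three distributions removes the weights from the
  first-order part, which leaves minus \<open>s\<^sup>2 * \<sigma>2\<close>. The squared distances
  converge by domination with the square of \<open>Q\<close>.\<close>

lemma Y_tendsto:
  "(\<lambda>n. Y \<zeta>1 \<zeta>2 n) \<longlonglongrightarrow>
    (\<integral>x. (cmod (\<i> * of_real (s * g x) + \<zeta>1 * of_real (lr G0 G1 x - 1) + \<zeta>2 * of_real (lr G0 G2 x - 1)))\<^sup>2 \<partial>P G0) - s\<^sup>2 * \<sigma>2"
proof -
  let ?r = "\<lambda>G n. of_real (sqrt (real n)) * (CLINT z|J G. e n z - 1)"
  let ?Z = "max (cmod \<zeta>1) (cmod \<zeta>2)"
  note [measurable] = dens_measurable[OF dist(1)] dens_measurable[OF dist(2)] dens_measurable[OF dist(3)]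
    cmean_measurable[OF dist(1) dist(1) w_measurable]
  have r: "?r G \<longlonglongrightarrow> 0" if "integrable (J G) w" "integral\<^sup>L (J G) w = 0" for G
    using integral_iexp_first_order[OF that(1), of s] that(2) by (simp add: e_def)
  have "(\<lambda>n. 2 * Re (of_nat n * (CLINT z|J G0. e n z - 1) + \<zeta>1 * (?r G1 n - ?r G0 n) + \<zeta>2 * (?r G2 n - ?r G0 n)))
      \<longlonglongrightarrow> 2 * Re (- (of_real (s\<^sup>2 * \<sigma>2 / 2)) + \<zeta>1 * (0 - 0) + \<zeta>2 * (0 - 0))"
    using integral_iexp_second_order(1)[OF w0_int w_sq w_0(1), of s]
    by (intro tendsto_intros r w0_int w_int w_0) (simp add: e_def)
  then have 1: "(\<lambda>n. real n * (2 * Re (CLINT x|P G0. K \<zeta>1 \<zeta>2 n x - 1))) \<longlonglongrightarrow> - (s\<^sup>2 * \<sigma>2)"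
    unfolding n_Re_integral_K by simp
  have 2: "(\<lambda>n. real n * (\<integral>x. (cmod (K \<zeta>1 \<zeta>2 n x - 1))\<^sup>2 \<partial>P G0)) \<longlonglongrightarrow>
     (\<integral>x. (cmod (\<i> * of_real (s * g x) + \<zeta>1 * of_real (lr G0 G1 x - 1) + \<zeta>2 * of_real (lr G0 G2 x - 1)))\<^sup>2 \<partial>P G0)"
    unfolding integral_K_power2
  proof (rule integral_dominated_convergence[OF _ _ Q_square_integrable[of ?Z]])
    show "AE x in P G0. norm ((cmod (of_real (sqrt (real n)) * (K \<zeta>1 \<zeta>2 n x - 1)))\<^sup>2) \<le> (Q ?Z x)\<^sup>2" for n
      using Q_nonneg_le[of \<zeta>1 ?Z \<zeta>2 n] by simp
    show "AE x in P G0. (\<lambda>n. (cmod (of_real (sqrt (real n)) * (K \<zeta>1 \<zeta>2 n x - 1)))\<^sup>2) \<longlonglongrightarrow>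
       (cmod (\<i> * of_real (s * g x) + \<zeta>1 * of_real (lr G0 G1 x - 1) + \<zeta>2 * of_real (lr G0 G2 x - 1)))\<^sup>2"
      using sqrt_K_tendsto[of \<zeta>1 \<zeta>2] by eventually_elim (intro tendsto_intros)
  qed auto
  show ?thesis
    unfolding Y_def distrib_left[of "real _"] using tendsto_add[OF 1 2] by simp
qed

section \<open>The characteristic function continued to complex weights\<close>

definition F :: "nat \<Rightarrow> ((nat \<Rightarrow> 'x) \<Rightarrow> complex) \<Rightarrow> complex \<Rightarrow> complex \<Rightarrow> complex" where
  "F n A \<zeta>1 \<zeta>2 = (\<integral>x. A x * (\<Prod>j<n. K \<zeta>1 \<zeta>2 n (x j)) \<partial>(\<Pi>\<^sub>M j\<in>{..<n}. P G0))"

lemma norm_F_le: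
  assumes "\<And>x. norm (A x) \<le> 1"
  shows "(cmod (F n A \<zeta>1 \<zeta>2))\<^sup>2 \<le> exp (Y \<zeta>1 \<zeta>2 n)"
proof -
  have "cmod (F n A \<zeta>1 \<zeta>2) \<le> (\<integral>x. cmod (K \<zeta>1 \<zeta>2 n x) \<partial>P G0) ^ n"
    unfolding F_def by (rule norm_integral_prod_le[OF P0.prob_space_axioms K_integrable assms])
  then have "(cmod (F n A \<zeta>1 \<zeta>2))\<^sup>2 \<le> ((\<integral>x. cmod (K \<zeta>1 \<zeta>2 n x) \<partial>P G0) ^ n)\<^sup>2"
    by (intro power_mono) auto
  also have "\<dots> \<le> exp (Y \<zeta>1 \<zeta>2 n)"
    unfolding Y_def by (rule power_integral_norm_le[OF P0.prob_space_axioms _ K_power2_integrable]) simp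
  finally show ?thesis .
qed

lemma F_holomorphic:
  assumes A: "A \<in> borel_measurable (\<Pi>\<^sub>M j\<in>{..<n}. \<nu>)" "\<And>x. norm (A x) \<le> 1"
    and \<zeta>: "\<zeta>1 holomorphic_on S" "\<zeta>2 holomorphic_on S"
  shows "(\<lambda>z. F n A (\<zeta>1 z) (\<zeta>2 z)) holomorphic_on S"
proof -
  \<comment> \<open>The three coefficients sum to 1; the one of \<open>k G0 n\<close> collects what
    the two directions leave.\<close>
  define kk where "kk i = (if i = 0 then k G0 n else if i = 1 then k G1 n else k G2 n)" for i :: nat
  define c where "c i z = (if i = 0 then 1 - \<zeta>1 z / sqrt (real n) - \<zeta>2 z / sqrt (real n)
      else if i = 1 then \<zeta>1 z / sqrt (real n) else \<zeta>2 z / sqrt (real n))" for i :: nat and z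
  have K_eq: "K (\<zeta>1 z) (\<zeta>2 z) n x = (\<Sum>i<3. c i z * kk i x)" for z x
    by (simp add: K_def c_def kk_def numeral_3_eq_3 algebra_simps)
  have div: "(\<lambda>z. \<zeta>1 z / sqrt (real n)) holomorphic_on S" "(\<lambda>z. \<zeta>2 z / sqrt (real n)) holomorphic_on S"
    unfolding divide_inverse by (intro holomorphic_intros \<zeta>)+
  have Am: "A \<in> borel_measurable (\<Pi>\<^sub>M j\<in>{..<n}. P G0)"
    using A(1) by (simp cong: measurable_cong_sets sets_PiM_cong)
  show ?thesis
    unfolding F_def K_eq
  proof (rule holomorphic_on_integral_prod_sum[OF _ _ Am A(2)])
    show "finite_measure (P G0)" by unfold_locales
    show "integrable (P G0) (kk i)" for i
      by (auto simp: kk_def intro: k_integrable dom0 dom)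
    show "c i holomorphic_on S" for i
      unfolding c_def[abs_def] by (cases "i = 0"; cases "i = 1") (auto intro!: holomorphic_intros div)
  qed
qed

text \<open>The identity for bounded test functions that \<open>integral_PiM_marginal\<close>
  requires, for each of the three distributions separately.\<close>

lemma integral_e_eq:
  assumes dom: "dominated G0 G" and \<phi>: "\<phi> \<in> borel_measurable \<nu>" "\<And>x. norm (\<phi> x) \<le> C"
  shows "(\<integral>z. \<phi> (fst z) * e n z \<partial>J G) = (\<integral>x. \<phi> x * k G n x \<partial>P G0)"
    and "integrable (J G) (\<lambda>z. \<phi> (fst z) * e n z)"
    and "integrable (P G0) (\<lambda>x. \<phi> x * k G n x)"
proof -
  have G: "distribution_on T G" using dom by (simp add: dominated_def)
  interpret J: prob_space "J G" by (rule prob_space_joint[OF G])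
  note [measurable] = \<phi>(1)
  have "(\<lambda>z. \<phi> (fst z) * e n z) \<in> borel_measurable (\<nu> \<Otimes>\<^sub>M T)"
    by measurable
  then have m: "(\<lambda>z. \<phi> (fst z) * e n z) \<in> borel_measurable (J G)"
    unfolding borel_measurable_pair_iff(2)[OF G] .
  show i: "integrable (J G) (\<lambda>z. \<phi> (fst z) * e n z)"
    by (rule J.integrable_const_bound[of _ C]) (use \<phi>(2) m in \<open>auto simp: norm_mult e_def\<close>)
  have eq: "cmean G0 G (\<lambda>z. \<phi> (fst z) * e n z) = (\<lambda>x. \<phi> x * k G n x)"
    by (rule ext) (rule cmean_mult)
  show "(\<integral>z. \<phi> (fst z) * e n z \<partial>J G) = (\<integral>x. \<phi> x * k G n x \<partial>P G0)"
    using integral_cmean[OF dom i] unfolding eq by simp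
  show "integrable (P G0) (\<lambda>x. \<phi> x * k G n x)"
    using cmean_integrable[OF dom i] unfolding eq by simp
qed

text \<open>For real parameters the weights are those of a mixture of the three distributions.\<close>

lemma F_eq_sample:
  assumes t: "0 < t1" "0 < t2" "t1 + t2 \<le> sqrt (real n)"
    and A: "A \<in> borel_measurable (\<Pi>\<^sub>M j\<in>{..<n}. \<nu>)" "\<And>x. norm (A x) \<le> 1"
  shows "(\<integral>\<omega>. A (\<lambda>j\<in>{..<n}. fst (\<omega> j)) * (\<Prod>j<n. e n (\<omega> j))
      \<partial>(\<Pi>\<^sub>M j\<in>{..<n}. J (mix ((t1 + t2) / sqrt (real n)) G0 (mix (t2 / (t1 + t2)) G1 G2)))) =
    F n A (of_real t1) (of_real t2)"
proof -
  \<comment> \<open>Nesting the mixtures gives weight \<open>t1 / sqrt n\<close> to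
    \<open>G1\<close> and \<open>t2 / sqrt n\<close> to \<open>G2\<close>, and keeps the form used
    by regularity: one alternative, approached at the rate \<open>c / sqrt n\<close> with
    \<open>c = t1 + t2\<close>.\<close>
  let ?c = "(t1 + t2) / sqrt (real n)" and ?\<tau> = "t2 / (t1 + t2)"
  let ?G = "mix ?\<tau> G1 G2"
  have r: "0 < sqrt (real n)" using t by linarith
  have \<tau>: "?\<tau> \<in> {0..1}" and c: "?c \<in> {0..1}" using t r by (auto simp: divide_le_eq)
  note dG = distribution_on_mix[OF dist(2,3) \<tau>]
  note dM = distribution_on_mix[OF dist(1) dG c]
  interpret JM: prob_space "J (mix ?c G0 ?G)" by (rule prob_space_joint[OF dM])
  show ?thesis
    unfolding F_def
  proof (rule integral_PiM_marginal[OF _ _ fst_measurable_joint[OF dM] sets_P e_integrable[OF dM] K_integrable _ A])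
    show "finite_measure (J (mix ?c G0 ?G))" "finite_measure (P G0)" by unfold_locales
    fix \<phi> C assume \<phi>: "\<phi> \<in> borel_measurable \<nu>" "\<And>x. norm (\<phi> x :: complex) \<le> C"
    note I0 = integral_e_eq[OF dom0 \<phi>, of n] and I1 = integral_e_eq[OF dom(1) \<phi>, of n] and I2 = integral_e_eq[OF dom(2) \<phi>, of n]
    note mm = integrable_joint_mix[OF dist(2,3) \<tau> I1(2) I2(2)]
    let ?I = "\<lambda>G. \<integral>x. \<phi> x * k G n x \<partial>P G0"
    have "1 - ?\<tau> = t1 / (t1 + t2)" using t by (simp add: field_simps)
    then have c12: "?c * (1 - ?\<tau>) = t1 / sqrt (real n)" "?c * ?\<tau> = t2 / sqrt (real n)" using t by simp_all
    have "(\<integral>z. \<phi> (fst z) * e n z \<partial>J (mix ?c G0 ?G)) =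
        of_real (1 - ?c) * ?I G0 + of_real ?c * (of_real (1 - ?\<tau>) * ?I G1 + of_real ?\<tau> * ?I G2)"
      by (simp only: integral_joint_mix[OF dist(1) dG c I0(2) mm] integral_joint_mix[OF dist(2,3) \<tau> I1(2) I2(2)] I0(1) I1(1) I2(1))
    moreover have "of_real (1 - ?c) * ?I G0 + of_real ?c * (of_real (1 - ?\<tau>) * ?I G1 + of_real ?\<tau> * ?I G2) =
        of_real (1 - ?c) * ?I G0 + of_real (t1 / sqrt (real n)) * ?I G1 + of_real (t2 / sqrt (real n)) * ?I G2"
      unfolding c12[symmetric] of_real_mult by (simp only: distrib_left mult.assoc add.assoc)
    moreover have "of_real (1 - ?c) * ?I G0 + of_real (t1 / sqrt (real n)) * ?I G1 + of_real (t2 / sqrt (real n)) * ?I G2 =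
       (\<integral>x. of_real (1 - ?c) * (\<phi> x * k G0 n x) + of_real (t1 / sqrt (real n)) * (\<phi> x * k G1 n x) + of_real (t2 / sqrt (real n)) * (\<phi> x * k G2 n x) \<partial>P G0)"
      using I0(3) I1(3) I2(3) by simp
    moreover have "\<dots> = (\<integral>x. \<phi> x * K (of_real t1) (of_real t2) n x \<partial>P G0)"
      by (intro Bochner_Integration.integral_cong refl) (simp add: K_def algebra_simps add_divide_distrib)
    ultimately show "(\<integral>z. \<phi> (fst z) * e n z \<partial>J (mix ?c G0 ?G)) = (\<integral>x. \<phi> x * K (of_real t1) (of_real t2) n x \<partial>P G0)"
      by (simp only:)
  qed
qed

text \<open>The curve \<open>z \<mapsto> (a (z\<^sup>2 - z + 1), b z)\<close> maps positive reals to pairs of positive reals and passes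
  through the imaginary point \<open>(- \<i> a, \<i> b)\<close>, at which the bound on \<open>F\<close> is useful.\<close>

lemma norm_char_limit_le:
  fixes A :: "nat \<Rightarrow> (nat \<Rightarrow> 'x) \<Rightarrow> complex"
  assumes A: "\<And>n. A n \<in> borel_measurable (\<Pi>\<^sub>M j\<in>{..<n}. \<nu>)" "\<And>n x. norm (A n x) \<le> 1"
    and ab: "0 < a" "0 < b"
    and lim: "\<And>t1 t2. 0 < t1 \<Longrightarrow> 0 < t2 \<Longrightarrow>
      (\<lambda>n. \<integral>\<omega>. A n (\<lambda>j\<in>{..<n}. fst (\<omega> j)) * (\<Prod>j<n. e n (\<omega> j))
        \<partial>(\<Pi>\<^sub>M j\<in>{..<n}. J (mix ((t1 + t2) / sqrt (real n)) G0 (mix (t2 / (t1 + t2)) G1 G2)))) \<longlonglongrightarrow> c"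
  shows "(cmod c)\<^sup>2 \<le> exp ((\<integral>x. (s * g x - (a * (lr G0 G1 x - 1) - b * (lr G0 G2 x - 1)))\<^sup>2 \<partial>P G0) - s\<^sup>2 * \<sigma>2)"
proof -
  \<comment> \<open>A linear curve with positive coefficients sends \<i> to imaginary numbers of
    equal sign. The quadratic is positive on the reals yet equals - \<i> at \<i>, so one complex
    variable reaches both signs.\<close>
  define p where "p z = of_real a * (z\<^sup>2 - z + 1)" for z :: complex
  define q where "q z = of_real b * z" for z :: complex
  let ?E = "(\<integral>x. (s * g x - (a * (lr G0 G1 x - 1) - b * (lr G0 G2 x - 1)))\<^sup>2 \<partial>P G0) - s\<^sup>2 * \<sigma>2"
  have "norm c \<le> sqrt (exp ?E)"
  proof (rule norm_limit_on_reals_le[where F = "\<lambda>n z. F n (A n) (p z) (q z)"])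
    show "(\<lambda>z. F n (A n) (p z) (q z)) holomorphic_on UNIV" for n
    proof (rule F_holomorphic[OF A])
      show "p holomorphic_on UNIV" unfolding p_def[abs_def] by (intro holomorphic_intros)
      show "q holomorphic_on UNIV" unfolding q_def[abs_def] by (intro holomorphic_intros)
    qed
  next
    fix S :: "complex set" assume "compact S"
    from compact_imp_bounded[OF this] obtain R where R: "\<And>z. z \<in> S \<Longrightarrow> norm z \<le> R"
      by (auto simp: bounded_iff)
    let ?Z = "max (a * (R\<^sup>2 + R + 1)) (b * R)"
    obtain B where B: "\<And>n \<zeta>1 \<zeta>2. cmod \<zeta>1 \<le> ?Z \<Longrightarrow> cmod \<zeta>2 \<le> ?Z \<Longrightarrow> Y \<zeta>1 \<zeta>2 n \<le> B"
      using Y_bounded[of ?Z] by blast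
    show "\<exists>B. \<forall>n. \<forall>z\<in>S. norm (F n (A n) (p z) (q z)) \<le> B"
    proof (intro exI allI ballI)
      fix n z assume "z \<in> S"
      then have z: "norm z \<le> R" by (rule R)
      have "norm (z\<^sup>2 - z + 1) \<le> norm z ^ 2 + norm z + 1"
        by (rule order_trans[OF norm_triangle_ineq]) (auto simp: norm_power[symmetric] intro: norm_triangle_ineq4)
      also have "\<dots> \<le> R\<^sup>2 + R + 1" using z by (intro add_mono power_mono) auto
      finally have "norm (p z) \<le> a * (R\<^sup>2 + R + 1)"
        unfolding p_def norm_mult using ab by (intro mult_mono) auto
      moreover have "norm (q z) \<le> b * R"
        unfolding q_def norm_mult using ab z by (intro mult_mono) auto
      ultimately have "Y (p z) (q z) n \<le> B" by (intro B) auto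
      then have "(cmod (F n (A n) (p z) (q z)))\<^sup>2 \<le> exp B"
        using norm_F_le[of "A n" n "p z" "q z", OF A(2)] by (meson exp_le_cancel_iff order_trans)
      then show "norm (F n (A n) (p z) (q z)) \<le> sqrt (exp B)" by (rule real_le_rsqrt)
    qed
  next
    fix t :: real assume "0 < t"
    define t1 where "t1 = a * (t\<^sup>2 - t + 1)"
    define t2 where "t2 = b * t"
    have "t\<^sup>2 - t + 1 = (t - 1/2)\<^sup>2 + 3/4" by (simp add: power2_eq_square algebra_simps)
    then have "0 < t\<^sup>2 - t + 1" by (simp add: add_nonneg_pos)
    then have t: "0 < t1" "0 < t2" using ab \<open>0 < t\<close> by (auto simp: t1_def t2_def)
    have pq: "p (of_real t) = of_real t1" "q (of_real t) = of_real t2"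
      by (auto simp: p_def q_def t1_def t2_def)
    have ev: "\<forall>\<^sub>F n in sequentially. t1 + t2 \<le> sqrt (real n)"
      by real_asymp
    show "(\<lambda>n. F n (A n) (p (of_real t)) (q (of_real t))) \<longlonglongrightarrow> c"
      using lim[OF t] unfolding pq
      by (rule Lim_transform_eventually) (use ev in eventually_elim, rule F_eq_sample[OF t _ A])
  next
    show "norm (F n (A n) (p \<i>) (q \<i>)) \<le> sqrt (exp (Y (- (\<i> * of_real a)) (\<i> * of_real b) n))" for n
      using norm_F_le[of "A n" n "p \<i>" "q \<i>", OF A(2)]
      by (intro real_le_rsqrt) (simp add: p_def q_def mult.commute)
    have "(cmod (\<i> * of_real (s * g x) + - (\<i> * of_real a) * of_real (lr G0 G1 x - 1) + \<i> * of_real b * of_real (lr G0 G2 x - 1)))\<^sup>2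
        = (s * g x - (a * (lr G0 G1 x - 1) - b * (lr G0 G2 x - 1)))\<^sup>2" for x
    proof -
      have "\<i> * of_real (s * g x) + - (\<i> * of_real a) * of_real (lr G0 G1 x - 1) + \<i> * of_real b * of_real (lr G0 G2 x - 1)
         = \<i> * of_real (s * g x - (a * (lr G0 G1 x - 1) - b * (lr G0 G2 x - 1)))"
        by (simp add: algebra_simps)
      then show ?thesis by (simp only: norm_mult norm_of_real norm_ii mult_1_left power2_abs)
    qed
    then have "(\<lambda>n. Y (- (\<i> * of_real a)) (\<i> * of_real b) n) \<longlonglongrightarrow> ?E"
      using Y_tendsto[of "- (\<i> * of_real a)" "\<i> * of_real b"] by simp
    then show "(\<lambda>n. sqrt (exp (Y (- (\<i> * of_real a)) (\<i> * of_real b) n))) \<longlonglongrightarrow> sqrt (exp ?E)"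
      by (intro tendsto_intros)
  qed
  then have "(cmod c)\<^sup>2 \<le> (sqrt (exp ?E))\<^sup>2" by (intro power_mono) auto
  then show ?thesis by simp
qed

end

section \<open>Scores and minimality\<close>

locale local_model = mixture_model \<nu> T f
  for \<nu> :: "'x measure" and T :: "'t measure" and f :: "'x \<Rightarrow> 't \<Rightarrow> real" +
  fixes u :: "'x \<Rightarrow> 't \<Rightarrow> real" and \<G> :: "'t measure set" and G0 :: "'t measure" and v0 :: "'x \<Rightarrow> real"
  assumes u_measurable [measurable]: "case_prod u \<in> borel_measurable (\<nu> \<Otimes>\<^sub>M T)"
    and dist_\<G>: "\<And>G. G \<in> \<G> \<Longrightarrow> distribution_on T G"
    and convex: "convex_class \<G>"
    and u_sq: "\<And>G. G \<in> \<G> \<Longrightarrow> integrable (J G) (\<lambda>(x, \<theta>). (u x \<theta>)\<^sup>2)"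
    and G0: "G0 \<in> \<G>"
    and v0_min: "is_arg_min (mean_square_error \<nu> f u G0) (\<lambda>v. v \<in> local_unbiased_functions \<nu> f u \<G> G0) v0"
    and v0_sq: "integrable (J G0) (\<lambda>(x, \<theta>). (v0 x)\<^sup>2)"
begin

abbreviation LC :: "'t measure set" where
  "LC \<equiv> local_class \<nu> f \<G> G0"

definition w :: "'x \<times> 't \<Rightarrow> real" where
  "w z = v0 (fst z) - u (fst z) (snd z)"

lemma dist0: "distribution_on T G0" by (rule dist_\<G>[OF G0])

sublocale J0: prob_space "J G0" by (rule prob_space_joint[OF dist0])
sublocale P0: prob_space "P G0" by (rule prob_space_P[OF dist0])

section \<open>The local class and its likelihood ratios\<close>

lemma nn_integral_mixture_density:
  assumes G: "distribution_on T G"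
  shows "(\<integral>\<^sup>+x. mixture_density f G x \<partial>\<nu>) = 1"
proof -
  interpret prob_space "P G" by (rule prob_space_P[OF G])
  have "(\<integral>\<^sup>+x. mixture_density f G x \<partial>\<nu>) = (\<integral>\<^sup>+x. 1 \<partial>P G)"
    unfolding P_def using mixture_density_measurable[OF G] by (subst nn_integral_density) auto
  then show ?thesis using emeasure_space_1 by simp
qed

lemma local_class_eq:
  "LC = {G \<in> \<G>. (\<integral>\<^sup>+x. (mixture_density f G x / mixture_density f G0 x)\<^sup>2 \<partial>P G0) < \<infinity> \<and>
     (\<integral>\<^sup>+x. mixture_density f G x * indicator {x. 0 < mixture_density f G0 x} x \<partial>\<nu>) = 1}"
proof -
  have "(\<integral>\<^sup>+(x, \<theta>). (mixture_density f G x / mixture_density f G0 x)\<^sup>2 \<partial>J G0) =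
      (\<integral>\<^sup>+x. (mixture_density f G x / mixture_density f G0 x)\<^sup>2 \<partial>P G0)" if "G \<in> \<G>" for G
  proof -
    note [measurable] = mixture_density_measurable[OF dist0] mixture_density_measurable[OF dist_\<G>[OF that]]
    show ?thesis
      using nn_integral_joint_fst[OF dist0, of "\<lambda>x. (mixture_density f G x / mixture_density f G0 x)\<^sup>2"]
      by (simp add: split_beta')
  qed
  then show ?thesis unfolding local_class_def by auto
qed

lemma LC_\<G>: "G \<in> LC \<Longrightarrow> G \<in> \<G>" by (simp add: local_class_def)

lemma LC_dist: "G \<in> LC \<Longrightarrow> distribution_on T G" using LC_\<G> dist_\<G> by blast

text \<open>Total mass 1 is already attained where the density of \<open>G0\<close> is positive, so
  no mass is left on its zeros.\<close>

lemma LC_dominated: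
  assumes G: "G \<in> LC"
  shows "dominated G0 G"
proof -
  let ?f0 = "mixture_density f G0" and ?h = "mixture_density f G"
  note [measurable] = mixture_density_measurable[OF dist0] mixture_density_measurable[OF LC_dist[OF G]]
  have "(\<integral>\<^sup>+x. ?h x \<partial>\<nu>) = (\<integral>\<^sup>+x. ?h x * indicator {x. 0 < ?f0 x} x + ?h x * indicator {x. ?f0 x = 0} x \<partial>\<nu>)"
    by (intro nn_integral_cong) (auto simp: indicator_def zero_less_iff_neq_zero)
  also have "\<dots> = 1 + (\<integral>\<^sup>+x. ?h x * indicator {x. ?f0 x = 0} x \<partial>\<nu>)"
  proof -
    have one: "(\<integral>\<^sup>+x. ?h x * indicator {x. 0 < ?f0 x} x \<partial>\<nu>) = 1" using G by (simp add: local_class_eq)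
    show ?thesis unfolding one[symmetric] by (rule nn_integral_add) measurable
  qed
  finally have "1 + 0 = 1 + (\<integral>\<^sup>+x. ?h x * indicator {x. ?f0 x = 0} x \<partial>\<nu>)"
    unfolding nn_integral_mixture_density[OF LC_dist[OF G]] by simp
  then have "(\<integral>\<^sup>+x. ?h x * indicator {x. ?f0 x = 0} x \<partial>\<nu>) = 0"
    unfolding ennreal_add_left_cancel by simp
  then have "AE x in \<nu>. ?h x * indicator {x. ?f0 x = 0} x = 0"
    by (subst (asm) nn_integral_0_iff_AE) auto
  then have "AE x in \<nu>. ?f0 x = 0 \<longrightarrow> ?h x = 0"
    by eventually_elim auto
  then show ?thesis using dist0 LC_dist[OF G] by (simp add: dominated_def)
qed

lemma AE_lr:
  assumes G: "distribution_on T G"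
  shows "AE x in P G0. mixture_density f G x / mixture_density f G0 x = ennreal (lr G0 G x)"
proof (rule AE_P[OF dist0])
  show "AE x in \<nu>. 0 < dens G0 x \<longrightarrow> mixture_density f G x / mixture_density f G0 x = ennreal (lr G0 G x)"
    using AE_dens[OF dist0] AE_dens[OF G]
  proof eventually_elim
    case (elim x)
    have "0 \<le> dens G x" by (simp add: dens_def)
    then show ?case unfolding elim by (simp add: divide_ennreal)
  qed
qed

lemma lr_nonneg: "0 \<le> lr G0 G x" by (simp add: dens_def)

lemma lr_measurable: "distribution_on T G \<Longrightarrow> lr G0 G \<in> borel_measurable \<nu>"
  using dens_measurable[OF dist0] dens_measurable[of G] by measurable

lemma nn_integral_lr_sq:
  assumes G: "distribution_on T G"
  shows "(\<integral>\<^sup>+x. (mixture_density f G x / mixture_density f G0 x)\<^sup>2 \<partial>P G0) = (\<integral>\<^sup>+x. ennreal ((lr G0 G x)\<^sup>2) \<partial>P G0)"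
  by (intro nn_integral_cong_AE, use AE_lr[OF G] in eventually_elim) (simp only: ennreal_power lr_nonneg)

lemma LC_lr_sq:
  assumes G: "G \<in> LC"
  shows "integrable (P G0) (\<lambda>x. (lr G0 G x)\<^sup>2)"
proof -
  note [measurable] = lr_measurable[OF LC_dist[OF G]]
  show ?thesis
    using G nn_integral_lr_sq[OF LC_dist[OF G]] by (simp add: integrable_iff_bounded local_class_eq)
qed

lemma lr_G0: "AE x in P G0. lr G0 G0 x = 1"
  by (rule AE_P[OF dist0]) auto

lemma G0_LC: "G0 \<in> LC"
proof -
  have "(\<integral>\<^sup>+x. (mixture_density f G0 x / mixture_density f G0 x)\<^sup>2 \<partial>P G0) = (\<integral>\<^sup>+x. 1 \<partial>P G0)"
    unfolding nn_integral_lr_sq[OF dist0]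
    by (intro nn_integral_cong_AE, use lr_G0 in eventually_elim) (simp only: power_one ennreal_1)
  moreover have "(\<integral>\<^sup>+x. mixture_density f G0 x * indicator {x. 0 < mixture_density f G0 x} x \<partial>\<nu>) = (\<integral>\<^sup>+x. mixture_density f G0 x \<partial>\<nu>)"
    by (intro nn_integral_cong) (auto simp: indicator_def zero_less_iff_neq_zero)
  ultimately show ?thesis
    using G0 nn_integral_mixture_density[OF dist0] P0.emeasure_space_1 by (simp add: local_class_eq)
qed

text \<open>Used twice: an alternative in two directions is again an admissible alternative for
  regularity, and positive combinations of scores are multiples of a single score.\<close>

lemma mix_LC:
  assumes G: "G1 \<in> LC" "G2 \<in> LC" and t: "t \<in> {0..1}"
  shows "mix t G1 G2 \<in> LC"
proof -
  let ?f0 = "mixture_density f G0" and ?f1 = "mixture_density f G1" and ?f2 = "mixture_density f G2"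
  let ?fm = "mixture_density f (mix t G1 G2)"
  note d = LC_dist[OF G(1)] LC_dist[OF G(2)]
  note [measurable] = mixture_density_measurable[OF dist0] mixture_density_measurable[OF d(1)] mixture_density_measurable[OF d(2)]
  have m: "mix t G1 G2 \<in> \<G>"
    using convex LC_\<G>[OF G(1)] LC_\<G>[OF G(2)] t unfolding convex_class_def by blast
  have fm: "?fm x = ennreal (1 - t) * ?f1 x + ennreal t * ?f2 x" if "x \<in> space \<nu>" for x
    by (rule mixture_density_mix[OF d that])
  have one: "ennreal (1 - t) + ennreal t = 1"
    using t by (simp flip: ennreal_plus)
  have "(\<integral>\<^sup>+x. (?fm x / ?f0 x)\<^sup>2 \<partial>P G0) \<le> (\<integral>\<^sup>+x. (?f1 x / ?f0 x)\<^sup>2 + (?f2 x / ?f0 x)\<^sup>2 \<partial>P G0)"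
  proof (rule nn_integral_mono)
    fix x assume "x \<in> space (P G0)"
    then have x: "x \<in> space \<nu>" by simp
    \<comment> \<open>A convex combination is at most the maximum, whose square is one of the two
      squares; this avoids expanding a square of extended reals.\<close>
    let ?M = "max (?f1 x) (?f2 x)"
    have "?fm x \<le> ennreal (1 - t) * ?M + ennreal t * ?M"
      unfolding fm[OF x] by (intro add_mono mult_left_mono) auto
    also have "\<dots> = ?M" by (simp only: distrib_right[symmetric] one mult_1_left)
    finally have le: "(?fm x / ?f0 x)\<^sup>2 \<le> (?M / ?f0 x)\<^sup>2"
      by (intro power_mono divide_right_mono_ennreal) auto
    show "(?fm x / ?f0 x)\<^sup>2 \<le> (?f1 x / ?f0 x)\<^sup>2 + (?f2 x / ?f0 x)\<^sup>2"
    proof (cases "?f1 x \<le> ?f2 x")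
      case True
      then have M: "?M = ?f2 x" by (simp add: max_def)
      show ?thesis using le unfolding M by (rule order_trans) simp
    next
      case False
      then have M: "?M = ?f1 x" by (simp add: max_def)
      show ?thesis using le unfolding M by (rule order_trans) simp
    qed
  qed
  also have "\<dots> < \<infinity>"
    using G by (subst nn_integral_add) (auto simp: local_class_eq)
  finally have 1: "(\<integral>\<^sup>+x. (?fm x / ?f0 x)\<^sup>2 \<partial>P G0) < \<infinity>" .
  have "(\<integral>\<^sup>+x. ?fm x * indicator {x. 0 < ?f0 x} x \<partial>\<nu>) =
      (\<integral>\<^sup>+x. ennreal (1 - t) * (?f1 x * indicator {x. 0 < ?f0 x} x) + ennreal t * (?f2 x * indicator {x. 0 < ?f0 x} x) \<partial>\<nu>)"
    by (intro nn_integral_cong) (simp add: fm distrib_right mult.assoc)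
  also have "\<dots> = ennreal (1 - t) * (\<integral>\<^sup>+x. ?f1 x * indicator {x. 0 < ?f0 x} x \<partial>\<nu>) + ennreal t * (\<integral>\<^sup>+x. ?f2 x * indicator {x. 0 < ?f0 x} x \<partial>\<nu>)"
    by (subst nn_integral_add) (simp_all add: nn_integral_cmult)
  also have "\<dots> = 1" using G one by (simp add: local_class_eq)
  finally show ?thesis using 1 m by (simp add: local_class_eq)
qed

lemma lr_mix:
  assumes G: "distribution_on T G1" "distribution_on T G2" and t: "t \<in> {0..1}"
  shows "AE x in P G0. lr G0 (mix t G1 G2) x = (1 - t) * lr G0 G1 x + t * lr G0 G2 x"
proof (rule AE_P'[OF dist0])
  show "AE x in \<nu>. lr G0 (mix t G1 G2) x = (1 - t) * lr G0 G1 x + t * lr G0 G2 x"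
    using AE_dens[OF G(1)] AE_dens[OF G(2)] AE_space
  proof eventually_elim
    case (elim x)
    have d: "0 \<le> dens G1 x" "0 \<le> dens G2 x" by (simp_all add: dens_def)
    have "mixture_density f (mix t G1 G2) x = ennreal ((1 - t) * dens G1 x + t * dens G2 x)"
      unfolding mixture_density_mix[OF G elim(3), of t] elim(1,2) using t d
      by (simp add: ennreal_mult[symmetric] ennreal_plus[symmetric] del: ennreal_plus)
    then have "dens (mix t G1 G2) x = (1 - t) * dens G1 x + t * dens G2 x"
      using t d unfolding dens_def[of "mix t G1 G2"] by (simp del: ennreal_plus)
    then show ?case by (simp add: add_divide_distrib)
  qed
qed

text \<open>Square integrability of the likelihood ratio makes every function in L2 of
  \<open>P G0\<close> integrable under \<open>G\<close>, so that expectations under \<open>G\<close>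
  become inner products with \<open>lr G0 G\<close>.\<close>

lemma integral_fst_eq:
  fixes h :: "'x \<Rightarrow> real"
  assumes G: "dominated G0 G" "integrable (P G0) (\<lambda>x. (lr G0 G x)\<^sup>2)"
    and h [measurable]: "h \<in> borel_measurable \<nu>" and hi: "integrable (P G0) (\<lambda>x. (h x)\<^sup>2)"
  shows "integrable (J G) (\<lambda>z. h (fst z))" "(\<integral>z. h (fst z) \<partial>J G) = (\<integral>x. h x * lr G0 G x \<partial>P G0)"
proof -
  have d: "distribution_on T G" using G(1) by (simp add: dominated_def)
  note [measurable] = lr_measurable[OF d] dens_measurable[OF d] dens_measurable[OF dist0]
  have d0: "0 \<le> dens H x" for H x by (simp add: dens_def)
  have hl: "integrable (P G0) (\<lambda>x. h x * lr G0 G x)"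
    by (rule L2_product_integrable) (use hi G(2) in auto)
  have "AE x in \<nu>. mixture_density f G0 x = 0 \<longrightarrow> mixture_density f G x = 0"
    using G(1) by (simp add: dominated_def)
  then have AE: "AE x in \<nu>. dens G x = dens G0 x * lr G0 G x"
    using AE_dens[OF dist0]
  proof eventually_elim
    case (elim x)
    show ?case
    proof (cases "dens G0 x = 0")
      case True
      with elim have "mixture_density f G x = 0" by simp
      then have "dens G x = 0" by (simp add: dens_def)
      with True show ?thesis by simp
    qed simp
  qed
  have "integrable \<nu> (\<lambda>x. dens G0 x *\<^sub>R (h x * lr G0 G x))"
    using hl unfolding P_eq[OF dist0] by (subst (asm) integrable_density) (auto simp: d0)
  then have "integrable \<nu> (\<lambda>x. dens G x *\<^sub>R h x)"
  proof (rule integrable_cong_AE_imp)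
    show "AE x in \<nu>. dens G0 x *\<^sub>R (h x * lr G0 G x) = dens G x *\<^sub>R h x"
      using AE by eventually_elim (auto split: if_splits)
  qed measurable
  then have "integrable (P G) h"
    unfolding P_eq[OF d] by (subst integrable_density) (auto simp: d0)
  then show i: "integrable (J G) (\<lambda>z. h (fst z))"
    unfolding integrable_joint_fst[OF d h] .
  have eq: "cmean G0 G (\<lambda>z. h (fst z)) = (\<lambda>x. h x * cmean G0 G (\<lambda>z. 1) x)"
    by (rule ext) (use cmean_mult[of G0 G h "\<lambda>_. 1"] in simp)
  have "(\<integral>z. h (fst z) \<partial>J G) = (\<integral>x. h x * cmean G0 G (\<lambda>z. 1) x \<partial>P G0)"
    using integral_cmean[OF G(1) i] unfolding eq by simp
  also have "\<dots> = (\<integral>x. h x * lr G0 G x \<partial>P G0)"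
  proof (rule integral_cong_AE)
    show "(\<lambda>x. h x * cmean G0 G (\<lambda>z. 1) x) \<in> borel_measurable (P G0)"
      using cmean_measurable[OF dist0 d, of "\<lambda>_. 1 :: real"] by simp
    show "AE x in P G0. h x * cmean G0 G (\<lambda>z. 1) x = h x * lr G0 G x"
      using AE_P'[OF dist0 cmean_const[OF d, of G0 "1 :: real"]] by eventually_elim simp
  qed simp
  finally show "(\<integral>z. h (fst z) \<partial>J G) = (\<integral>x. h x * lr G0 G x \<partial>P G0)" .
qed

section \<open>The error of the minimiser and its projection\<close>

lemma v0_local: "v0 \<in> local_unbiased_functions \<nu> f u \<G> G0"
  using v0_min by (simp add: is_arg_min_def)

lemma v0_measurable [measurable]: "v0 \<in> borel_measurable \<nu>"
  using v0_local by (simp add: local_unbiased_functions_def)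

lemma w_measurable [measurable]: "w \<in> borel_measurable (\<nu> \<Otimes>\<^sub>M T)"
proof -
  have "(\<lambda>z. v0 (fst z) - case_prod u z) \<in> borel_measurable (\<nu> \<Otimes>\<^sub>M T)" by measurable
  then show ?thesis by (simp add: w_def[abs_def] split_beta')
qed

lemma u_integrable:
  assumes G: "G \<in> \<G>"
  shows "integrable (J G) (case_prod u)"
proof -
  interpret J: prob_space "J G" by (rule prob_space_joint[OF dist_\<G>[OF G]])
  have "case_prod u \<in> borel_measurable (J G)"
    unfolding borel_measurable_pair_iff(2)[OF dist_\<G>[OF G]] by (rule u_measurable)
  moreover have "integrable (J G) (\<lambda>z. (case_prod u z)\<^sup>2)"
    using u_sq[OF G] by (simp add: split_beta')
  ultimately show ?thesis by (rule J.square_integrable_imp_integrable)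
qed

lemma
  assumes G: "G \<in> LC"
  shows w_integrable: "integrable (J G) w" and integral_w: "integral\<^sup>L (J G) w = 0"
proof -
  have unb: "unbiased \<nu> f u G v0" using v0_local G by (simp add: local_unbiased_functions_def)
  have v: "integrable (J G) (\<lambda>z. v0 (fst z))" "(\<integral>z. v0 (fst z) \<partial>J G) = integral\<^sup>L (J G) (case_prod u)"
    using unb by (simp_all add: unbiased_def split_beta')
  have weq: "w = (\<lambda>z. v0 (fst z) - case_prod u z)" by (simp add: w_def fun_eq_iff split_beta)
  show "integrable (J G) w" "integral\<^sup>L (J G) w = 0"
    unfolding weq using v u_integrable[OF LC_\<G>[OF G]] by simp_all
qed

lemma w_sq: "integrable (J G0) (\<lambda>z. (w z)\<^sup>2)"
proof -
  have m: "(\<lambda>z. v0 (fst z)) \<in> borel_measurable (J G0)" "case_prod u \<in> borel_measurable (J G0)"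
    unfolding borel_measurable_pair_iff(2)[OF dist0] by measurable
  have "integrable (J G0) (\<lambda>z. (1 * v0 (fst z) + (- 1) * case_prod u z)\<^sup>2)"
    using v0_sq u_sq[OF G0] by (intro L2_combination_integrable m) (simp_all add: split_beta')
  then show ?thesis by (simp add: w_def split_beta')
qed

abbreviation g :: "'x \<Rightarrow> real" where "g \<equiv> cmean G0 G0 w"
abbreviation \<sigma>2 :: real where "\<sigma>2 \<equiv> (\<integral>z. (w z)\<^sup>2 \<partial>J G0)"

lemma g_measurable [measurable]: "g \<in> borel_measurable \<nu>"
  by (rule cmean_measurable[OF dist0 dist0 w_measurable])

lemma g_sq: "integrable (P G0) (\<lambda>x. (g x)\<^sup>2)"
  by (rule cmean_square_integrable[OF dist0 w_measurable w_sq])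

lemma integral_g: "(\<integral>x. g x \<partial>P G0) = 0"
  using integral_cmean[OF LC_dominated[OF G0_LC] w_integrable[OF G0_LC]] integral_w[OF G0_LC] by simp

lemma integral_lr: "G \<in> LC \<Longrightarrow> (\<integral>x. lr G0 G x \<partial>P G0) = 1"
proof -
  assume G: "G \<in> LC"
  interpret J: prob_space "J G" by (rule prob_space_joint[OF LC_dist[OF G]])
  show ?thesis
    using integral_fst_eq(2)[OF LC_dominated[OF G] LC_lr_sq[OF G], of "\<lambda>_. 1"] by (simp add: J.prob_space)
qed

text \<open>Minimality of the mean square error of \<open>v0\<close> in the direction \<open>h\<close>.\<close>

lemma g_orthogonal:
  assumes h [measurable]: "h \<in> borel_measurable \<nu>" and hi: "integrable (P G0) (\<lambda>x. (h x)\<^sup>2)"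
    and h0: "\<And>G. G \<in> LC \<Longrightarrow> (\<integral>x. h x * lr G0 G x \<partial>P G0) = 0"
  shows "(\<integral>x. h x * g x \<partial>P G0) = 0"
proof -
  have hJ: "integrable (J G0) (\<lambda>z. (h (fst z))\<^sup>2)"
    using hi integrable_joint_fst[OF dist0, of "\<lambda>x. (h x)\<^sup>2"] by simp
  have m: "(\<lambda>z. h (fst z)) \<in> borel_measurable (J G0)" "w \<in> borel_measurable (J G0)"
    unfolding borel_measurable_pair_iff(2)[OF dist0] by measurable
  have wh: "integrable (J G0) (\<lambda>z. h (fst z) * w z)"
    by (rule L2_product_integrable[OF m hJ w_sq])
  let ?c = "\<integral>z. h (fst z) * w z \<partial>J G0" and ?d = "\<integral>z. (h (fst z))\<^sup>2 \<partial>J G0"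
  have le: "0 \<le> 2 * t * ?c + t\<^sup>2 * ?d" for t
  proof -
    \<comment> \<open>\<open>h\<close> has mean 0 under every member of the local class, so this
      perturbation of \<open>v0\<close> stays among the admissible competitors.\<close>
    let ?v = "\<lambda>x. v0 x + t * h x"
    have "?v \<in> local_unbiased_functions \<nu> f u \<G> G0"
      unfolding local_unbiased_functions_def
    proof (intro CollectI conjI ballI)
      fix G assume G: "G \<in> LC"
      note hG = integral_fst_eq[OF LC_dominated[OF G] LC_lr_sq[OF G] h hi, unfolded h0[OF G]]
      have "unbiased \<nu> f u G v0" using v0_local G by (simp add: local_unbiased_functions_def)
      then show "unbiased \<nu> f u G ?v"
        using hG by (simp add: unbiased_def split_beta')
    qed measurable
    then have mse: "mean_square_error \<nu> f u G0 v0 \<le> mean_square_error \<nu> f u G0 ?v"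
      using v0_min by (auto simp: is_arg_min_def not_less)
    have eq: "(?v (fst z) - u (fst z) (snd z))\<^sup>2 = (w z)\<^sup>2 + 2 * t * (h (fst z) * w z) + t\<^sup>2 * (h (fst z))\<^sup>2" for z
      by (simp add: w_def power2_eq_square algebra_simps)
    have i: "integrable (J G0) (\<lambda>z. (w z)\<^sup>2 + 2 * t * (h (fst z) * w z) + t\<^sup>2 * (h (fst z))\<^sup>2)"
      using w_sq wh hJ by auto
    have "mean_square_error \<nu> f u G0 v0 = ennreal \<sigma>2"
      unfolding mean_square_error_def using w_sq by (simp add: split_beta' nn_integral_eq_integral flip: w_def)
    moreover have "mean_square_error \<nu> f u G0 ?v = ennreal (\<integral>z. (?v (fst z) - u (fst z) (snd z))\<^sup>2 \<partial>J G0)"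
      unfolding mean_square_error_def split_beta' using i unfolding eq[symmetric]
      by (intro nn_integral_eq_integral) auto
    ultimately have "\<sigma>2 \<le> (\<integral>z. (?v (fst z) - u (fst z) (snd z))\<^sup>2 \<partial>J G0)"
      using mse by (simp add: ennreal_le_iff)
    also have "\<dots> = \<sigma>2 + 2 * t * ?c + t\<^sup>2 * ?d"
      unfolding eq using w_sq wh hJ by simp
    finally show ?thesis by simp
  qed
  have "?c = 0"
  proof -
    have d0: "0 \<le> ?d" by auto
    \<comment> \<open>At \<open>t = - e\<close> the quadratic equals
      \<open>- (e\<^sup>2 * (2 + ?d))\<close>, which is nonnegative only for \<open>e = 0\<close>;
      the added 1 avoids a division by zero.\<close>
    define e where "e = ?c / (1 + ?d)"
    have c: "?c = e * (1 + ?d)" using d0 by (simp add: e_def add_nonneg_eq_0_iff)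
    have "0 \<le> 2 * (- e) * (e * (1 + ?d)) + (- e)\<^sup>2 * ?d"
      using le[of "- e"] unfolding c[symmetric] .
    also have "\<dots> = - (e\<^sup>2 * (2 + ?d))"
      by (simp add: power2_eq_square algebra_simps)
    finally have "e\<^sup>2 * (2 + ?d) \<le> 0" by simp
    then have "e = 0" using d0 by (simp add: mult_le_0_iff)
    then show ?thesis unfolding c by simp
  qed
  moreover have "cmean G0 G0 (\<lambda>z. h (fst z) * w z) = (\<lambda>x. h x * g x)"
    by (rule ext) (rule cmean_mult)
  ultimately show ?thesis
    using integral_cmean[OF LC_dominated[OF G0_LC] wh] by simp
qed

text \<open>The linear span of the constants and the likelihood ratios, in a normal form with two
  members of the class. Constants are included because \<open>g_orthogonal\<close> tests against the
  ratios and not against the scores. Strictly positive coefficients are no restriction: the score of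
  \<open>G0\<close> vanishes almost everywhere and can fill an empty place.\<close>

definition tangent :: "('x \<Rightarrow> real) set" where
  "tangent = {d \<in> borel_measurable \<nu>. \<exists>c a b. \<exists>G1\<in>LC. \<exists>G2\<in>LC. 0 < a \<and> 0 < b \<and>
     (AE x in P G0. d x = c + (a * (lr G0 G1 x - 1) - b * (lr G0 G2 x - 1)))}"

lemma tangentI:
  assumes "d \<in> borel_measurable \<nu>" "G1 \<in> LC" "G2 \<in> LC" "0 < a" "0 < b"
    "AE x in P G0. d x = c + (a * (lr G0 G1 x - 1) - b * (lr G0 G2 x - 1))"
  shows "d \<in> tangent"
  using assms unfolding tangent_def by blast

lemma tangentE:
  assumes "d \<in> tangent"
  obtains c a b G1 G2 where "d \<in> borel_measurable \<nu>" "G1 \<in> LC" "G2 \<in> LC" "0 < a" "0 < b"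
    "AE x in P G0. d x = c + (a * (lr G0 G1 x - 1) - b * (lr G0 G2 x - 1))"
  using assms unfolding tangent_def by blast

lemma lr_combination_sq:
  assumes G: "G1 \<in> LC" "G2 \<in> LC"
  shows "integrable (P G0) (\<lambda>x. (c + (a * (lr G0 G1 x - 1) - b * (lr G0 G2 x - 1)))\<^sup>2)"
proof -
  note [measurable] = dens_measurable[OF LC_dist[OF G(1)]] dens_measurable[OF LC_dist[OF G(2)]] dens_measurable[OF dist0]
  have 1: "integrable (P G0) (\<lambda>x. (a * lr G0 G1 x + (- b) * lr G0 G2 x)\<^sup>2)"
    by (intro L2_combination_integrable LC_lr_sq G) auto
  have "integrable (P G0) (\<lambda>x. (1 * (a * lr G0 G1 x + (- b) * lr G0 G2 x) + (c - a + b) * 1)\<^sup>2)"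
    by (rule L2_combination_integrable[OF _ _ 1]) auto
  then show ?thesis by (simp add: algebra_simps)
qed

lemma tangent_sq:
  assumes "d \<in> tangent"
  shows "integrable (P G0) (\<lambda>x. (d x)\<^sup>2)"
proof -
  from assms obtain c a b G1 G2 where d: "d \<in> borel_measurable \<nu>" "G1 \<in> LC" "G2 \<in> LC"
    "AE x in P G0. d x = c + (a * (lr G0 G1 x - 1) - b * (lr G0 G2 x - 1))"
    by (rule tangentE)
  note [measurable] = d(1)
  show ?thesis
  proof (rule integrable_cong_AE_imp[OF lr_combination_sq[OF d(2,3), of c a b]])
    show "AE x in P G0. (c + (a * (lr G0 G1 x - 1) - b * (lr G0 G2 x - 1)))\<^sup>2 = (d x)\<^sup>2"
      using d(4) by eventually_elim simp
  qed simp
qed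

lemma tangent_scale:
  assumes "d \<in> tangent"
  shows "(\<lambda>x. s * d x) \<in> tangent"
proof -
  from assms obtain c a b G1 G2 where d: "d \<in> borel_measurable \<nu>" "G1 \<in> LC" "G2 \<in> LC" "0 < a" "0 < b"
    "AE x in P G0. d x = c + (a * (lr G0 G1 x - 1) - b * (lr G0 G2 x - 1))"
    by (rule tangentE)
  note [measurable] = d(1)
  consider "0 < s" | "s = 0" | "s < 0" by linarith
  then show ?thesis
  proof cases
    case 1
    show ?thesis
    proof (rule tangentI[OF _ d(2,3), where a = "s * a" and b = "s * b" and c = "s * c"])
      show "AE x in P G0. s * d x = s * c + (s * a * (lr G0 G1 x - 1) - s * b * (lr G0 G2 x - 1))"
        using d(6) by eventually_elim (simp only: distrib_left right_diff_distrib mult.assoc)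
    qed (use 1 d(4,5) in auto)
  next
    case 2
    show ?thesis
      by (rule tangentI[OF _ G0_LC G0_LC, where a = 1 and b = 1 and c = 0]) (use 2 in auto)
  next
    \<comment> \<open>A negative factor exchanges the two directions, so that both coefficients
      remain positive.\<close>
    case 3
    show ?thesis
    proof (rule tangentI[OF _ d(3,2), where a = "- s * b" and b = "- s * a" and c = "s * c"])
      show "AE x in P G0. s * d x = s * c + (- s * b * (lr G0 G2 x - 1) - - s * a * (lr G0 G1 x - 1))"
        using d(6)
      proof eventually_elim
        case (elim x)
        show ?case unfolding elim by (simp only: algebra_simps)
      qed
    qed (use 3 d(4,5) in \<open>auto simp: mult_neg_pos\<close>)
  qed
qed

text \<open>The scores generate a convex cone: a positive combination of two scores is a multiple of
  the score of a mixture with proportional weights.\<close>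

lemma lr_mix_combination:
  assumes "G1 \<in> LC" "G2 \<in> LC" "0 < a1" "0 < a2"
  shows "mix (a2 / (a1 + a2)) G1 G2 \<in> LC"
    and "AE x in P G0. (a1 + a2) * (lr G0 (mix (a2 / (a1 + a2)) G1 G2) x - 1) = a1 * (lr G0 G1 x - 1) + a2 * (lr G0 G2 x - 1)"
proof -
  have t: "a2 / (a1 + a2) \<in> {0..1}" using assms by (auto simp: divide_le_eq)
  show "mix (a2 / (a1 + a2)) G1 G2 \<in> LC" by (rule mix_LC[OF assms(1,2) t])
  have c: "(a1 + a2) * (1 - a2 / (a1 + a2)) = a1" "(a1 + a2) * (a2 / (a1 + a2)) = a2"
    using assms by (simp_all add: right_diff_distrib)
  show "AE x in P G0. (a1 + a2) * (lr G0 (mix (a2 / (a1 + a2)) G1 G2) x - 1) = a1 * (lr G0 G1 x - 1) + a2 * (lr G0 G2 x - 1)"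
    using lr_mix[OF LC_dist[OF assms(1)] LC_dist[OF assms(2)] t]
  proof eventually_elim
    case (elim x)
    have "p * ((1 - t) * A + t * B - 1) = (p * (1 - t)) * A + (p * t) * B - p" for p t A B :: real
      by (simp add: algebra_simps)
    from this[of "a1 + a2" "a2 / (a1 + a2)" "lr G0 G1 x" "lr G0 G2 x"]
    show ?case unfolding elim c by (simp add: right_diff_distrib)
  qed
qed

lemma tangent_add:
  assumes "d \<in> tangent" "d' \<in> tangent"
  shows "(\<lambda>x. d x + d' x) \<in> tangent"
proof -
  from assms(1) obtain c a b G1 G2 where d: "d \<in> borel_measurable \<nu>" "G1 \<in> LC" "G2 \<in> LC" "0 < a" "0 < b"
    "AE x in P G0. d x = c + (a * (lr G0 G1 x - 1) - b * (lr G0 G2 x - 1))"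
    by (rule tangentE)
  from assms(2) obtain c' a' b' G1' G2' where d': "d' \<in> borel_measurable \<nu>" "G1' \<in> LC" "G2' \<in> LC" "0 < a'" "0 < b'"
    "AE x in P G0. d' x = c' + (a' * (lr G0 G1' x - 1) - b' * (lr G0 G2' x - 1))"
    by (rule tangentE)
  note m1 = lr_mix_combination[OF d(2) d'(2) d(4) d'(4)]
  note m2 = lr_mix_combination[OF d(3) d'(3) d(5) d'(5)]
  show ?thesis
  proof (rule tangentI[OF _ m1(1) m2(1), where a = "a + a'" and b = "b + b'" and c = "c + c'"])
    show "AE x in P G0. d x + d' x = c + c' + ((a + a') * (lr G0 (mix (a' / (a + a')) G1 G1') x - 1)
        - (b + b') * (lr G0 (mix (b' / (b + b')) G2 G2') x - 1))"
      using m1(2) m2(2) d(6) d'(6) by eventually_elim linarith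
  qed (use d d' in auto)
qed

lemma tangent_const: "(\<lambda>_. c) \<in> tangent"
  by (rule tangentI[OF _ G0_LC G0_LC, where a = 1 and b = 1 and c = c]) auto

lemma tangent_lr:
  assumes G: "G \<in> LC"
  shows "lr G0 G \<in> tangent"
proof (rule tangentI[OF lr_measurable[OF LC_dist[OF G]] G G0_LC, of 1 1 1])
  show "AE x in P G0. lr G0 G x = 1 + (1 * (lr G0 G x - 1) - 1 * (lr G0 G0 x - 1))"
    using lr_G0
  proof eventually_elim
    case (elim x)
    show ?case unfolding elim by simp
  qed
qed auto

lemma tangent_dense:
  assumes "0 < \<epsilon>"
  obtains a b G1 G2 where "G1 \<in> LC" "G2 \<in> LC" "0 < a" "0 < b"
    "(\<integral>x. (g x - (a * (lr G0 G1 x - 1) - b * (lr G0 G2 x - 1)))\<^sup>2 \<partial>P G0) < \<epsilon>"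
proof -
  have "\<exists>d\<in>tangent. (\<integral>x. (g x - d x)\<^sup>2 \<partial>P G0) < \<epsilon>"
  proof (rule L2_dense_criterion)
    show "tangent \<noteq> {}" using tangent_const by blast
    show "d \<in> tangent \<Longrightarrow> d \<in> borel_measurable (P G0)" for d by (simp add: tangent_def)
    show "(\<lambda>x. s * d x + t * e x) \<in> tangent" if "d \<in> tangent" "e \<in> tangent" for d e s t
      by (intro tangent_add tangent_scale that)
    show "(\<integral>x. h x * g x \<partial>P G0) = 0" if "h \<in> borel_measurable (P G0)" "integrable (P G0) (\<lambda>x. (h x)\<^sup>2)"
      "\<And>d. d \<in> tangent \<Longrightarrow> (\<integral>x. h x * d x \<partial>P G0) = 0" for h
    proof (rule g_orthogonal)
      show "(\<integral>x. h x * lr G0 G x \<partial>P G0) = 0" if "G \<in> LC" for G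
        by (rule \<open>\<And>d. d \<in> tangent \<Longrightarrow> (\<integral>x. h x * d x \<partial>P G0) = 0\<close>[OF tangent_lr[OF that]])
    qed (use that in simp_all)
  qed (use g_sq tangent_sq assms in auto)
  then obtain d where "d \<in> tangent" and d_le: "(\<integral>x. (g x - d x)\<^sup>2 \<partial>P G0) < \<epsilon>" by blast
  from this(1) obtain c a b G1 G2 where d: "d \<in> borel_measurable \<nu>" "G1 \<in> LC" "G2 \<in> LC" "0 < a" "0 < b"
    "AE x in P G0. d x = c + (a * (lr G0 G1 x - 1) - b * (lr G0 G2 x - 1))"
    by (rule tangentE)
  note [measurable] = d(1) lr_measurable[OF LC_dist[OF d(2)]] lr_measurable[OF LC_dist[OF d(3)]]
  define h where "h x = g x - (a * (lr G0 G1 x - 1) - b * (lr G0 G2 x - 1))" for x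
  have [measurable]: "h \<in> borel_measurable \<nu>" unfolding h_def[abs_def] by measurable
  have 1: "integrable (P G0) (\<lambda>x. (0 + (a * (lr G0 G1 x - 1) - b * (lr G0 G2 x - 1)))\<^sup>2)"
    by (rule lr_combination_sq[OF d(2,3)])
  have "integrable (P G0) (\<lambda>x. (1 * g x + (- 1) * (0 + (a * (lr G0 G1 x - 1) - b * (lr G0 G2 x - 1))))\<^sup>2)"
    by (rule L2_combination_integrable[OF _ _ g_sq 1]) auto
  moreover have "1 * g x + (- 1) * (0 + (a * (lr G0 G1 x - 1) - b * (lr G0 G2 x - 1))) = h x" for x
    by (simp add: h_def)
  ultimately have h_sq: "integrable (P G0) (\<lambda>x. (h x)\<^sup>2)" by (simp only:)
  have lri: "integrable (P G0) (lr G0 G1)" "integrable (P G0) (lr G0 G2)" "integrable (P G0) g"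
    using LC_lr_sq[OF d(2)] LC_lr_sq[OF d(3)] g_sq
    by (auto intro!: P0.square_integrable_imp_integrable[rotated])
  have hi: "integrable (P G0) h" and h0: "integral\<^sup>L (P G0) h = 0"
    unfolding h_def[abs_def] using lri
    by (simp_all add: integral_g integral_lr[OF d(2)] integral_lr[OF d(3)] P0.prob_space[simplified])
  \<comment> \<open>\<open>g\<close> and the scores have mean 0, so the constant \<open>c\<close> in
    \<open>d\<close> only adds its square to the distance and may be dropped.\<close>
  have "(\<integral>x. (h x)\<^sup>2 \<partial>P G0) \<le> (\<integral>x. (h x)\<^sup>2 - 2 * c * h x + c\<^sup>2 \<partial>P G0)"
    using h_sq hi h0 by (simp add: P0.prob_space[simplified])
  also have "\<dots> = (\<integral>x. (g x - d x)\<^sup>2 \<partial>P G0)"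
  proof (rule integral_cong_AE)
    show "AE x in P G0. (h x)\<^sup>2 - 2 * c * h x + c\<^sup>2 = (g x - d x)\<^sup>2"
      using d(6)
    proof eventually_elim
      case (elim x)
      have "g x - d x = h x - c" unfolding elim h_def by simp
      then show ?case by (simp add: power2_diff)
    qed
  qed simp_all
  finally have "(\<integral>x. (h x)\<^sup>2 \<partial>P G0) < \<epsilon>" using d_le by simp
  then show ?thesis using d that unfolding h_def by blast
qed

end

section \<open>The lower bound\<close>

text \<open>For finitely many \<open>n\<close> the mixing weight exceeds 1 and the error law need
  not be a probability law. Dropping these terms makes Levy's continuity theorem applicable.\<close>

lemma weak_conv_m_ignore_initial:
  "weak_conv_m (\<lambda>n. M (n + k)) L \<longleftrightarrow> weak_conv_m M L"
  unfolding weak_conv_m_def weak_conv_def by (auto intro: LIMSEQ_offset LIMSEQ_ignore_initial_segment)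

text \<open>Scaling the standard normal law, instead of using a normal density, includes
  \<open>v = 0\<close>, where the law is the point mass at 0.\<close>

lemma
  assumes "0 \<le> v"
  defines "L \<equiv> distr std_normal_distribution borel (\<lambda>x. sqrt v * x)"
  shows real_distribution_normal: "real_distribution L"
    and char_normal: "char L s = of_real (exp (- (s\<^sup>2 * v / 2)))"
    and law_variance_normal: "law_variance L = ennreal v"
    and law_second_moment_normal: "law_second_moment L = ennreal v"
proof -
  interpret N: real_distribution std_normal_distribution by (rule real_dist_normal_dist)
  show "real_distribution L" unfolding L_def by (intro N.real_distribution_distr) simp
  have "char L s = char std_normal_distribution (s * sqrt v)"
    unfolding L_def char_def by (subst integral_distr) (auto simp: mult.assoc)
  also have "\<dots> = of_real (exp (- (s\<^sup>2 * v / 2)))"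
    using assms(1) by (simp add: char_std_normal_distribution power_mult_distrib)
  finally show "char L s = of_real (exp (- (s\<^sup>2 * v / 2)))" .
  have m: "(LINT x|std_normal_distribution. x\<^sup>2) = 1" "integrable std_normal_distribution (\<lambda>x. x\<^sup>2)"
    using std_normal_distribution_even_moments[of 1] by simp_all
  have "law_second_moment L = (\<integral>\<^sup>+x. ennreal ((sqrt v * x)\<^sup>2) \<partial>std_normal_distribution)"
    unfolding law_second_moment_def L_def by (subst nn_integral_distr) auto
  also have "\<dots> = (\<integral>\<^sup>+x. ennreal (v * x\<^sup>2) \<partial>std_normal_distribution)"
    using assms(1) by (simp add: power_mult_distrib)
  also have "\<dots> = ennreal (LINT x|std_normal_distribution. v * x\<^sup>2)"
    using m assms(1) by (intro nn_integral_eq_integral) auto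
  also have "\<dots> = ennreal v" using m by simp
  finally show *: "law_second_moment L = ennreal v" .
  have "(LINT z|L. z) = (LINT x|std_normal_distribution. sqrt v * x)"
    unfolding L_def by (subst integral_distr) auto
  also have "\<dots> = 0"
    using integral_std_normal_distribution_moment_odd[of 1] by simp
  finally show "law_variance L = ennreal v"
    using * unfolding law_variance_def law_second_moment_def by simp
qed

lemma outer_measure_of_Un_le:
  assumes "A \<subseteq> space M" "B \<subseteq> space M"
  shows "outer_measure_of M (A \<union> B) \<le> outer_measure_of M A + outer_measure_of M B"
proof -
  obtain E where E: "E \<in> sets M" "A \<subseteq> E" "outer_measure_of M A = emeasure M E"
    using outer_measure_of_attain[OF assms(1)] by blast
  obtain F where F: "F \<in> sets M" "B \<subseteq> F" "outer_measure_of M B = emeasure M F"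
    using outer_measure_of_attain[OF assms(2)] by blast
  have "outer_measure_of M (A \<union> B) \<le> outer_measure_of M (E \<union> F)"
    using E F by (intro outer_measure_of_mono) auto
  also have "\<dots> = emeasure M (E \<union> F)" using E F by simp
  also have "\<dots> \<le> emeasure M E + emeasure M F" using E F by (intro emeasure_subadditive)
  finally show ?thesis using E F by simp
qed

lemma observations_measurable:
  assumes "fst \<in> measurable J N"
  shows "(\<lambda>\<omega>. \<lambda>j\<in>{..<n}. fst (\<omega> j)) \<in> measurable (\<Pi>\<^sub>M j\<in>{..<n}. J) (\<Pi>\<^sub>M j\<in>{..<n}. N)"
proof (rule measurable_restrict)
  fix j assume "j \<in> {..<n}"
  then have "(\<lambda>\<omega>. \<omega> j) \<in> measurable (\<Pi>\<^sub>M j\<in>{..<n}. J) J"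
    by (rule measurable_component_singleton)
  then show "(\<lambda>\<omega>. fst (\<omega> j)) \<in> measurable (\<Pi>\<^sub>M j\<in>{..<n}. J) N"
    by (rule measurable_compose[OF _ assms])
qed

context local_model
begin

section \<open>Characteristic functions of the error laws\<close>

lemma v0_sum_measurable: "(\<lambda>x. \<Sum>j<n. v0 (x j)) \<in> borel_measurable (\<Pi>\<^sub>M j\<in>{..<n}. \<nu>)"
  by measurable

lemma prob_space_sample:
  assumes G: "distribution_on T G"
  shows "prob_space (sample \<nu> f G n)"
  unfolding sample_def by (intro prob_space_PiM prob_space_joint G)

lemma error_measurable:
  assumes G: "distribution_on T G" and S: "S n \<in> borel_measurable (\<Pi>\<^sub>M j\<in>{..<n}. \<nu>)"
  shows "(\<lambda>\<omega>. (S n (observations n \<omega>) - utility_sum u n \<omega>) / sqrt (real n)) \<in> borel_measurable (sample \<nu> f G n)"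
proof -
  have [measurable]: "(\<lambda>\<omega>. S n (observations n \<omega>)) \<in> borel_measurable (sample \<nu> f G n)"
    unfolding sample_def observations_def
    by (rule measurable_compose[OF observations_measurable[OF fst_measurable_joint[OF G]] S])
  have "case_prod u \<in> borel_measurable (J G)"
    unfolding borel_measurable_pair_iff(2)[OF G] by measurable
  then have "(\<lambda>\<omega>. case_prod u (\<omega> j)) \<in> borel_measurable (sample \<nu> f G n)" if "j < n" for j
    unfolding sample_def using that by (intro measurable_compose[OF measurable_component_singleton]) auto
  then have [measurable]: "utility_sum u n \<in> borel_measurable (sample \<nu> f G n)"
    unfolding utility_sum_def[abs_def] by (intro borel_measurable_sum) (auto simp: split_beta')
  show ?thesis by measurable
qed

lemma real_distribution_error_law:
  assumes "distribution_on T G" "S n \<in> borel_measurable (\<Pi>\<^sub>M j\<in>{..<n}. \<nu>)"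
  shows "real_distribution (error_law \<nu> f u G S n)"
proof -
  interpret prob_space "sample \<nu> f G n" by (rule prob_space_sample[OF assms(1)])
  show ?thesis
    unfolding error_law_def by (rule real_distribution_distr[OF error_measurable[where S = S and n = n, OF assms]])
qed

text \<open>The estimator is compared with the sum of \<open>v0\<close> and not with the unobserved
  utility sum, so that this factor is a function of the observations. The difference of the two sums
  is the sum of the \<open>w\<close>, which factorises over the coordinates.\<close>

definition A :: "(nat \<Rightarrow> (nat \<Rightarrow> 'x) \<Rightarrow> real) \<Rightarrow> real \<Rightarrow> nat \<Rightarrow> (nat \<Rightarrow> 'x) \<Rightarrow> complex" where
  "A S s n x = iexp (s * (S n x - (\<Sum>j<n. v0 (x j))) / sqrt (real n))"

lemma A_measurable:
  assumes [measurable]: "S n \<in> borel_measurable (\<Pi>\<^sub>M j\<in>{..<n}. \<nu>)"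
  shows "A S s n \<in> borel_measurable (\<Pi>\<^sub>M j\<in>{..<n}. \<nu>)"
proof -
  note [measurable] = v0_sum_measurable[of n]
  show ?thesis unfolding A_def[abs_def] by measurable
qed

lemma norm_A: "norm (A S s n x) \<le> 1"
  by (simp add: A_def)

lemma char_error_law:
  assumes G: "distribution_on T G" and S: "S n \<in> borel_measurable (\<Pi>\<^sub>M j\<in>{..<n}. \<nu>)"
  shows "char (error_law \<nu> f u G S n) s =
    (\<integral>\<omega>. A S s n (\<lambda>j\<in>{..<n}. fst (\<omega> j)) * (\<Prod>j<n. iexp (s * w (\<omega> j) / sqrt (real n))) \<partial>(\<Pi>\<^sub>M j\<in>{..<n}. J G))"
proof -
  have "char (error_law \<nu> f u G S n) s = (\<integral>\<omega>. iexp (s * ((S n (observations n \<omega>) - utility_sum u n \<omega>) / sqrt (real n))) \<partial>sample \<nu> f G n)"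
    unfolding error_law_def char_def
    by (subst integral_distr[OF error_measurable[where S = S and n = n, OF G S]]) auto
  also have "\<dots> = (\<integral>\<omega>. A S s n (\<lambda>j\<in>{..<n}. fst (\<omega> j)) * (\<Prod>j<n. iexp (s * w (\<omega> j) / sqrt (real n))) \<partial>(\<Pi>\<^sub>M j\<in>{..<n}. J G))"
    unfolding sample_def
  proof (intro Bochner_Integration.integral_cong refl)
    fix \<omega> :: "nat \<Rightarrow> 'x \<times> 't"
    let ?o = "\<lambda>j\<in>{..<n}. fst (\<omega> j)"
    have v: "(\<Sum>j<n. v0 (?o j)) = (\<Sum>j<n. v0 (fst (\<omega> j)))"
      by (intro sum.cong) auto
    have "s * ((S n ?o - utility_sum u n \<omega>) / sqrt (real n)) =
        s * (S n ?o - (\<Sum>j<n. v0 (?o j))) / sqrt (real n) + (\<Sum>j<n. s * w (\<omega> j) / sqrt (real n))"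
      unfolding v by (simp add: utility_sum_def w_def sum_subtractf right_diff_distrib diff_divide_distrib
          flip: sum_distrib_left sum_divide_distrib)
    moreover have "iexp (\<Sum>j<n. s * w (\<omega> j) / sqrt (real n)) = (\<Prod>j<n. iexp (s * w (\<omega> j) / sqrt (real n)))"
      by (simp only: of_real_sum sum_distrib_left exp_sum finite_lessThan)
    ultimately show "iexp (s * ((S n (observations n \<omega>) - utility_sum u n \<omega>) / sqrt (real n))) =
        A S s n ?o * (\<Prod>j<n. iexp (s * w (\<omega> j) / sqrt (real n)))"
      unfolding A_def observations_def by (simp only: of_real_add distrib_left exp_add)
  qed
  finally show ?thesis .
qed

lemma eventually_mix_valid: "\<forall>\<^sub>F n in sequentially. c \<le> sqrt (real n) \<and> 0 < n"
  by (intro eventually_conj eventually_gt_at_top) real_asymp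

lemma mix_valid:
  assumes "0 < c" "c \<le> sqrt (real n)"
  shows "c / sqrt (real n) \<in> {0..1}"
  using assms by (auto simp: divide_le_eq)

lemma char_regular_tendsto:
  assumes reg: "regular_with_limit \<nu> f u \<G> G0 S L" and G: "G \<in> LC" and c: "0 < c"
  shows "(\<lambda>n. char (error_law \<nu> f u (mix (c / sqrt (real n)) G0 G) S n) s) \<longlonglongrightarrow> char L s"
proof -
  obtain N where N: "\<And>n. N \<le> n \<Longrightarrow> c \<le> sqrt (real n)"
    using eventually_mix_valid[of c] by (auto simp: eventually_sequentially)
  have "weak_conv_m (\<lambda>n. error_law \<nu> f u (mix (c / sqrt (real n)) G0 G) S n) L"
    using reg G c by (simp add: regular_with_limit_def)
  then have wc: "weak_conv_m (\<lambda>n. error_law \<nu> f u (mix (c / sqrt (real (n + N))) G0 G) S (n + N)) L"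
    using weak_conv_m_ignore_initial[of "\<lambda>n. error_law \<nu> f u (mix (c / sqrt (real n)) G0 G) S n" N L] by simp
  have "(\<lambda>n. char (error_law \<nu> f u (mix (c / sqrt (real (n + N))) G0 G) S (n + N)) s) \<longlonglongrightarrow> char L s"
  proof (rule levy_continuity1[OF _ _ wc])
    show "real_distribution L" using reg by (simp add: regular_with_limit_def)
    show "real_distribution (error_law \<nu> f u (mix (c / sqrt (real (n + N))) G0 G) S (n + N))" for n
      using reg by (intro real_distribution_error_law distribution_on_mix dist0 LC_dist G mix_valid c N)
        (auto simp: regular_with_limit_def estimator_seq_def)
  qed
  then show ?thesis by (rule LIMSEQ_offset)
qed

lemma two_directions_LC:
  assumes "G1 \<in> LC" "G2 \<in> LC"
  shows "two_directions \<nu> T f G0 G1 G2 w"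
  by unfold_locales (use assms w_sq in \<open>auto intro: LC_dominated LC_lr_sq w_integrable integral_w G0_LC\<close>)

lemma norm_char_regular_le:
  assumes reg: "regular_with_limit \<nu> f u \<G> G0 S L" and s: "0 < s"
  shows "cmod (char L s) \<le> exp (- (s\<^sup>2 * \<sigma>2 / 2))"
proof -
  have S: "S n \<in> borel_measurable (\<Pi>\<^sub>M j\<in>{..<n}. \<nu>)" for n
    using reg by (simp add: regular_with_limit_def estimator_seq_def)
  have le: "(cmod (char L s))\<^sup>2 \<le> exp (s\<^sup>2 * \<epsilon> - s\<^sup>2 * \<sigma>2)" if e: "0 < \<epsilon>" for \<epsilon>
  proof -
    obtain a b G1 G2 where G: "G1 \<in> LC" "G2 \<in> LC" and ab: "0 < a" "0 < b"
      and d: "(\<integral>x. (g x - (a * (lr G0 G1 x - 1) - b * (lr G0 G2 x - 1)))\<^sup>2 \<partial>P G0) < \<epsilon>"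
      by (rule tangent_dense[OF e])
    interpret D: two_directions \<nu> T f G0 G1 G2 w s by (rule two_directions_LC[OF G])
    \<comment> \<open>The weights are \<open>s * a\<close> and \<open>s * b\<close>: then
      \<open>s\<^sup>2\<close> factors out of the integral, and the approximation of
      \<open>g\<close> can be chosen before \<open>s\<close> enters.\<close>
    have "(cmod (char L s))\<^sup>2 \<le> exp ((\<integral>x. (s * g x - (s * a * (lr G0 G1 x - 1) - s * b * (lr G0 G2 x - 1)))\<^sup>2 \<partial>P G0) - s\<^sup>2 * \<sigma>2)"
    proof (rule D.norm_char_limit_le[where A = "A S s"])
      fix t1 t2 :: real assume t: "0 < t1" "0 < t2"
      let ?G = "mix (t2 / (t1 + t2)) G1 G2"
      have GL: "?G \<in> LC" by (rule lr_mix_combination(1)[OF G t])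
      have "0 < t1 + t2" using t by simp
      have ev: "\<forall>\<^sub>F n in sequentially. char (error_law \<nu> f u (mix ((t1 + t2) / sqrt (real n)) G0 ?G) S n) s =
         (\<integral>\<omega>. A S s n (\<lambda>j\<in>{..<n}. fst (\<omega> j)) * (\<Prod>j<n. D.e n (\<omega> j)) \<partial>(\<Pi>\<^sub>M j\<in>{..<n}. J (mix ((t1 + t2) / sqrt (real n)) G0 ?G)))"
        using eventually_mix_valid[of "t1 + t2"]
      proof eventually_elim
        case (elim n)
        show ?case
          unfolding D.e_def
          by (rule char_error_law[OF distribution_on_mix[OF dist0 LC_dist[OF GL] mix_valid[OF \<open>0 < t1 + t2\<close>]] S]) (use elim in simp)
      qed
      show "(\<lambda>n. \<integral>\<omega>. A S s n (\<lambda>j\<in>{..<n}. fst (\<omega> j)) * (\<Prod>j<n. D.e n (\<omega> j)) \<partial>(\<Pi>\<^sub>M j\<in>{..<n}. J (mix ((t1 + t2) / sqrt (real n)) G0 ?G))) \<longlonglongrightarrow> char L s"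
        by (rule Lim_transform_eventually[OF char_regular_tendsto[OF reg GL \<open>0 < t1 + t2\<close>] ev])
    qed (use s ab S in \<open>auto intro: A_measurable norm_A\<close>)
    also have "(\<integral>x. (s * g x - (s * a * (lr G0 G1 x - 1) - s * b * (lr G0 G2 x - 1)))\<^sup>2 \<partial>P G0) =
        (\<integral>x. s\<^sup>2 * (g x - (a * (lr G0 G1 x - 1) - b * (lr G0 G2 x - 1)))\<^sup>2 \<partial>P G0)"
    proof (intro Bochner_Integration.integral_cong refl)
      fix x
      have "s * g x - (s * a * (lr G0 G1 x - 1) - s * b * (lr G0 G2 x - 1)) = s * (g x - (a * (lr G0 G1 x - 1) - b * (lr G0 G2 x - 1)))"
        by (simp only: right_diff_distrib mult.assoc)
      then show "(s * g x - (s * a * (lr G0 G1 x - 1) - s * b * (lr G0 G2 x - 1)))\<^sup>2 = s\<^sup>2 * (g x - (a * (lr G0 G1 x - 1) - b * (lr G0 G2 x - 1)))\<^sup>2"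
        by (simp only: power_mult_distrib)
    qed
    also have "exp (\<dots> - s\<^sup>2 * \<sigma>2) \<le> exp (s\<^sup>2 * \<epsilon> - s\<^sup>2 * \<sigma>2)"
      using d by (auto intro!: mult_left_mono)
    finally show ?thesis .
  qed
  have "(cmod (char L s))\<^sup>2 \<le> exp (s\<^sup>2 * 0 - s\<^sup>2 * \<sigma>2)"
  proof (rule tendsto_lowerbound)
    show "((\<lambda>\<epsilon>. exp (s\<^sup>2 * \<epsilon> - s\<^sup>2 * \<sigma>2)) \<longlongrightarrow> exp (s\<^sup>2 * 0 - s\<^sup>2 * \<sigma>2)) (at_right 0)"
      by (intro tendsto_intros)
    show "\<forall>\<^sub>F \<epsilon> in at_right 0. (cmod (char L s))\<^sup>2 \<le> exp (s\<^sup>2 * \<epsilon> - s\<^sup>2 * \<sigma>2)"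
      using eventually_at_right_less by eventually_elim (rule le)
  qed simp
  also have "exp (s\<^sup>2 * 0 - s\<^sup>2 * \<sigma>2) = (exp (- (s\<^sup>2 * \<sigma>2 / 2)))\<^sup>2"
    by (simp flip: exp_double)
  finally show ?thesis by (rule power2_le_imp_le) simp
qed

lemma law_variance_regular_ge:
  assumes reg: "regular_with_limit \<nu> f u \<G> G0 S L"
  shows "ennreal \<sigma>2 \<le> law_variance L"
  using reg norm_char_regular_le[OF reg]
  by (intro law_variance_ge_of_char) (auto simp: regular_with_limit_def)

section \<open>Contiguity\<close>

lemma
  fixes \<phi> :: "'x \<Rightarrow> complex"
  assumes dom: "dominated G0 G" and \<phi> [measurable]: "\<phi> \<in> borel_measurable \<nu>" and C: "\<And>x. norm (\<phi> x) \<le> C"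
  shows integrable_fst_bounded: "integrable (J G) (\<lambda>z. \<phi> (fst z))"
    and integral_fst_bounded: "(\<integral>z. \<phi> (fst z) \<partial>J G) = (\<integral>x. \<phi> x * of_real (lr G0 G x) \<partial>P G0)"
    and integrable_bounded_lr: "integrable (P G0) (\<lambda>x. \<phi> x * of_real (lr G0 G x))"
proof -
  have G: "distribution_on T G" using dom by (simp add: dominated_def)
  interpret J: prob_space "J G" by (rule prob_space_joint[OF G])
  have m: "(\<lambda>z. \<phi> (fst z)) \<in> borel_measurable (J G)"
    unfolding borel_measurable_pair_iff(2)[OF G] by measurable
  show i: "integrable (J G) (\<lambda>z. \<phi> (fst z))"
    by (rule J.integrable_const_bound[OF _ m, of C]) (use C in auto)
  have eq: "cmean G0 G (\<lambda>z. \<phi> (fst z)) = (\<lambda>x. \<phi> x * cmean G0 G (\<lambda>_. 1) x)"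
    by (rule ext) (use cmean_mult[of G0 G \<phi> "\<lambda>_. 1"] in simp)
  have AE: "AE x in P G0. \<phi> x * cmean G0 G (\<lambda>_. 1) x = \<phi> x * of_real (lr G0 G x)"
    using AE_P'[OF dist0 cmean_const[OF G, of G0 "1 :: complex"]] by eventually_elim (simp add: scaleR_conv_of_real)
  note [measurable] = dens_measurable[OF G] dens_measurable[OF dist0] cmean_measurable[OF dist0 G, of "\<lambda>_. 1 :: complex"]
  have m2: "(\<lambda>x. \<phi> x * of_real (lr G0 G x)) \<in> borel_measurable (P G0)"
    unfolding borel_measurable_P by measurable
  have i2: "integrable (P G0) (\<lambda>x. \<phi> x * cmean G0 G (\<lambda>_. 1) x)"
    using cmean_integrable[OF dom i] unfolding eq .
  show "integrable (P G0) (\<lambda>x. \<phi> x * of_real (lr G0 G x))"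
    by (rule integrable_cong_AE_imp[OF i2 m2 AE])
  show "(\<integral>z. \<phi> (fst z) \<partial>J G) = (\<integral>x. \<phi> x * of_real (lr G0 G x) \<partial>P G0)"
    using integral_cmean[OF dom i] integral_cong_AE[OF borel_measurable_integrable[OF i2] m2 AE] unfolding eq by simp
qed

lemma integral_fst_bounded_G0:
  fixes \<phi> :: "'x \<Rightarrow> complex"
  assumes \<phi>: "\<phi> \<in> borel_measurable \<nu>" "\<And>x. norm (\<phi> x) \<le> C"
  shows "(\<integral>z. \<phi> (fst z) \<partial>J G0) = (\<integral>x. \<phi> x \<partial>P G0)"
  unfolding integral_fst_bounded[OF LC_dominated[OF G0_LC] \<phi>]
proof (rule integral_cong_AE[OF borel_measurable_integrable[OF integrable_bounded_lr[OF LC_dominated[OF G0_LC] \<phi>]]])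
  show "AE x in P G0. \<phi> x * complex_of_real (lr G0 G0 x) = \<phi> x"
    using lr_G0
  proof eventually_elim
    case (elim x)
    show ?case unfolding elim by simp
  qed
qed (use \<phi> in auto)

text \<open>The marginalisation lemma with the constant 1 in the place of \<open>e\<close> and an
  indicator as \<open>A\<close>; \<open>k\<close> is the likelihood ratio of one
  observation.\<close>

lemma measure_observations_eq:
  assumes H: "distribution_on T H" and k: "integrable (P G0) k"
    and eq: "\<And>\<phi> C. \<phi> \<in> borel_measurable \<nu> \<Longrightarrow> (\<And>x. norm (\<phi> x) \<le> C) \<Longrightarrow>
      (\<integral>z. \<phi> (fst z) \<partial>J H) = (\<integral>x. \<phi> x * complex_of_real (k x) \<partial>P G0)"
    and B: "B \<in> sets (\<Pi>\<^sub>M j\<in>{..<n}. \<nu>)"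
  shows "measure (sample \<nu> f H n) {\<omega> \<in> space (sample \<nu> f H n). observations n \<omega> \<in> B} =
    (\<integral>x. indicator B x * (\<Prod>j<n. k (x j)) \<partial>(\<Pi>\<^sub>M j\<in>{..<n}. P G0))"
proof -
  interpret JH: prob_space "J H" by (rule prob_space_joint[OF H])
  let ?M = "sample \<nu> f H n" and ?E = "{\<omega> \<in> space (sample \<nu> f H n). observations n \<omega> \<in> B}"
  have "observations n \<in> measurable ?M (\<Pi>\<^sub>M j\<in>{..<n}. \<nu>)"
    unfolding sample_def observations_def[abs_def] by (rule observations_measurable[OF fst_measurable_joint[OF H]])
  then have E: "?E \<in> sets ?M" using B by measurable
  interpret M: prob_space ?M by (rule prob_space_sample[OF H])
  have "complex_of_real (measure ?M ?E) = of_real (\<integral>\<omega>. indicator ?E \<omega> \<partial>?M)"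
    using E by simp
  also have "\<dots> = (\<integral>\<omega>. of_real (indicator ?E \<omega>) \<partial>?M)"
    by (rule integral_complex_of_real[symmetric])
  also have "\<dots> = (\<integral>\<omega>. of_real (indicator B (\<lambda>j\<in>{..<n}. fst (\<omega> j))) * (\<Prod>j<n. 1) \<partial>(\<Pi>\<^sub>M j\<in>{..<n}. J H))"
    unfolding sample_def by (intro Bochner_Integration.integral_cong refl) (simp add: observations_def indicator_def)
  also have "\<dots> = (\<integral>x. of_real (indicator B x) * (\<Prod>j<n. complex_of_real (k (x j))) \<partial>(\<Pi>\<^sub>M j\<in>{..<n}. P G0))"
  proof (rule integral_PiM_marginal[OF _ _ fst_measurable_joint[OF H] sets_P, where C = 1])
    show "finite_measure (J H)" "finite_measure (P G0)" by unfold_locales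
    show "(\<lambda>x. complex_of_real (indicator B x)) \<in> borel_measurable (\<Pi>\<^sub>M j\<in>{..<n}. \<nu>)"
      using B by measurable
    show "(\<integral>z. \<phi> (fst z) * 1 \<partial>J H) = (\<integral>x. \<phi> x * complex_of_real (k x) \<partial>P G0)"
      if "\<phi> \<in> borel_measurable \<nu>" "\<And>x. norm (\<phi> x) \<le> C" for \<phi> C
      using eq[OF that] by simp
  qed (use k in \<open>auto simp: indicator_def\<close>)
  also have "\<dots> = (\<integral>x. of_real (indicator B x * (\<Prod>j<n. k (x j))) \<partial>(\<Pi>\<^sub>M j\<in>{..<n}. P G0))"
    by simp
  also have "\<dots> = of_real (\<integral>x. indicator B x * (\<Prod>j<n. k (x j)) \<partial>(\<Pi>\<^sub>M j\<in>{..<n}. P G0))"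
    by (rule integral_complex_of_real)
  finally show ?thesis by (simp only: of_real_eq_iff)
qed

text \<open>Contiguity: the second moment of the likelihood ratio of the sample stays bounded.\<close>

lemma measure_mix_le:
  assumes G: "G \<in> LC" and c: "0 < c" "c \<le> sqrt (real n)" and B: "B \<in> sets (\<Pi>\<^sub>M j\<in>{..<n}. \<nu>)" and M: "0 < M"
  defines "H \<equiv> mix (c / sqrt (real n)) G0 G"
  shows "measure (sample \<nu> f H n) {\<omega> \<in> space (sample \<nu> f H n). observations n \<omega> \<in> B} \<le>
    M * measure (sample \<nu> f G0 n) {\<omega> \<in> space (sample \<nu> f G0 n). observations n \<omega> \<in> B} +
    exp (c\<^sup>2 * (\<integral>x. (lr G0 G x - 1)\<^sup>2 \<partial>P G0)) / M"
proof -
  let ?t = "c / sqrt (real n)" and ?h = "\<integral>x. (lr G0 G x - 1)\<^sup>2 \<partial>P G0"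
  have n0: "0 < real n" using c by (cases n) auto
  have t: "?t \<in> {0..1}" by (rule mix_valid[OF c])
  have H: "distribution_on T H" unfolding H_def by (rule distribution_on_mix[OF dist0 LC_dist[OF G] t])
  interpret PP: product_sigma_finite "\<lambda>_. P G0" by standard
  interpret PPn: prob_space "\<Pi>\<^sub>M j\<in>{..<n}. P G0" by (intro prob_space_PiM prob_space_P dist0)
  define k where "k x = 1 + ?t * (lr G0 G x - 1)" for x
  have lrm: "lr G0 G \<in> borel_measurable (P G0)" using lr_measurable[OF LC_dist[OF G]] by simp
  have km [measurable]: "k \<in> borel_measurable (P G0)"
    unfolding k_def[abs_def] by (intro borel_measurable_add borel_measurable_times borel_measurable_diff lrm borel_measurable_const)
  have lr_i: "integrable (P G0) (lr G0 G)"
    by (rule P0.square_integrable_imp_integrable[OF lrm LC_lr_sq[OF G]])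
  have k_i: "integrable (P G0) k" unfolding k_def[abs_def] using lr_i by auto
  \<comment> \<open>As a convex combination of 1 and the ratio, \<open>k\<close> is nonnegative;
    here the bound on the mixing weight enters.\<close>
  have k0: "0 \<le> k x" for x
  proof -
    have "k x = (1 - ?t) + ?t * lr G0 G x" by (simp add: k_def right_diff_distrib)
    moreover have "0 \<le> (1 - ?t) + ?t * lr G0 G x"
      using t by (intro add_nonneg_nonneg mult_nonneg_nonneg lr_nonneg) auto
    ultimately show ?thesis by (simp only:)
  qed
  have h_i: "integrable (P G0) (\<lambda>x. (lr G0 G x - 1)\<^sup>2)"
    using L2_combination_integrable[OF lrm borel_measurable_const LC_lr_sq[OF G], of 1 1 "-1"] by simp
  have k2: "(k x)\<^sup>2 = 1 + 2 * ?t * (lr G0 G x - 1) + ?t\<^sup>2 * (lr G0 G x - 1)\<^sup>2" for x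
    unfolding k_def power2_sum power_mult_distrib by simp
  have k2_i: "integrable (P G0) (\<lambda>x. (k x)\<^sup>2)"
    unfolding k2 using lr_i h_i by auto
  \<comment> \<open>The linear term has mean 0, so the excess over 1 is of order 1 / n and its n-th
    power stays below a constant independent of \<open>n\<close>.\<close>
  have "(\<integral>x. (k x)\<^sup>2 \<partial>P G0) = 1 + ?t\<^sup>2 * ?h"
    unfolding k2 using lr_i h_i by (simp add: integral_lr[OF G] P0.prob_space[simplified])
  also have "\<dots> \<le> exp (?t\<^sup>2 * ?h)" by (rule exp_ge_add_one_self)
  finally have k2_le: "(\<integral>x. (k x)\<^sup>2 \<partial>P G0) \<le> exp (?t\<^sup>2 * ?h)" .
  have eqH: "measure (sample \<nu> f H n) {\<omega> \<in> space (sample \<nu> f H n). observations n \<omega> \<in> B} =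
    (\<integral>x. indicator B x * (\<Prod>j<n. k (x j)) \<partial>(\<Pi>\<^sub>M j\<in>{..<n}. P G0))"
  proof (rule measure_observations_eq[OF H k_i _ B])
    fix \<phi> :: "'x \<Rightarrow> complex" and C assume \<phi>: "\<phi> \<in> borel_measurable \<nu>" "\<And>x. norm (\<phi> x) \<le> C"
    note f0 = integrable_fst_bounded[OF LC_dominated[OF G0_LC] \<phi>]
    note f1 = integrable_fst_bounded[OF LC_dominated[OF G] \<phi>]
    note i1 = integrable_bounded_lr[OF LC_dominated[OF G] \<phi>]
    have \<phi>_i: "integrable (P G0) \<phi>"
      by (rule P0.integrable_const_bound[of _ C]) (use \<phi> in auto)
    have "(\<integral>z. \<phi> (fst z) \<partial>J H) = of_real (1 - ?t) * (\<integral>x. \<phi> x \<partial>P G0) + of_real ?t * (\<integral>x. \<phi> x * of_real (lr G0 G x) \<partial>P G0)"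
      unfolding H_def integral_joint_mix[OF dist0 LC_dist[OF G] t f0 f1] integral_fst_bounded_G0[OF \<phi>] integral_fst_bounded[OF LC_dominated[OF G] \<phi>] ..
    also have "\<dots> = (\<integral>x. of_real (1 - ?t) * \<phi> x + of_real ?t * (\<phi> x * of_real (lr G0 G x)) \<partial>P G0)"
      by (subst Bochner_Integration.integral_add[OF integrable_mult_right[OF \<phi>_i] integrable_mult_right[OF i1]])
        (simp only: integral_mult_right_zero)
    also have "\<dots> = (\<integral>x. \<phi> x * complex_of_real (k x) \<partial>P G0)"
      by (intro Bochner_Integration.integral_cong refl) (simp add: k_def ring_distribs mult_ac)
    finally show "(\<integral>z. \<phi> (fst z) \<partial>J H) = (\<integral>x. \<phi> x * complex_of_real (k x) \<partial>P G0)" .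
  qed
  have eq0: "measure (sample \<nu> f G0 n) {\<omega> \<in> space (sample \<nu> f G0 n). observations n \<omega> \<in> B} =
    (\<integral>x. indicator B x * (\<Prod>j<n. 1) \<partial>(\<Pi>\<^sub>M j\<in>{..<n}. P G0))"
  proof (rule measure_observations_eq[OF dist0 _ _ B])
    fix \<phi> :: "'x \<Rightarrow> complex" and C assume \<phi>: "\<phi> \<in> borel_measurable \<nu>" "\<And>x. norm (\<phi> x) \<le> C"
    show "(\<integral>z. \<phi> (fst z) \<partial>J G0) = (\<integral>x. \<phi> x * complex_of_real 1 \<partial>P G0)"
      using integral_fst_bounded_G0[OF \<phi>] by simp
  qed simp
  have BP: "B \<in> sets (\<Pi>\<^sub>M j\<in>{..<n}. P G0)" using B by (simp cong: sets_PiM_cong)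
  have \<Lambda>_i: "integrable (\<Pi>\<^sub>M j\<in>{..<n}. P G0) (\<lambda>x. \<Prod>j<n. k (x j))"
    by (intro PP.product_integrable_prod k_i) auto
  have \<Lambda>2_i: "integrable (\<Pi>\<^sub>M j\<in>{..<n}. P G0) (\<lambda>x. \<Prod>j<n. (k (x j))\<^sup>2)"
    by (intro PP.product_integrable_prod k2_i) auto
  have B_i: "integrable (\<Pi>\<^sub>M j\<in>{..<n}. P G0) (indicator B :: _ \<Rightarrow> real)"
    using BP by (simp add: PPn.emeasure_finite less_top[symmetric])
  have "(\<integral>x. indicator B x * (\<Prod>j<n. k (x j)) \<partial>(\<Pi>\<^sub>M j\<in>{..<n}. P G0)) \<le>
      (\<integral>x. M * indicator B x + (\<Prod>j<n. (k (x j))\<^sup>2) / M \<partial>(\<Pi>\<^sub>M j\<in>{..<n}. P G0))"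
  proof (rule integral_mono)
    show "integrable (\<Pi>\<^sub>M j\<in>{..<n}. P G0) (\<lambda>x. indicator B x * (\<Prod>j<n. k (x j)))"
      using integrable_mult_indicator[OF BP \<Lambda>_i] by simp
    show "integrable (\<Pi>\<^sub>M j\<in>{..<n}. P G0) (\<lambda>x. M * indicator B x + (\<Prod>j<n. (k (x j))\<^sup>2) / M)"
      using B_i \<Lambda>2_i by auto
    fix x
    define \<Lambda> where "\<Lambda> = (\<Prod>j<n. k (x j))"
    have sq: "(\<Prod>j<n. (k (x j))\<^sup>2) = \<Lambda>\<^sup>2" by (simp add: \<Lambda>_def prod_power_distrib)
    \<comment> \<open>Truncation of the likelihood ratio at level \<open>M\<close>, with the part
      above it bounded by its second moment over \<open>M\<close>.\<close>
    have "\<Lambda> \<le> M + \<Lambda>\<^sup>2 / M"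
    proof -
      have "0 \<le> (\<Lambda> - M)\<^sup>2 + M * \<Lambda>"
        using M k0 by (simp add: \<Lambda>_def prod_nonneg)
      then have "M * \<Lambda> \<le> M * M + \<Lambda>\<^sup>2" by (simp add: power2_eq_square algebra_simps)
      then show ?thesis using M by (simp add: field_simps)
    qed
    then show "indicator B x * (\<Prod>j<n. k (x j)) \<le> M * indicator B x + (\<Prod>j<n. (k (x j))\<^sup>2) / M"
      unfolding sq unfolding \<Lambda>_def[symmetric] using M by (auto simp: indicator_def)
  qed
  also have "\<dots> = M * (\<integral>x. indicator B x * (\<Prod>j<n. 1) \<partial>(\<Pi>\<^sub>M j\<in>{..<n}. P G0)) + (\<Prod>j<n. \<integral>x. (k x)\<^sup>2 \<partial>P G0) / M"
  proof -
    have "(\<integral>x. (\<Prod>j<n. (k (x j))\<^sup>2) \<partial>(\<Pi>\<^sub>M j\<in>{..<n}. P G0)) = (\<Prod>j<n. \<integral>x. (k x)\<^sup>2 \<partial>P G0)"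
      by (rule PP.product_integral_prod) (auto intro: k2_i)
    then show ?thesis using B_i \<Lambda>2_i by simp
  qed
  also have "(\<Prod>j<n. \<integral>x. (k x)\<^sup>2 \<partial>P G0) \<le> exp (?t\<^sup>2 * ?h) ^ n"
    using k2_le by (simp add: power_mono)
  also have "exp (?t\<^sup>2 * ?h) ^ n = exp (c\<^sup>2 * ?h)"
    using n0 by (simp add: exp_of_nat_mult[symmetric] power_divide)
  finally show ?thesis unfolding eqH eq0 using M by (simp add: divide_right_mono)
qed

lemma contiguous:
  assumes G: "G \<in> LC" and c: "0 < c" and B: "\<And>n. B n \<in> sets (\<Pi>\<^sub>M j\<in>{..<n}. \<nu>)"
    and lim: "(\<lambda>n. measure (sample \<nu> f G0 n) {\<omega> \<in> space (sample \<nu> f G0 n). observations n \<omega> \<in> B n}) \<longlonglongrightarrow> 0"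
  shows "(\<lambda>n. measure (sample \<nu> f (mix (c / sqrt (real n)) G0 G) n)
    {\<omega> \<in> space (sample \<nu> f (mix (c / sqrt (real n)) G0 G) n). observations n \<omega> \<in> B n}) \<longlonglongrightarrow> 0"
proof (rule order_tendstoI)
  fix e :: real assume "0 < e"
  let ?C = "exp (c\<^sup>2 * (\<integral>x. (lr G0 G x - 1)\<^sup>2 \<partial>P G0))"
  \<comment> \<open>This level makes the truncated part \<open>e / 2\<close> for every
    \<open>n\<close>; with \<open>M\<close> fixed, the other term tends to 0.\<close>
  define M where "M = 2 * ?C / e"
  have M: "0 < M" using \<open>0 < e\<close> by (simp add: M_def)
  have CM: "?C / M = e / 2" using \<open>0 < e\<close> by (simp add: M_def)
  have "\<forall>\<^sub>F n in sequentially. measure (sample \<nu> f G0 n) {\<omega> \<in> space (sample \<nu> f G0 n). observations n \<omega> \<in> B n} < e / 2 / M"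
    using \<open>0 < e\<close> M by (intro order_tendstoD(2)[OF lim]) auto
  then show "\<forall>\<^sub>F n in sequentially. measure (sample \<nu> f (mix (c / sqrt (real n)) G0 G) n)
    {\<omega> \<in> space (sample \<nu> f (mix (c / sqrt (real n)) G0 G) n). observations n \<omega> \<in> B n} < e"
    using eventually_mix_valid[of c]
  proof eventually_elim
    case (elim n)
    have "M * measure (sample \<nu> f G0 n) {\<omega> \<in> space (sample \<nu> f G0 n). observations n \<omega> \<in> B n} < e / 2"
      using elim(1) M by (simp add: less_divide_eq mult.commute)
    then show ?case
      using measure_mix_le[OF G c _ B M, of n] elim(2) unfolding CM by simp
  qed
qed (auto intro!: always_eventually less_le_trans[OF _ measure_nonneg])

section \<open>Efficiency\<close>

definition deviation :: "(nat \<Rightarrow> (nat \<Rightarrow> 'x) \<Rightarrow> real) \<Rightarrow> nat \<Rightarrow> real \<Rightarrow> (nat \<Rightarrow> 'x) set" where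
  "deviation S n \<delta> = {x \<in> space (\<Pi>\<^sub>M j\<in>{..<n}. \<nu>). \<delta> < \<bar>S n x - (\<Sum>j<n. v0 (x j))\<bar> / sqrt (real n)}"

lemma deviation_sets:
  assumes [measurable]: "S n \<in> borel_measurable (\<Pi>\<^sub>M j\<in>{..<n}. \<nu>)"
  shows "deviation S n \<delta> \<in> sets (\<Pi>\<^sub>M j\<in>{..<n}. \<nu>)"
proof -
  note [measurable] = v0_sum_measurable[of n]
  show ?thesis unfolding deviation_def by measurable
qed

lemma norm_A_minus_1_le:
  assumes "x \<in> space (\<Pi>\<^sub>M j\<in>{..<n}. \<nu>)" "0 \<le> \<delta>"
  shows "cmod (A S s n x - 1) \<le> \<bar>s\<bar> * \<delta> + 2 * indicator (deviation S n \<delta>) x"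
proof (cases "x \<in> deviation S n \<delta>")
  case True
  have "cmod (A S s n x - 1) \<le> 1 + 1"
    using norm_triangle_ineq4[of "A S s n x" 1] norm_A[of S s n x] by simp
  then show ?thesis using True assms(2) by (simp add: add_increasing)
next
  case False
  then have d: "\<bar>S n x - (\<Sum>j<n. v0 (x j))\<bar> / sqrt (real n) \<le> \<delta>"
    using assms by (simp add: deviation_def)
  have "cmod (A S s n x - 1) \<le> \<bar>s * (S n x - (\<Sum>j<n. v0 (x j))) / sqrt (real n)\<bar>"
    unfolding A_def by (rule norm_iexp_minus_1_le)
  also have "\<dots> = \<bar>s\<bar> * (\<bar>S n x - (\<Sum>j<n. v0 (x j))\<bar> / sqrt (real n))"
    by (simp add: abs_mult)
  also have "\<dots> \<le> \<bar>s\<bar> * \<delta>" using d by (intro mult_left_mono) auto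
  finally show ?thesis using False by simp
qed

text \<open>Replacing the factor \<open>A\<close> by 1 costs at most its mean distance from 1, since
  the remaining factors have modulus 1. What is left is a product over independent coordinates, an
  n-th power.\<close>

lemma char_error_law_approx:
  assumes H: "distribution_on T H" and S: "S n \<in> borel_measurable (\<Pi>\<^sub>M j\<in>{..<n}. \<nu>)" and "0 \<le> \<delta>"
  shows "cmod (char (error_law \<nu> f u H S n) s - (\<integral>z. iexp (s * w z / sqrt (real n)) \<partial>J H) ^ n) \<le>
    \<bar>s\<bar> * \<delta> + 2 * measure (sample \<nu> f H n) {\<omega> \<in> space (sample \<nu> f H n). observations n \<omega> \<in> deviation S n \<delta>}"
proof -
  interpret JH: prob_space "J H" by (rule prob_space_joint[OF H])
  interpret PJ: product_sigma_finite "\<lambda>_. J H" by standard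
  let ?M = "sample \<nu> f H n" and ?e = "\<lambda>z. iexp (s * w z / sqrt (real n))"
  let ?o = "observations n"
  interpret M: prob_space ?M by (rule prob_space_sample[OF H])
  have M: "?M = (\<Pi>\<^sub>M j\<in>{..<n}. J H)" by (simp add: sample_def)
  have o [measurable]: "?o \<in> measurable ?M (\<Pi>\<^sub>M j\<in>{..<n}. \<nu>)"
    unfolding sample_def observations_def[abs_def] by (rule observations_measurable[OF fst_measurable_joint[OF H]])
  have "?e \<in> borel_measurable (\<nu> \<Otimes>\<^sub>M T)" by measurable
  then have em [measurable]: "?e \<in> borel_measurable (J H)"
    unfolding borel_measurable_pair_iff(2)[OF H] .
  have ei: "integrable (J H) ?e"
    by (rule JH.integrable_const_bound[OF _ em, of 1]) auto
  have pm: "(\<lambda>\<omega>. \<Prod>j<n. ?e (\<omega> j)) \<in> borel_measurable ?M"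
    unfolding M by measurable
  have Am: "(\<lambda>\<omega>. A S s n (?o \<omega>)) \<in> borel_measurable ?M"
    by (rule measurable_compose[OF o A_measurable[where S = S and n = n, OF S]])
  have n1: "cmod (\<Prod>j<n. ?e (\<omega> j)) = 1" for \<omega> :: "nat \<Rightarrow> 'x \<times> 't"
    by (simp add: prod_norm[symmetric])
  have i1: "integrable ?M (\<lambda>\<omega>. A S s n (?o \<omega>) * (\<Prod>j<n. ?e (\<omega> j)))"
    by (rule M.integrable_const_bound[of _ 1])
      (use Am pm in \<open>auto simp only: norm_mult n1 mult_1_right norm_A intro!: AE_I2 borel_measurable_times\<close>)
  have i2: "integrable ?M (\<lambda>\<omega>. \<Prod>j<n. ?e (\<omega> j))"
    by (rule M.integrable_const_bound[of _ 1]) (use pm n1 in auto)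
  have "(\<integral>z. ?e z \<partial>J H) ^ n = (\<integral>\<omega>. (\<Prod>j<n. ?e (\<omega> j)) \<partial>?M)"
    unfolding M using ei by (subst PJ.product_integral_prod) auto
  then have eq: "char (error_law \<nu> f u H S n) s - (\<integral>z. ?e z \<partial>J H) ^ n =
     (\<integral>\<omega>. A S s n (?o \<omega>) * (\<Prod>j<n. ?e (\<omega> j)) - (\<Prod>j<n. ?e (\<omega> j)) \<partial>?M)"
    using char_error_law[where S = S and n = n, OF H S, of s]
      Bochner_Integration.integral_diff[OF i1 i2] unfolding M observations_def by simp
  have "cmod (char (error_law \<nu> f u H S n) s - (\<integral>z. ?e z \<partial>J H) ^ n) \<le>
      (\<integral>\<omega>. cmod (A S s n (?o \<omega>) * (\<Prod>j<n. ?e (\<omega> j)) - (\<Prod>j<n. ?e (\<omega> j))) \<partial>?M)"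
    unfolding eq by (rule integral_norm_bound)
  also have "\<dots> \<le> (\<integral>\<omega>. \<bar>s\<bar> * \<delta> + 2 * indicator {\<omega> \<in> space ?M. ?o \<omega> \<in> deviation S n \<delta>} \<omega> \<partial>?M)"
  proof (rule integral_mono)
    have E: "{\<omega> \<in> space ?M. ?o \<omega> \<in> deviation S n \<delta>} \<in> sets ?M"
      using deviation_sets[where S = S and n = n, OF S] by measurable
    then show "integrable ?M (\<lambda>\<omega>. \<bar>s\<bar> * \<delta> + 2 * indicator {\<omega> \<in> space ?M. ?o \<omega> \<in> deviation S n \<delta>} \<omega>)"
      by (auto simp: M.emeasure_finite less_top[symmetric])
    fix \<omega> assume \<omega>: "\<omega> \<in> space ?M"
    have "A S s n (?o \<omega>) * (\<Prod>j<n. ?e (\<omega> j)) - (\<Prod>j<n. ?e (\<omega> j)) = (A S s n (?o \<omega>) - 1) * (\<Prod>j<n. ?e (\<omega> j))"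
      by (simp only: left_diff_distrib mult_1_left)
    then have "cmod (A S s n (?o \<omega>) * (\<Prod>j<n. ?e (\<omega> j)) - (\<Prod>j<n. ?e (\<omega> j))) = cmod (A S s n (?o \<omega>) - 1)"
      by (simp only: norm_mult n1 mult_1_right)
    also have "\<dots> \<le> \<bar>s\<bar> * \<delta> + 2 * indicator (deviation S n \<delta>) (?o \<omega>)"
      using norm_A_minus_1_le[OF measurable_space[OF o \<omega>] \<open>0 \<le> \<delta>\<close>] .
    finally show "cmod (A S s n (?o \<omega>) * (\<Prod>j<n. ?e (\<omega> j)) - (\<Prod>j<n. ?e (\<omega> j))) \<le>
        \<bar>s\<bar> * \<delta> + 2 * indicator {\<omega> \<in> space ?M. ?o \<omega> \<in> deviation S n \<delta>} \<omega>"
      using \<omega> by (simp add: indicator_def)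
  qed (use i1 i2 in auto)
  also have "\<dots> = \<bar>s\<bar> * \<delta> + 2 * measure ?M {\<omega> \<in> space ?M. ?o \<omega> \<in> deviation S n \<delta>}"
  proof -
    have E: "{\<omega> \<in> space ?M. ?o \<omega> \<in> deviation S n \<delta>} \<in> sets ?M"
      using deviation_sets[where S = S and n = n, OF S] by measurable
    then have "integrable ?M (indicator {\<omega> \<in> space ?M. ?o \<omega> \<in> deviation S n \<delta>} :: _ \<Rightarrow> real)"
      by (auto simp: M.emeasure_finite less_top[symmetric])
    then show ?thesis using E M.prob_space by simp
  qed
  finally show ?thesis .
qed

text \<open>A central limit theorem under alternatives with possibly infinite variance: after
  multiplication by \<open>n\<close>, the part of \<open>G0\<close> gives minus half of
  \<open>s\<^sup>2 * \<sigma>2\<close>, while the part of \<open>G\<close>, of weight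
  \<open>c / sqrt n\<close>, is only magnified by \<open>sqrt n\<close> and vanishes to first order
  because \<open>w\<close> has mean 0.\<close>

lemma power_integral_tendsto:
  assumes G: "G \<in> LC" and c: "0 < c"
  shows "(\<lambda>n. (\<integral>z. iexp (s * w z / sqrt (real n)) \<partial>J (mix (c / sqrt (real n)) G0 G)) ^ n) \<longlonglongrightarrow> of_real (exp (- (s\<^sup>2 * \<sigma>2 / 2)))"
proof -
  interpret JG: prob_space "J G" by (rule prob_space_joint[OF LC_dist[OF G]])
  let ?e = "\<lambda>n z. iexp (s * w z / sqrt (real n))"
  let ?d = "\<lambda>H n. CLINT z|J H. ?e n z - 1"
  have ei: "integrable (J H) (?e n)" if H: "distribution_on T H" for H n
  proof -
    interpret JH: prob_space "J H" by (rule prob_space_joint[OF H])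
    have "?e n \<in> borel_measurable (\<nu> \<Otimes>\<^sub>M T)" by measurable
    then have "?e n \<in> borel_measurable (J H)"
      unfolding borel_measurable_pair_iff(2)[OF H] .
    from JH.integrable_const_bound[OF _ this, of 1] show ?thesis by simp
  qed
  \<comment> \<open>The value 1 for the small \<open>n\<close> with an invalid mixing weight keeps
    the sequence in the unit disc, as \<open>tendsto_power_exp\<close> requires for all
    \<open>n\<close>.\<close>
  define z where "z n = (if c \<le> sqrt (real n) \<and> 0 < n then (\<integral>z. ?e n z \<partial>J (mix (c / sqrt (real n)) G0 G)) else 1)" for n
  have z_eq: "z n = (\<integral>z. ?e n z \<partial>J (mix (c / sqrt (real n)) G0 G))" if "c \<le> sqrt (real n) \<and> 0 < n" for n
    using that by (simp add: z_def)
  have z1: "norm (z n) \<le> 1" for n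
  proof (cases "c \<le> sqrt (real n) \<and> 0 < n")
    case True
    have H: "distribution_on T (mix (c / sqrt (real n)) G0 G)"
      using True by (intro distribution_on_mix dist0 LC_dist G mix_valid c) auto
    interpret JH: prob_space "J (mix (c / sqrt (real n)) G0 G)" by (rule prob_space_joint[OF H])
    have "norm (z n) \<le> (\<integral>z. norm (?e n z) \<partial>J (mix (c / sqrt (real n)) G0 G))"
      unfolding z_eq[OF True] by (rule integral_norm_bound)
    also have "\<dots> = 1" using JH.prob_space by simp
    finally show ?thesis .
  next
    case False
    then have "z n = 1" unfolding z_def by (rule if_not_P)
    then show ?thesis by simp
  qed
  have zd: "of_nat n * (z n - 1) = of_nat n * ?d G0 n + c * (of_real (sqrt (real n)) * ?d G n - of_real (sqrt (real n)) * ?d G0 n)"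
    if n: "c \<le> sqrt (real n) \<and> 0 < n" for n
  proof -
    have t: "c / sqrt (real n) \<in> {0..1}" using n by (intro mix_valid c) simp
    have d: "?d G0 n = (\<integral>z. ?e n z \<partial>J G0) - 1" "?d G n = (\<integral>z. ?e n z \<partial>J G) - 1"
      using ei[OF dist0] ei[OF LC_dist[OF G]] J0.prob_space JG.prob_space by simp_all
    have zz: "z n - 1 = ?d G0 n + of_real (c / sqrt (real n)) * (?d G n - ?d G0 n)"
      unfolding z_eq[OF n] integral_joint_mix[OF dist0 LC_dist[OF G] t ei[OF dist0] ei[OF LC_dist[OF G]]] d
      by (simp add: algebra_simps)
    have "real n * (c / sqrt (real n)) = c * sqrt (real n)"
      using n by (simp add: field_simps)
    moreover have "of_nat n * of_real x = complex_of_real (real n * x)" for x by simp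
    ultimately have nc: "of_nat n * of_real (c / sqrt (real n)) = complex_of_real (c * sqrt (real n))"
      by (simp only:)
    have "of_nat n * (z n - 1) = of_nat n * ?d G0 n + of_real (c * sqrt (real n)) * (?d G n - ?d G0 n)"
      unfolding zz nc[symmetric] by (simp only: distrib_left mult.assoc)
    also have "\<dots> = of_nat n * ?d G0 n + c * (of_real (sqrt (real n)) * ?d G n - of_real (sqrt (real n)) * ?d G0 n)"
      by (simp only: of_real_mult right_diff_distrib mult.assoc)
    finally show ?thesis .
  qed
  have r: "(\<lambda>n. of_real (sqrt (real n)) * ?d H n) \<longlonglongrightarrow> 0" if "H \<in> LC" for H
    using integral_iexp_first_order[OF w_integrable[OF that], of s] integral_w[OF that] by simp
  have "(\<lambda>n. of_nat n * ?d G0 n + of_real c * (of_real (sqrt (real n)) * ?d G n - of_real (sqrt (real n)) * ?d G0 n))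
      \<longlonglongrightarrow> - (of_real (s\<^sup>2 * \<sigma>2 / 2)) + of_real c * (0 - 0)"
    using integral_iexp_second_order(1)[OF w_integrable[OF G0_LC] w_sq integral_w[OF G0_LC], of s]
    by (intro tendsto_add tendsto_mult tendsto_const tendsto_diff r G G0_LC) simp
  then have lim: "(\<lambda>n. of_nat n * ?d G0 n + of_real c * (of_real (sqrt (real n)) * ?d G n - of_real (sqrt (real n)) * ?d G0 n))
      \<longlonglongrightarrow> - of_real (s\<^sup>2 * \<sigma>2 / 2)" by simp
  have "(\<lambda>n. of_nat n * (z n - 1)) \<longlonglongrightarrow> - of_real (s\<^sup>2 * \<sigma>2 / 2)"
    by (rule Lim_transform_eventually[OF lim]) (use eventually_mix_valid[of c] in eventually_elim, simp only: zd)
  then have "(\<lambda>n. z n ^ n) \<longlonglongrightarrow> of_real (exp (- (s\<^sup>2 * \<sigma>2 / 2)))"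
    by (intro tendsto_power_exp z1) simp_all
  then show ?thesis
    by (rule Lim_transform_eventually) (use eventually_mix_valid[of c] in eventually_elim, simp only: z_eq)
qed

lemma regular_normal:
  assumes S: "estimator_seq \<nu> S"
    and close: "\<And>\<delta>. 0 < \<delta> \<Longrightarrow> (\<lambda>n. measure (sample \<nu> f G0 n)
      {\<omega> \<in> space (sample \<nu> f G0 n). observations n \<omega> \<in> deviation S n \<delta>}) \<longlonglongrightarrow> 0"
  shows "regular_with_limit \<nu> f u \<G> G0 S (distr std_normal_distribution borel (\<lambda>x. sqrt \<sigma>2 * x))"
    (is "regular_with_limit _ _ _ _ _ _ ?L")
  unfolding regular_with_limit_def
proof (intro conjI allI impI ballI S)
  have \<sigma>0: "0 \<le> \<sigma>2" by auto
  show L: "real_distribution ?L" by (rule real_distribution_normal[OF \<sigma>0])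
  fix c :: real and G assume c: "0 < c" and G: "G \<in> LC"
  let ?H = "\<lambda>n. mix (c / sqrt (real n)) G0 G"
  have Sn: "S n \<in> borel_measurable (\<Pi>\<^sub>M j\<in>{..<n}. \<nu>)" for n using S by (simp add: estimator_seq_def)
  have char: "(\<lambda>n. char (error_law \<nu> f u (?H n) S n) s) \<longlonglongrightarrow> char ?L s" for s
  proof -
    let ?z = "\<lambda>n. (\<integral>z. iexp (s * w z / sqrt (real n)) \<partial>J (?H n)) ^ n"
    let ?d = "\<lambda>n. char (error_law \<nu> f u (?H n) S n) s - ?z n"
    have "?d \<longlonglongrightarrow> 0"
    proof (rule tendstoI)
      fix e :: real assume e: "0 < e"
      \<comment> \<open>Half of \<open>e\<close> goes to the deviation bound; the other half is
        twice a probability below \<open>e / 4\<close>. The added 1 covers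
        \<open>s = 0\<close>.\<close>
      define \<delta> where "\<delta> = e / (2 * (\<bar>s\<bar> + 1))"
      have \<delta>: "0 < \<delta>" using e by (simp add: \<delta>_def)
      have "\<bar>s\<bar> * \<delta> \<le> e / 2"
        using e by (simp add: \<delta>_def field_simps)
      moreover have "\<forall>\<^sub>F n in sequentially. measure (sample \<nu> f (?H n) n)
          {\<omega> \<in> space (sample \<nu> f (?H n) n). observations n \<omega> \<in> deviation S n \<delta>} < e / 4"
        using e by (intro order_tendstoD(2)[OF contiguous[OF G c deviation_sets[OF Sn] close[OF \<delta>]]]) auto
      then show "\<forall>\<^sub>F n in sequentially. dist (?d n) 0 < e"
        using eventually_mix_valid[of c]
      proof eventually_elim
        case (elim n)
        have H: "distribution_on T (?H n)"
          using elim by (intro distribution_on_mix dist0 LC_dist G mix_valid c) auto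
        show ?case
          using char_error_law_approx[where S = S and n = n, OF H Sn less_imp_le[OF \<delta>], of s] elim(1) \<open>\<bar>s\<bar> * \<delta> \<le> e / 2\<close>
          unfolding dist_norm diff_zero by linarith
      qed
    qed
    from tendsto_add[OF this power_integral_tendsto[OF G c, of s]] show ?thesis
      by (simp add: char_normal[OF \<sigma>0])
  qed
  obtain N where N: "\<And>n. N \<le> n \<Longrightarrow> c \<le> sqrt (real n)"
    using eventually_mix_valid[of c] by (auto simp: eventually_sequentially)
  have "weak_conv_m (\<lambda>n. error_law \<nu> f u (?H (n + N)) S (n + N)) ?L"
  proof (rule levy_continuity[OF _ L])
    show "real_distribution (error_law \<nu> f u (?H (n + N)) S (n + N))" for n
      by (intro real_distribution_error_law distribution_on_mix dist0 LC_dist G mix_valid c N Sn) auto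
    show "(\<lambda>n. char (error_law \<nu> f u (?H (n + N)) S (n + N)) s) \<longlonglongrightarrow> char ?L s" for s
      by (rule LIMSEQ_ignore_initial_segment[OF char])
  qed
  then show "weak_conv_m (\<lambda>n. error_law \<nu> f u (?H n) S n) ?L"
    using weak_conv_m_ignore_initial[of "\<lambda>n. error_law \<nu> f u (?H n) S n" N ?L] by simp
qed

text \<open>The estimator itself is regular with a centred normal limit of variance \<sigma>2, so it
  attains the lower bound and identifies the infimum; for a centred limit, second moment and
  variance agree.\<close>

lemma asymptotically_efficient_if_close:
  assumes S: "estimator_seq \<nu> S"
    and close: "\<And>\<delta>. 0 < \<delta> \<Longrightarrow> (\<lambda>n. measure (sample \<nu> f G0 n)
      {\<omega> \<in> space (sample \<nu> f G0 n). observations n \<omega> \<in> deviation S n \<delta>}) \<longlonglongrightarrow> 0"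
  shows "asymptotically_efficient \<nu> f u \<G> G0 S"
proof -
  let ?L = "distr std_normal_distribution borel (\<lambda>x. sqrt \<sigma>2 * x)"
  have \<sigma>0: "0 \<le> \<sigma>2" by auto
  have reg: "regular_with_limit \<nu> f u \<G> G0 S ?L" by (rule regular_normal[OF assms])
  have "variance_bound \<nu> f u \<G> G0 = ennreal \<sigma>2"
    unfolding variance_bound_def
  proof (rule antisym)
    show "Inf {law_variance L |L. \<exists>S. regular_with_limit \<nu> f u \<G> G0 S L} \<le> ennreal \<sigma>2"
      unfolding law_variance_normal[OF \<sigma>0, symmetric] using reg by (intro Inf_lower) blast
    show "ennreal \<sigma>2 \<le> Inf {law_variance L |L. \<exists>S. regular_with_limit \<nu> f u \<G> G0 S L}"
      by (rule Inf_greatest) (auto intro: law_variance_regular_ge)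
  qed
  then show ?thesis
    unfolding asymptotically_efficient_def using reg law_second_moment_normal[OF \<sigma>0] by auto
qed

text \<open>A large deviation forces one of three events: the estimate leaves \<G>s, it is far from
  \<open>G0\<close> in norm, or the supremum is large. These events need not be measurable, so the
  union bound is taken for outer measures.\<close>

lemma deviation_tendsto_0:
  fixes v :: "'t measure \<Rightarrow> 'x \<Rightarrow> real" and Ghat :: "nat \<Rightarrow> (nat \<Rightarrow> 'x) \<Rightarrow> 't measure"
  assumes v0: "v G0 = v0"
    and equi: "tendsto_0_in_prob (\<lambda>(\<epsilon>, n). sample \<nu> f G0 n)
             (\<lambda>(\<epsilon>, n) \<omega>.
                SUP G\<in>{G \<in> \<G>s. norm_G \<nu> f G0 (\<lambda>x. v G x - v G0 x) \<le> ennreal \<epsilon>}.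
                  ennreal \<bar>\<Sum>j<n. (v G (observations n \<omega> j) - v G0 (observations n \<omega> j))
                                    / sqrt (real n)\<bar>)
             (at_right (0::real) \<times>\<^sub>F sequentially)"
    and est: "estimator_seq \<nu> (\<lambda>n x. \<Sum>j<n. v (Ghat n x) (x j))"
    and Gs: "(\<lambda>n. outer_measure_of (sample \<nu> f G0 n)
              {\<omega> \<in> space (sample \<nu> f G0 n). Ghat n (observations n \<omega>) \<notin> \<G>s}) \<longlonglongrightarrow> 0"
    and cons: "tendsto_0_in_prob (sample \<nu> f G0)
             (\<lambda>n \<omega>. norm_G \<nu> f G0 (\<lambda>x. v (Ghat n (observations n \<omega>)) x - v G0 x))
             sequentially"
    and \<delta>: "0 < \<delta>"
  shows "(\<lambda>n. measure (sample \<nu> f G0 n) {\<omega> \<in> space (sample \<nu> f G0 n).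
      observations n \<omega> \<in> deviation (\<lambda>n x. \<Sum>j<n. v (Ghat n x) (x j)) n \<delta>}) \<longlonglongrightarrow> 0"
proof -
  let ?M = "sample \<nu> f G0" and ?S = "\<lambda>n x. \<Sum>j<n. v (Ghat n x) (x j)"
  let ?E = "\<lambda>n. {\<omega> \<in> space (?M n). observations n \<omega> \<in> deviation ?S n \<delta>}"
  let ?Y = "\<lambda>\<epsilon> n \<omega>. SUP G\<in>{G \<in> \<G>s. norm_G \<nu> f G0 (\<lambda>x. v G x - v G0 x) \<le> ennreal \<epsilon>}.
      ennreal \<bar>\<Sum>j<n. (v G (observations n \<omega> j) - v G0 (observations n \<omega> j)) / sqrt (real n)\<bar>"
  let ?E1 = "\<lambda>n. {\<omega> \<in> space (?M n). Ghat n (observations n \<omega>) \<notin> \<G>s}"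
  let ?E2 = "\<lambda>\<epsilon> n. {\<omega> \<in> space (?M n). norm_G \<nu> f G0 (\<lambda>x. v (Ghat n (observations n \<omega>)) x - v G0 x) > ennreal \<epsilon>}"
  let ?E3 = "\<lambda>\<epsilon> n. {\<omega> \<in> space (?M n). ?Y \<epsilon> n \<omega> > ennreal \<delta>}"
  have sub: "?E n \<subseteq> ?E1 n \<union> ?E2 \<epsilon> n \<union> ?E3 \<epsilon> n" for \<epsilon> n
  proof
    fix \<omega> assume \<omega>: "\<omega> \<in> ?E n"
    let ?x = "observations n \<omega>"
    let ?G = "Ghat n ?x"
    let ?y = "\<bar>\<Sum>j<n. (v ?G (?x j) - v G0 (?x j)) / sqrt (real n)\<bar>"
    show "\<omega> \<in> ?E1 n \<union> ?E2 \<epsilon> n \<union> ?E3 \<epsilon> n"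
    proof (rule ccontr)
      assume not: "\<omega> \<notin> ?E1 n \<union> ?E2 \<epsilon> n \<union> ?E3 \<epsilon> n"
      have "?y = \<bar>?S n ?x - (\<Sum>j<n. v0 (?x j))\<bar> / sqrt (real n)"
        by (simp add: v0 sum_subtractf flip: sum_divide_distrib)
      then have "\<delta> < ?y" using \<omega> by (simp add: deviation_def)
      then have "ennreal \<delta> < ennreal ?y" using \<delta> by (simp add: ennreal_lessI)
      \<comment> \<open>Outside the first two events the estimate is itself an index of the
        supremum.\<close>
      also have "ennreal ?y \<le> ?Y \<epsilon> n \<omega>"
        using not \<omega> by (intro SUP_upper) (auto simp: not_less)
      finally show False using not \<omega> by auto
    qed
  qed
  have lim: "(\<lambda>n. emeasure (?M n) (?E n)) \<longlonglongrightarrow> 0"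
  proof (rule order_tendstoI)
    fix a :: ennreal assume a: "0 < a"
    obtain \<eta> :: real where \<eta>: "0 < \<eta>" "ennreal (3 * \<eta>) < a"
    proof -
      obtain b where b: "0 < b" "b < a" using dense[OF a] by blast
      then have "b = ennreal (enn2real b)" by (metis ennreal_enn2real order_less_le_trans top_greatest)
      moreover from this b have "0 < enn2real b" by (metis ennreal_0 enn2real_nonneg less_irrefl order_le_less)
      ultimately show ?thesis using b by (intro that[of "enn2real b / 3"]) auto
    qed
    have "((\<lambda>i. outer_measure_of ((\<lambda>(\<epsilon>, n). ?M n) i) {\<omega> \<in> space ((\<lambda>(\<epsilon>, n). ?M n) i). (\<lambda>(\<epsilon>, n) \<omega>. ?Y \<epsilon> n \<omega>) i \<omega> > ennreal \<delta>}) \<longlongrightarrow> 0)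
        (at_right (0::real) \<times>\<^sub>F sequentially)"
      using equi \<delta> unfolding tendsto_0_in_prob_def by blast
    from order_tendstoD(2)[OF this, of "ennreal \<eta>"] \<eta>
    have "\<forall>\<^sub>F (\<epsilon>, n) in at_right (0::real) \<times>\<^sub>F sequentially. outer_measure_of (?M n) (?E3 \<epsilon> n) < ennreal \<eta>"
      by (simp add: split_beta')
    \<comment> \<open>Smallness on the product filter holds for all small \<epsilon> and all large
      \<open>n\<close> independently. Hence one positive \<epsilon> can be fixed before
      \<open>n\<close> grows, which consistency at that \<epsilon> requires.\<close>
    then obtain Pf Pg where Pf: "eventually Pf (at_right (0::real))" and Pg: "eventually Pg sequentially"
      and P: "\<And>\<epsilon> n. Pf \<epsilon> \<Longrightarrow> Pg n \<Longrightarrow> outer_measure_of (?M n) (?E3 \<epsilon> n) < ennreal \<eta>"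
      unfolding eventually_prod_filter by auto
    have "eventually (\<lambda>\<epsilon>. Pf \<epsilon> \<and> 0 < \<epsilon>) (at_right (0::real))"
      using Pf eventually_at_right_less by (rule eventually_conj)
    then obtain \<epsilon> where \<epsilon>: "Pf \<epsilon>" "0 < \<epsilon>"
      using eventually_happens'[of "at_right (0::real)"] by auto
    have e2: "(\<lambda>n. outer_measure_of (?M n) (?E2 \<epsilon> n)) \<longlonglongrightarrow> 0"
      using cons \<epsilon>(2) unfolding tendsto_0_in_prob_def by blast
    have \<eta>': "0 < ennreal \<eta>" using \<eta> by simp
    show "\<forall>\<^sub>F n in sequentially. emeasure (?M n) (?E n) < a"
      using order_tendstoD(2)[OF Gs \<eta>'] order_tendstoD(2)[OF e2 \<eta>'] Pg
    proof eventually_elim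
      case (elim n)
      have "emeasure (?M n) (?E n) = outer_measure_of (?M n) (?E n)"
      proof (rule outer_measure_of_eq[symmetric])
        have [measurable]: "observations n \<in> measurable (?M n) (\<Pi>\<^sub>M j\<in>{..<n}. \<nu>)"
          unfolding sample_def observations_def[abs_def] by (rule observations_measurable[OF fst_measurable_joint[OF dist0]])
        have "?S n \<in> borel_measurable (\<Pi>\<^sub>M j\<in>{..<n}. \<nu>)"
          using est by (simp add: estimator_seq_def)
        note [measurable] = deviation_sets[where S = ?S and n = n, OF this]
        show "?E n \<in> sets (?M n)" by measurable
      qed
      also have "\<dots> \<le> outer_measure_of (?M n) (?E1 n \<union> ?E2 \<epsilon> n \<union> ?E3 \<epsilon> n)"
        by (rule outer_measure_of_mono[OF sub])
      also have "\<dots> \<le> outer_measure_of (?M n) (?E1 n \<union> ?E2 \<epsilon> n) + outer_measure_of (?M n) (?E3 \<epsilon> n)"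
        by (rule outer_measure_of_Un_le) auto
      also have "\<dots> \<le> outer_measure_of (?M n) (?E1 n) + outer_measure_of (?M n) (?E2 \<epsilon> n) + outer_measure_of (?M n) (?E3 \<epsilon> n)"
        by (intro add_right_mono outer_measure_of_Un_le) auto
      also have "\<dots> \<le> ennreal \<eta> + ennreal \<eta> + ennreal \<eta>"
        using elim P[OF \<epsilon>(1)] by (intro add_mono) (auto intro: less_imp_le)
      also have "\<dots> = ennreal (3 * \<eta>)" using \<eta> by (simp flip: ennreal_plus)
      also have "\<dots> < a" by (rule \<eta>)
      finally show ?case .
    qed
  qed simp
  from lim have "(\<lambda>n. emeasure (?M n) (?E n)) \<longlonglongrightarrow> ennreal 0" by simp
  from tendsto_enn2real[OF this] show ?thesis by (simp add: measure_def)
qed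

end

theorem theorem2p4:
  fixes \<nu> :: "'x measure" and T :: "'t measure"
    and f u :: "'x \<Rightarrow> 't \<Rightarrow> real"
    and \<G> \<G>s :: "'t measure set"
    and v :: "'t measure \<Rightarrow> 'x \<Rightarrow> real"
    and Ghat :: "nat \<Rightarrow> (nat \<Rightarrow> 'x) \<Rightarrow> 't measure"
  assumes "sigma_finite_measure \<nu>"
    and "kernel_density \<nu> T f"
    and "case_prod u \<in> borel_measurable (\<nu> \<Otimes>\<^sub>M T)"
    and "\<And>G. G \<in> \<G> \<Longrightarrow> distribution_on T G"
    and "convex_class \<G>"
    and "\<And>G. G \<in> \<G> \<Longrightarrow> integrable (joint \<nu> f G) (\<lambda>(x, \<theta>). (u x \<theta>)\<^sup>2)"
    and "\<G>s \<subseteq> \<G>"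
    and "square_integrable_unbiased_functions \<nu> f u \<G>s \<noteq> {}"
    and "\<And>G0. G0 \<in> \<G>s \<Longrightarrow>
           is_arg_min (mean_square_error \<nu> f u G0)
             (\<lambda>w. w \<in> local_unbiased_functions \<nu> f u \<G> G0) (v G0)"
    and "\<And>G0. G0 \<in> \<G>s \<Longrightarrow> v G0 \<in> square_integrable_unbiased_functions \<nu> f u \<G>s"
    and "\<And>G0. G0 \<in> \<G>s \<Longrightarrow>
           tendsto_0_in_prob (\<lambda>(\<epsilon>, n). sample \<nu> f G0 n)
             (\<lambda>(\<epsilon>, n) \<omega>.
                SUP G\<in>{G \<in> \<G>s. norm_G \<nu> f G0 (\<lambda>x. v G x - v G0 x) \<le> ennreal \<epsilon>}.
                  ennreal \<bar>\<Sum>j<n. (v G (observations n \<omega> j) - v G0 (observations n \<omega> j))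
                                    / sqrt (real n)\<bar>)
             (at_right (0::real) \<times>\<^sub>F sequentially)"
    and "estimator_seq \<nu> (\<lambda>n x. \<Sum>j<n. v (Ghat n x) (x j))"
    and "\<And>G0. G0 \<in> \<G>s \<Longrightarrow>
           (\<lambda>n. outer_measure_of (sample \<nu> f G0 n)
              {\<omega> \<in> space (sample \<nu> f G0 n). Ghat n (observations n \<omega>) \<notin> \<G>s}) \<longlonglongrightarrow> 0"
    and "\<And>G0. G0 \<in> \<G>s \<Longrightarrow>
           tendsto_0_in_prob (sample \<nu> f G0)
             (\<lambda>n \<omega>. norm_G \<nu> f G0 (\<lambda>x. v (Ghat n (observations n \<omega>)) x - v G0 x))
             sequentially"
  shows "\<forall>G0\<in>\<G>s. asymptotically_efficient \<nu> f u \<G> G0 (\<lambda>n x. \<Sum>j<n. v (Ghat n x) (x j))"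
proof
  fix G0 assume mem: "G0 \<in> \<G>s"
  interpret sigma_finite_measure \<nu> by fact
  interpret local_model \<nu> T f u \<G> G0 "v G0"
  proof unfold_locales
    \<comment> \<open>The second moment under \<open>G0\<close> itself comes from \<open>G0\<close>
      being a member of \<G>s.\<close>
    show "integrable (joint \<nu> f G0) (\<lambda>(x, \<theta>). (v G0 x)\<^sup>2)"
      using assms(10)[OF mem] mem by (simp add: square_integrable_unbiased_functions_def)
  qed (use mem assms(2-7) assms(9)[OF mem] in auto)
  show "asymptotically_efficient \<nu> f u \<G> G0 (\<lambda>n x. \<Sum>j<n. v (Ghat n x) (x j))"
    by (rule asymptotically_efficient_if_close[OF assms(12)
          deviation_tendsto_0[OF refl assms(11)[OF mem] assms(12) assms(13)[OF mem] assms(14)[OF mem]]])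
qed

end
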